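(* Let $\Gamma$ be a constraint language on a finite set $D$ containing only binary relations, such that $\Gamma$ has an $(n+1)$-ary near-unanimity polymorphism ($n\ge 2$). If an instance $\mathcal I$ of $\mathrm{CSP}(\Gamma)$ satisfies condition $(\mathrm{IPQ})_n$, then $\mathcal I$ is satisfiable (i.e. some assignment satisfies all its constraints).
   Context: An instance of $\mathrm{CSP}(\Gamma)$ is $\mathcal I=(V,\mathcal C)$ with $V$ a finite set of variables and $\mathcal C$ a finite set of constraints $((x,y),R)$ with $x,y\in V$ and $R\in\Gamma$ binary. A polymorphism of $\Gamma$ is an operation $f:D^{n+1}\to D$ such that for each $R\in\Gamma$ and $(a_i,b_i)\in R$ ($1\le i\le n+1$) we have $(f(a_1,\dots,a_{n+1}),f(b_1,\dots,b_{n+1}))\in R$; it is near-unanimity if $f(y,x,\dots,x)=f(x,y,x,\dots,x)=\dots=f(x,\dots,x,y)=x$ for all $x,y\in D$. A pattern in $\mathcal I$ is a finite directed multigraph $p$ whose vertices are labeled by variables of $\mathcal I$ and whose edges are labeled by constraints of $\mathcal I$, so that an edge labeled $((x,y),R)$ starts at a vertex labeled $x$ and ends at a vertex labeled $y$, together with two distinguished vertices, its beginning and end; if they are labeled $x$ and $y$, $p$ is a pattern from $x$ to $y$. If the end of $p$ and the beginning of $q$ carry the same label, $p+q$ is obtained from the disjoint union of $p$ and $q$ by identifying the end of $p$ with the beginning of $q$, with beginning that of $p$ and end that of $q$; $jp$ denotes $p+\dots+p$ ($j$ copies), and $0p$ is the one-vertex pattern (so $0(p+q)+p=p$). An $n$-tree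 pattern is a pattern whose underlying graph is an orientation of a tree with at most $n$ leaves, whose beginning and end are both leaves. A path of $n$-trees is a pattern of the form $t_1+\dots+t_j$ with each $t_i$ an $n$-tree pattern. A realization of $p$ is a map $r$ from the vertices of $p$ to $D$ such that $(r(u),r(v))\in R$ for every edge $(u,v)$ labeled $((x,y),R)$ (vertices with the same label may receive different values). Given non-empty sets $D^\ell_x\subseteq D$ ($x\in V$, $1\le\ell\le|D|+1$), an $\ell$-realization of $p$ is a realization $r$ with $r(v)\in D^{\ell+1}_x$ for each vertex $v$ labeled $x$; for $A\subseteq D$ and $p$ with beginning $b$ and end $e$, $A+^\ell p=\{r(e): r\text{ an }\ell\text{-realization of }p,\ r(b)\in A\}$. Condition $(\mathrm{IPQ})_n$: for every $y\in V$ there are non-empty sets $D^1_y\subseteq D^2_y\subseteq\dots\subseteq D^{|D|}_y\subseteq D^{|D|+1}_y=D$ such that for every $x\in V$, every $\ell\le|D|$, every $a\in D^\ell_x$, and every two patterns $p,q$ from $x$ to $x$ which are paths of $n$-trees in $\mathcal I$, there exists an integer $j\ge0$ with $a\in\{a\}+^\ell(j(p+q)+p)$. *)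

theory Defs
  imports
    "Graph_Theory.Digraph_Component"
    "Graph_Theory.Vertex_Walk"
    "HOL-Library.Nat_Bijection"
begin

section \<open>Instances and polymorphisms\<close>

type_synonym ('x, 'd) bin_constraint = "('x \<times> 'x) \<times> ('d \<times> 'd) set"

definition binary_language :: "'d set \<Rightarrow> ('d \<times> 'd) set set \<Rightarrow> bool" where
  "binary_language D \<Gamma> \<longleftrightarrow> (\<forall>R\<in>\<Gamma>. R \<subseteq> D \<times> D)"

definition csp_instance ::
    "('d \<times> 'd) set set \<Rightarrow> 'x set \<Rightarrow> ('x, 'd) bin_constraint set \<Rightarrow> bool" where
  "csp_instance \<Gamma> V C \<longleftrightarrow> finite V \<and> finite C \<and>
     (\<forall>((x, y), R)\<in>C. x \<in> V \<and> y \<in> V \<and> R \<in> \<Gamma>)"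

definition satisfiable :: "'d set \<Rightarrow> 'x set \<Rightarrow> ('x, 'd) bin_constraint set \<Rightarrow> bool" where
  "satisfiable D V C \<longleftrightarrow>
     (\<exists>s. (\<forall>x\<in>V. s x \<in> D) \<and> (\<forall>((x, y), R)\<in>C. (s x, s y) \<in> R))"

text \<open>A \<open>k\<close>-ary operation on \<open>D\<close> is a function on lists, of which only the values on
  lists of length \<open>k\<close> over \<open>D\<close> matter.\<close>

definition operation :: "nat \<Rightarrow> 'd set \<Rightarrow> ('d list \<Rightarrow> 'd) \<Rightarrow> bool" where
  "operation k D f \<longleftrightarrow> (\<forall>as. length as = k \<and> set as \<subseteq> D \<longrightarrow> f as \<in> D)"

definition polymorphism ::
    "nat \<Rightarrow> 'd set \<Rightarrow> ('d \<times> 'd) set set \<Rightarrow> ('d list \<Rightarrow> 'd) \<Rightarrow> bool" where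
  "polymorphism k D \<Gamma> f \<longleftrightarrow> operation k D f \<and>
     (\<forall>R\<in>\<Gamma>. \<forall>ps. length ps = k \<and> set ps \<subseteq> R \<longrightarrow> (f (map fst ps), f (map snd ps)) \<in> R)"

definition near_unanimity :: "nat \<Rightarrow> 'd set \<Rightarrow> ('d list \<Rightarrow> 'd) \<Rightarrow> bool" where
  "near_unanimity k D f \<longleftrightarrow> (\<forall>x\<in>D. \<forall>y\<in>D. \<forall>i<k. f ((replicate k x)[i := y]) = x)"

section \<open>Orientations of trees\<close>

text \<open>The library predicate \<^const>\<open>tree\<close> only excludes directed cycles, hence is not
  the notion required here. A cycle of the underlying undirected graph is given by its list of
  pairwise distinct vertices; loops and pairs of parallel or antiparallel arcs do not yield such
  a list and are excluded separately.\<close>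

definition undirected_cycle :: "('v, 'e) pre_digraph \<Rightarrow> 'v list \<Rightarrow> bool" where
  "undirected_cycle G c \<longleftrightarrow> 3 \<le> length c \<and> vpath c (mk_symmetric G) \<and>
     (last c, hd c) \<in> arcs_ends (mk_symmetric G)"

definition oriented_tree :: "('v, 'e) pre_digraph \<Rightarrow> bool" where
  "oriented_tree G \<longleftrightarrow> loopfree_digraph G \<and>
     inj_on (\<lambda>e. {tail G e, head G e}) (arcs G) \<and>
     connected G \<and> (\<nexists>c. undirected_cycle G c)"

definition leaves :: "('v, 'e) pre_digraph \<Rightarrow> 'v set" where
  "leaves G = {v \<in> verts G. in_degree G v + out_degree G v = 1}"

section \<open>Patterns\<close>

text \<open>Every finite multigraph is isomorphic to one whose vertices and arcs are natural numbers.\<close>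

record ('x, 'd) pattern =
  graph_of :: "(nat, nat) pre_digraph"
  vlabel :: "nat \<Rightarrow> 'x"
  elabel :: "nat \<Rightarrow> ('x, 'd) bin_constraint"
  beginning :: nat
  ending :: nat

definition pattern_in ::
    "'x set \<Rightarrow> ('x, 'd) bin_constraint set \<Rightarrow> ('x, 'd) pattern \<Rightarrow> bool" where
  "pattern_in V C p \<longleftrightarrow> fin_digraph (graph_of p) \<and>
     (\<forall>v\<in>verts (graph_of p). vlabel p v \<in> V) \<and>
     (\<forall>e\<in>arcs (graph_of p). elabel p e \<in> C \<and>
        fst (elabel p e) = (vlabel p (tail (graph_of p) e), vlabel p (head (graph_of p) e))) \<and>
     beginning p \<in> verts (graph_of p) \<and> ending p \<in> verts (graph_of p)"

definition pattern_from_to :: "('x, 'd) pattern \<Rightarrow> 'x \<Rightarrow> 'x \<Rightarrow> bool" where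
  "pattern_from_to p x y \<longleftrightarrow> vlabel p (beginning p) = x \<and> vlabel p (ending p) = y"

text \<open>The disjoint union is formed with \<^const>\<open>sum_encode\<close>; \<open>pinr p q\<close>
  embeds the vertices of \<open>q\<close>, sending the beginning of \<open>q\<close> to the end of \<open>p\<close>.\<close>

definition pinl :: "nat \<Rightarrow> nat" where
  "pinl v = sum_encode (Inl v)"

definition pinr :: "('x, 'd) pattern \<Rightarrow> ('x, 'd) pattern \<Rightarrow> nat \<Rightarrow> nat" where
  "pinr p q v = (if v = beginning q then pinl (ending p) else sum_encode (Inr v))"

definition psum :: "('x, 'd) pattern \<Rightarrow> ('x, 'd) pattern \<Rightarrow> ('x, 'd) pattern"
    (infixl \<open>\<oplus>\<^sub>p\<close> 65) where
  "p \<oplus>\<^sub>p q =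
    \<lparr> graph_of =
        \<lparr> verts = pinl ` verts (graph_of p) \<union> pinr p q ` verts (graph_of q),
          arcs = sum_encode ` (arcs (graph_of p) <+> arcs (graph_of q)),
          tail = (\<lambda>e. case sum_decode e of Inl e' \<Rightarrow> pinl (tail (graph_of p) e')
                                         | Inr e' \<Rightarrow> pinr p q (tail (graph_of q) e')),
          head = (\<lambda>e. case sum_decode e of Inl e' \<Rightarrow> pinl (head (graph_of p) e')
                                         | Inr e' \<Rightarrow> pinr p q (head (graph_of q) e')) \<rparr>,
      vlabel = (\<lambda>v. case sum_decode v of Inl v' \<Rightarrow> vlabel p v' | Inr v' \<Rightarrow> vlabel q v'),
      elabel = (\<lambda>e. case sum_decode e of Inl e' \<Rightarrow> elabel p e' | Inr e' \<Rightarrow> elabel q e'),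
      beginning = pinl (beginning p),
      ending = pinr p q (ending q) \<rparr>"

definition one_vertex_pattern :: "'x \<Rightarrow> ('x, 'd) pattern" where
  "one_vertex_pattern x =
    \<lparr> graph_of = \<lparr> verts = {0}, arcs = {}, tail = (\<lambda>_. 0), head = (\<lambda>_. 0) \<rparr>,
      vlabel = (\<lambda>_. x), elabel = (\<lambda>_. undefined), beginning = 0, ending = 0 \<rparr>"

primrec pmult :: "nat \<Rightarrow> ('x, 'd) pattern \<Rightarrow> ('x, 'd) pattern" where
  "pmult 0 p = one_vertex_pattern (vlabel p (beginning p))"
| "pmult (Suc j) p = pmult j p \<oplus>\<^sub>p p"

definition n_tree_pattern ::
    "'x set \<Rightarrow> ('x, 'd) bin_constraint set \<Rightarrow> nat \<Rightarrow> ('x, 'd) pattern \<Rightarrow> bool" where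
  "n_tree_pattern V C n p \<longleftrightarrow> pattern_in V C p \<and> oriented_tree (graph_of p) \<and>
     card (leaves (graph_of p)) \<le> n \<and>
     beginning p \<in> leaves (graph_of p) \<and> ending p \<in> leaves (graph_of p)"

inductive path_of_n_trees ::
    "'x set \<Rightarrow> ('x, 'd) bin_constraint set \<Rightarrow> nat \<Rightarrow> ('x, 'd) pattern \<Rightarrow> bool"
  for V C n where
  single: "n_tree_pattern V C n t \<Longrightarrow> path_of_n_trees V C n t"
| append: "\<lbrakk>path_of_n_trees V C n p; n_tree_pattern V C n t;
            vlabel p (ending p) = vlabel t (beginning t)\<rbrakk>
           \<Longrightarrow> path_of_n_trees V C n (p \<oplus>\<^sub>p t)"

section \<open>Realizations and the consistency condition\<close>

definition realization :: "'d set \<Rightarrow> ('x, 'd) pattern \<Rightarrow> (nat \<Rightarrow> 'd) \<Rightarrow> bool" where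
  "realization D p r \<longleftrightarrow> (\<forall>v\<in>verts (graph_of p). r v \<in> D) \<and>
     (\<forall>e\<in>arcs (graph_of p).
        (r (tail (graph_of p) e), r (head (graph_of p) e)) \<in> snd (elabel p e))"

text \<open>A family \<open>Ds\<close> assigns to a level \<open>l\<close> and a variable \<open>x\<close> the set \<open>D\<^sup>l\<^sub>x\<close>.\<close>

definition l_realization ::
    "'d set \<Rightarrow> (nat \<Rightarrow> 'x \<Rightarrow> 'd set) \<Rightarrow> nat \<Rightarrow> ('x, 'd) pattern \<Rightarrow> (nat \<Rightarrow> 'd) \<Rightarrow> bool" where
  "l_realization D Ds l p r \<longleftrightarrow> realization D p r \<and>
     (\<forall>v\<in>verts (graph_of p). r v \<in> Ds (l + 1) (vlabel p v))"

definition l_add ::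
    "'d set \<Rightarrow> (nat \<Rightarrow> 'x \<Rightarrow> 'd set) \<Rightarrow> nat \<Rightarrow> 'd set \<Rightarrow> ('x, 'd) pattern \<Rightarrow> 'd set" where
  "l_add D Ds l A p = {r (ending p) | r. l_realization D Ds l p r \<and> r (beginning p) \<in> A}"

definition IPQ ::
    "nat \<Rightarrow> 'd set \<Rightarrow> 'x set \<Rightarrow> ('x, 'd) bin_constraint set \<Rightarrow> bool" where
  "IPQ n D V C \<longleftrightarrow> (\<exists>Ds :: nat \<Rightarrow> 'x \<Rightarrow> 'd set.
     (\<forall>y\<in>V. (\<forall>l\<in>{1..card D + 1}. Ds l y \<noteq> {}) \<and>
            (\<forall>l\<in>{1..card D}. Ds l y \<subseteq> Ds (l + 1) y) \<and>
            Ds (card D + 1) y = D) \<and>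
     (\<forall>x\<in>V. \<forall>l\<in>{1..card D}. \<forall>a\<in>Ds l x. \<forall>p q.
        path_of_n_trees V C n p \<and> pattern_from_to p x x \<and>
        path_of_n_trees V C n q \<and> pattern_from_to q x x \<longrightarrow>
        (\<exists>j. a \<in> l_add D Ds l {a} (pmult j (p \<oplus>\<^sub>p q) \<oplus>\<^sub>p p))))"

end

theory Submission
  imports Defs
begin

text \<open>
  Close the sets \<open>D\<^sup>l\<^sub>x\<close> under the near-unanimity operation; the return condition survives. For every
  variable \<open>x\<close> the chain of the \<open>D\<^sup>l\<^sub>x\<close> is constant at some level \<open>l \<le> card D\<close>, and the variables are assigned
  level by level. The invariant says that every tree with at most \<open>n\<close> leaves, some of which carry assigned
  variables, can be realized at level \<open>l\<close> with the prescribed values at these leaves.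

  The trees whose leaves are assigned or about to be assigned at level \<open>l\<close> form a multisorted instance. Its
  arc-consistent closure is non-empty: by the Helly property of near-unanimity it suffices to prescribe at most
  \<open>n\<close> leaves at a time, the tree spanned by them is realized by the invariant, and the dropped branches extend
  by the return condition.

  In a minimal arc-consistent family that absorbs one deviating argument, all sets are singletons. Otherwise
  take a proper subset that absorbs a maximal number \<open>k\<close> of deviating arguments and propagate it along paths.
  By the return condition the proper images are unique for every label, and by maximality of \<open>k\<close> every tree
  evaluates them to a proper image or to the full set; this yields a smaller family.
\<close>

section \<open>Trees of hyperedges\<close>

text \<open>The return condition compares two adjacent levels: a value of level \<open>l\<close>
  returns through realizations with values of level \<open>l + 1\<close>. Only where both levels
  agree does it become a statement about one instance, and this dictates the order of assignment.

  The bound \<open>n\<close> on the leaves matches the arity: an operation of arity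
  \<open>n + 1\<close> reduces prescriptions at arbitrarily many leaves to prescriptions at
  \<open>n\<close> of them. Trees built from trees have arbitrarily many leaves, while the invariant
  speaks of few, so it can be applied only after this reduction. The same recursive trees therefore
  serve twice, over constraints with two ports and over hyperedges which are such trees themselves.

  Two tolerances run in parallel in the minimality argument. Returning paths use relations that
  ignore the earlier assignments, so every set must absorb one argument from the full domain; the
  number \<open>k\<close> is counted inside the current family, where it can be maximized.\<close>

text \<open>A tree is rooted at a vertex whose label is supplied separately. \<open>Spot m\<close> is a vertex whose value may be
  prescribed, \<open>Meet\<close> glues two trees at their roots, and \<open>Edge h p ts\<close> attaches the port \<open>p\<close> of the
  hyperedge \<open>h\<close> to the root and the trees \<open>ts q\<close> to its other ports.\<close>

datatype 'h gtree = Free | Spot nat | Meet "'h gtree" "'h gtree" | Edge 'h nat "nat \<Rightarrow> 'h gtree"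

primrec rename_spots :: "(nat \<Rightarrow> nat) \<Rightarrow> 'h gtree \<Rightarrow> 'h gtree" where
  "rename_spots g Free = Free"
| "rename_spots g (Spot m) = Spot (g m)"
| "rename_spots g (Meet A B) = Meet (rename_spots g A) (rename_spots g B)"
| "rename_spots g (Edge h p ts) = Edge h p (\<lambda>q. rename_spots g (ts q))"

locale hyperedges =
  fixes ports :: "'h \<Rightarrow> nat set" and plab :: "'h \<Rightarrow> nat \<Rightarrow> 'x"
begin

text \<open>Different branches share only the root, so the root values of solutions can be computed
  recursively. \<open>dec\<close> admits a set of values at each spot, which covers a fixed value, a
  subset and no prescription at all.\<close>

primrec sat :: "('h \<Rightarrow> (nat \<Rightarrow> 'd) set) \<Rightarrow> ('x \<Rightarrow> 'd set) \<Rightarrow> (nat \<Rightarrow> 'x \<Rightarrow> 'd set) \<Rightarrow>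
    'h gtree \<Rightarrow> 'x \<Rightarrow> 'd set" where
  "sat R U dec Free = U"
| "sat R U dec (Spot m) = (\<lambda>x. dec m x \<inter> U x)"
| "sat R U dec (Meet A B) = (\<lambda>x. sat R U dec A x \<inter> sat R U dec B x)"
| "sat R U dec (Edge h p ts) = (\<lambda>x. {a \<in> U x. \<exists>t\<in>R h. t p = a \<and>
     (\<forall>q\<in>ports h - {p}. t q \<in> sat R U dec (ts q) (plab h q))})"

text \<open>Gluing and attaching edges is confined to labels in \<open>G\<close>, spots to labels in
  \<open>Sp\<close>. If assigned variables belong to \<open>Sp\<close> but not to \<open>G\<close>,
  trees end there. Distinct spot numbers make prescriptions in different branches
  independent.\<close>

inductive wft :: "'h set \<Rightarrow> 'x set \<Rightarrow> 'x set \<Rightarrow> 'x \<Rightarrow> 'h gtree \<Rightarrow> (nat \<times> 'x) set \<Rightarrow> bool"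
  for H G Sp where
  wft_Free: "wft H G Sp x Free {}"
| wft_Spot: "x \<in> Sp \<Longrightarrow> wft H G Sp x (Spot m) {(m, x)}"
| wft_Meet: "\<lbrakk>x \<in> G; wft H G Sp x A S; wft H G Sp x B S'; fst ` S \<inter> fst ` S' = {}\<rbrakk>
    \<Longrightarrow> wft H G Sp x (Meet A B) (S \<union> S')"
| wft_Edge: "\<lbrakk>x \<in> G; h \<in> H; p \<in> ports h; plab h p = x;
     \<And>q. q \<in> ports h - {p} \<Longrightarrow> wft H G Sp (plab h q) (ts q) (S q);
     \<And>q q'. \<lbrakk>q \<in> ports h - {p}; q' \<in> ports h - {p}; q \<noteq> q'\<rbrakk> \<Longrightarrow> fst ` S q \<inter> fst ` S q' = {}\<rbrakk>
    \<Longrightarrow> wft H G Sp x (Edge h p ts) (\<Union>q\<in>ports h - {p}. S q)"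

text \<open>Like \<open>wft\<close>, but an edge may be attached at the root whatever its label is.\<close>

definition wfe :: "'h set \<Rightarrow> 'x set \<Rightarrow> 'x set \<Rightarrow> 'x \<Rightarrow> 'h gtree \<Rightarrow> (nat \<times> 'x) set \<Rightarrow> bool" where
  "wfe H G Sp x C S \<longleftrightarrow> (\<exists>h p ts Sq. C = Edge h p ts \<and> S = (\<Union>q\<in>ports h - {p}. Sq q) \<and>
     h \<in> H \<and> p \<in> ports h \<and> plab h p = x \<and>
     (\<forall>q\<in>ports h - {p}. wft H G Sp (plab h q) (ts q) (Sq q)) \<and>
     (\<forall>q\<in>ports h - {p}. \<forall>q'\<in>ports h - {p}. q \<noteq> q' \<longrightarrow> fst ` Sq q \<inter> fst ` Sq q' = {}))"

lemma wfe_imp_wft: "wfe H G Sp x C S \<Longrightarrow> x \<in> G \<Longrightarrow> wft H G Sp x C S"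
  unfolding wfe_def by (elim exE conjE) (hypsubst, rule wft_Edge, auto)

lemma wft_spot_label: "wft H G Sp x T S \<Longrightarrow> (m, z) \<in> S \<Longrightarrow> z \<in> Sp"
  by (induction rule: wft.induct) auto

lemma wft_finite:
  assumes "\<And>h. h \<in> H \<Longrightarrow> finite (ports h)" "wft H G Sp x T S" shows "finite S"
  using assms(2,1) by (induction rule: wft.induct) auto

lemma sat_subset: "sat R U dec T x \<subseteq> U x"
  by (induction T arbitrary: x) auto

lemma sat_mono:
  assumes "wft H G Sp x T S" "\<And>h. h \<in> H \<Longrightarrow> R h \<subseteq> R' h" "\<And>x. U x \<subseteq> U' x"
    "\<And>m z. (m, z) \<in> S \<Longrightarrow> dec m z \<inter> U z \<subseteq> dec' m z"
  shows "sat R U dec T x \<subseteq> sat R' U' dec' T x"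
  using assms(1,4)
proof (induction rule: wft.induct)
  case (wft_Edge x h p ts S)
  have "sat R U dec (ts q) (plab h q) \<subseteq> sat R' U' dec' (ts q) (plab h q)" if "q \<in> ports h - {p}" for q
    using wft_Edge that by blast
  note sub = this
  show ?case
  proof
    fix a assume "a \<in> sat R U dec (Edge h p ts) x"
    then obtain t where "t \<in> R h" "t p = a" "a \<in> U x"
      "\<And>q. q \<in> ports h - {p} \<Longrightarrow> t q \<in> sat R U dec (ts q) (plab h q)" by auto
    then show "a \<in> sat R' U' dec' (Edge h p ts) x"
      using sub wft_Edge(2) assms(2)[of h] assms(3)[of x] by (fastforce intro!: bexI[of _ t])
  qed
next
  case (wft_Meet x A S B S')
  then have "sat R U dec A x \<subseteq> sat R' U' dec' A x" "sat R U dec B x \<subseteq> sat R' U' dec' B x" by blast+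
  then show ?case by auto
qed (use assms(3) in \<open>auto simp: subset_iff\<close>)

lemma sat_cong:
  assumes "wft H G Sp x T S" "\<And>m z. (m, z) \<in> S \<Longrightarrow> dec m z \<inter> U z = dec' m z \<inter> U z"
  shows "sat R U dec T x = sat R U dec' T x"
  using sat_mono[OF assms(1), of R R U U dec dec'] sat_mono[OF assms(1), of R R U U dec' dec] assms(2)
  by blast

text \<open>Coordinatewise application of \<open>F\<close> to solutions of the whole tree. Argument
  \<open>i\<close> may solve its own relaxation \<open>R i\<close>, \<open>U i\<close>,
  \<open>dec i\<close>; absorption statements are the instances in which some of these are weaker
  than the target.\<close>

lemma sat_apply:
  assumes "wft H G Sp x T S"
    and "\<And>h t. h \<in> H \<Longrightarrow> (\<And>i. i < N \<Longrightarrow> t i \<in> R i h) \<Longrightarrow> (\<lambda>p. F (\<lambda>i. t i p)) \<in> R' h"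
    and "\<And>x v. (\<And>i. i < N \<Longrightarrow> v i \<in> U i x) \<Longrightarrow> F v \<in> U' x"
    and "\<And>m z v. (m, z) \<in> S \<Longrightarrow> (\<And>i. i < N \<Longrightarrow> v i \<in> dec i m z \<inter> U i z) \<Longrightarrow> F v \<in> dec' m z"
    and "\<And>i. i < N \<Longrightarrow> v i \<in> sat (R i) (U i) (dec i) T x"
  shows "F v \<in> sat R' U' dec' T x"
  using assms(1,4,5)
proof (induction arbitrary: v rule: wft.induct)
  case (wft_Edge x h p ts S)
  have "\<exists>t. \<forall>i<N. t i \<in> R i h \<and> t i p = v i \<and> (\<forall>q\<in>ports h - {p}. t i q \<in> sat (R i) (U i) (dec i) (ts q) (plab h q))"
  proof -
    have "\<forall>i. \<exists>t. i < N \<longrightarrow> t \<in> R i h \<and> t p = v i \<and> (\<forall>q\<in>ports h - {p}. t q \<in> sat (R i) (U i) (dec i) (ts q) (plab h q))"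
      using wft_Edge.prems(2) by auto
    then show ?thesis by metis
  qed
  then obtain t where t: "\<And>i. i < N \<Longrightarrow> t i \<in> R i h" "\<And>i. i < N \<Longrightarrow> t i p = v i"
    "\<And>i q. i < N \<Longrightarrow> q \<in> ports h - {p} \<Longrightarrow> t i q \<in> sat (R i) (U i) (dec i) (ts q) (plab h q)"
    by blast
  \<comment> \<open>Beyond \<open>N\<close> the tuple is padded with \<open>v i\<close>, so that its
    value at \<open>p\<close> is literally \<open>F v\<close>; no congruence of \<open>F\<close> is
    assumed here.\<close>
  define t' where "t' = (\<lambda>p. F (\<lambda>i. if i < N then t i p else v i))"
  define t0 where "t0 = (\<lambda>i. if i < N then t i else (\<lambda>_. v i))"
  have t't0: "t' = (\<lambda>p. F (\<lambda>i. t0 i p))" unfolding t'_def t0_def by (intro ext arg_cong[of _ _ F]) auto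
  have 1: "t' \<in> R' h" unfolding t't0 by (rule assms(2)) (use wft_Edge(2) t(1) in \<open>auto simp: t0_def\<close>)
  have 2: "t' p = F v" unfolding t'_def by (intro arg_cong[of _ _ F] ext) (auto simp: t(2))
  have 3: "t' q \<in> sat R' U' dec' (ts q) (plab h q)" if q: "q \<in> ports h - {p}" for q
    unfolding t't0
  proof (rule wft_Edge.IH[OF q])
    fix m z v assume "(m, z) \<in> S q" "\<And>i. i < N \<Longrightarrow> v i \<in> dec i m z \<inter> U i z"
    then show "F v \<in> dec' m z" using wft_Edge.prems(1)[of m z v] q by blast
  qed (use q t(3) in \<open>auto simp: t0_def\<close>)
  have 4: "F v \<in> U' x" by (rule assms(3)) (use wft_Edge.prems(2) in auto)
  show ?case using 1 2 3 4 by auto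
next
  case (wft_Spot x m)
  show ?case using wft_Spot.prems(1)[of m x v] wft_Spot.prems(2) assms(3)[of v x] by auto
next
  case (wft_Meet x A S B S')
  show ?case using wft_Meet.IH[of v] wft_Meet.prems by auto
qed (use assms(3) in auto)

text \<open>Edges are attached only at labels in \<open>G\<close>, so extending single values at
  such ports propagates from the root through the whole tree.\<close>

lemma sat_full:
  assumes "wft H G Sp x T S"
    and "\<And>h p a. h \<in> H \<Longrightarrow> p \<in> ports h \<Longrightarrow> plab h p \<in> G \<Longrightarrow> a \<in> U (plab h p) \<Longrightarrow>
       \<exists>t\<in>R h. t p = a \<and> (\<forall>q\<in>ports h. t q \<in> U (plab h q))"
    and "\<And>m z. (m, z) \<in> S \<Longrightarrow> U z \<subseteq> dec m z"
  shows "sat R U dec T x = U x"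
  using assms(1,3)
proof (induction rule: wft.induct)
  case (wft_Edge x h p ts S)
  have *: "sat R U dec (ts q) (plab h q) = U (plab h q)" if "q \<in> ports h - {p}" for q
    using wft_Edge that by blast
  have "\<exists>t\<in>R h. t p = a \<and> (\<forall>q\<in>ports h - {p}. t q \<in> sat R U dec (ts q) (plab h q))" if "a \<in> U x" for a
  proof -
    obtain t where "t \<in> R h" "t p = a" "\<forall>q\<in>ports h. t q \<in> U (plab h q)"
      using assms(2)[of h p a] wft_Edge(1-4) \<open>a \<in> U x\<close> by auto
    then show ?thesis using * by (intro bexI[of _ t]) auto
  qed
  then show ?case by auto
qed auto

text \<open>A solution uses one value at each spot. Spot numbers of different branches are disjoint,
  so the choices made in the branches merge into one function \<open>g\<close>.\<close>

lemma sat_singletons: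
  assumes "wft H G Sp x T S" "a \<in> sat R U dec T x"
  shows "\<exists>g. (\<forall>(m, z)\<in>S. g m \<in> dec m z \<inter> U z) \<and> a \<in> sat R U (\<lambda>m z. {g m}) T x"
  using assms
proof (induction arbitrary: a rule: wft.induct)
  case (wft_Spot x m)
  then show ?case by (intro exI[of _ "\<lambda>_. a"]) auto
next
  case (wft_Meet x A S B S')
  obtain g where g: "\<forall>(m, z)\<in>S. g m \<in> dec m z \<inter> U z" "a \<in> sat R U (\<lambda>m z. {g m}) A x"
    using wft_Meet.IH(1)[of a] wft_Meet.prems by auto
  obtain g' where g': "\<forall>(m, z)\<in>S'. g' m \<in> dec m z \<inter> U z" "a \<in> sat R U (\<lambda>m z. {g' m}) B x"
    using wft_Meet.IH(2)[of a] wft_Meet.prems by auto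
  define k where "k m = (if m \<in> fst ` S then g m else g' m)" for m
  have kS: "k m = g m" if "(m, z) \<in> S" for m z using that unfolding k_def by force
  have kS': "k m = g' m" if "(m, z) \<in> S'" for m z using that wft_Meet(4) unfolding k_def by force
  have "a \<in> sat R U (\<lambda>m z. {k m}) A x"
    using g(2) sat_cong[OF wft_Meet(2), of "\<lambda>m z. {g m}" U "\<lambda>m z. {k m}" R] kS by auto
  moreover have "a \<in> sat R U (\<lambda>m z. {k m}) B x"
    using g'(2) sat_cong[OF wft_Meet(3), of "\<lambda>m z. {g' m}" U "\<lambda>m z. {k m}" R] kS' by auto
  ultimately show ?case using g(1) g'(1) kS kS' by (intro exI[of _ k]) auto
next
  case (wft_Edge x h p ts S)
  obtain t where t: "t \<in> R h" "t p = a" "\<And>q. q \<in> ports h - {p} \<Longrightarrow> t q \<in> sat R U dec (ts q) (plab h q)"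
    using wft_Edge.prems by auto
  have "\<forall>q\<in>ports h - {p}. \<exists>g. (\<forall>(m, z)\<in>S q. g m \<in> dec m z \<inter> U z) \<and>
      t q \<in> sat R U (\<lambda>m z. {g m}) (ts q) (plab h q)"
    using wft_Edge.IH t(3) by blast
  from bchoice[OF this]
  obtain g where g: "\<And>q. q \<in> ports h - {p} \<Longrightarrow> (\<forall>(m, z)\<in>S q. g q m \<in> dec m z \<inter> U z)"
     "\<And>q. q \<in> ports h - {p} \<Longrightarrow> t q \<in> sat R U (\<lambda>m z. {g q m}) (ts q) (plab h q)"
    by blast
  \<comment> \<open>The branch that owns the spot \<open>m\<close> is unique, so its choice
    decides.\<close>
  define k where "k m = g (SOME q. q \<in> ports h - {p} \<and> m \<in> fst ` S q) m" for m
  have k: "k m = g q m" if "q \<in> ports h - {p}" "(m, z) \<in> S q" for m q z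
  proof -
    have m: "m \<in> fst ` S q" using that(2) by force
    have "(SOME q. q \<in> ports h - {p} \<and> m \<in> fst ` S q) = q"
    proof (rule some_equality)
      show "q \<in> ports h - {p} \<and> m \<in> fst ` S q" using that(1) m by simp
      fix q' assume "q' \<in> ports h - {p} \<and> m \<in> fst ` S q'"
      then show "q' = q" using wft_Edge(6)[of q' q] that(1) m by blast
    qed
    then show ?thesis unfolding k_def by simp
  qed
  have "t q \<in> sat R U (\<lambda>m z. {k m}) (ts q) (plab h q)" if q: "q \<in> ports h - {p}" for q
    using g(2)[OF q] sat_cong[OF wft_Edge(5)[OF q], of "\<lambda>m z. {g q m}" U "\<lambda>m z. {k m}" R] k[OF q] by auto
  then have "a \<in> sat R U (\<lambda>m z. {k m}) (Edge h p ts) x"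
    using t(1,2) wft_Edge.prems by auto
  moreover have "\<forall>(m, z)\<in>(\<Union>q\<in>ports h - {p}. S q). k m \<in> dec m z \<inter> U z"
  proof
    fix mz assume "mz \<in> (\<Union>q\<in>ports h - {p}. S q)"
    then obtain m z q where "mz = (m, z)" "q \<in> ports h - {p}" "(m, z) \<in> S q" by (cases mz) auto
    then show "case mz of (m, z) \<Rightarrow> k m \<in> dec m z \<inter> U z" using g(1)[of q] k[of q m z] by fastforce
  qed
  ultimately show ?case by blast
qed auto

text \<open>The context \<open>C\<close> is the part of the tree above the current root: descending through an
  edge attached at port \<open>p\<close> into its port \<open>q\<close> turns it into that same edge attached at \<open>q\<close>.\<close>

lemma reroot:
  assumes "wft H G Sp x T S" "(w, z) \<in> S" "(C = Free \<and> SC = {}) \<or> wft H G Sp x C SC \<or> wfe H G Sp x C SC"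
    "fst ` S \<inter> fst ` SC = {}"
  shows "\<exists>T' S'. ((T' = Free \<and> S' = {}) \<or> wft H G Sp z T' S' \<or> wfe H G Sp z T' S') \<and> S' = S - {(w, z)} \<union> SC \<and>
    (\<forall>R U (dec :: nat \<Rightarrow> 'x \<Rightarrow> 'd set). sat R U dec T x \<inter> sat R U dec C x \<noteq> {} \<longleftrightarrow> sat R U dec T' z \<inter> dec w z \<inter> U z \<noteq> {})"
  using assms
proof (induction arbitrary: C SC rule: wft.induct)
  case (wft_Spot x m)
  then have [simp]: "w = m" "z = x" by auto
  show ?case by (rule exI[of _ C], rule exI[of _ SC]) (use wft_Spot in auto)
next
  case (wft_Meet x A S B S')
  \<comment> \<open>An edge at a label outside \<open>G\<close> can only be the context of a bare
    spot. Here \<open>x\<close> lies in \<open>G\<close>, so every admissible context is an ordinary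
    tree and may be glued.\<close>
  have C: "wft H G Sp x C SC" using wft_Meet.prems(2) wfe_imp_wft[OF _ wft_Meet(1)] wft.wft_Free by metis
  show ?case
  proof (cases "(w, z) \<in> S")
    case True
    have nS': "(w, z) \<notin> S'" using True wft_Meet(4) by force
    have "wft H G Sp x (Meet B C) (S' \<union> SC)"
      by (rule wft.wft_Meet) (use wft_Meet C in auto)
    note wft = this
    have "fst ` S \<inter> fst ` (S' \<union> SC) = {}" using wft_Meet(4) wft_Meet.prems(3) by blast
    from wft_Meet.IH(1)[OF True disjI2[OF disjI1[OF wft]] this]
    obtain T' S'' where T': "(T' = Free \<and> S'' = {}) \<or> wft H G Sp z T' S'' \<or> wfe H G Sp z T' S''"
      "S'' = S - {(w, z)} \<union> (S' \<union> SC)"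
      "\<forall>R U (dec :: nat \<Rightarrow> 'x \<Rightarrow> 'd set). sat R U dec A x \<inter> sat R U dec (Meet B C) x \<noteq> {} \<longleftrightarrow> sat R U dec T' z \<inter> dec w z \<inter> U z \<noteq> {}"
      by (elim exE conjE)
    show ?thesis
    proof (rule exI[of _ T'], rule exI[of _ S''], intro conjI allI)
      show "S'' = S \<union> S' - {(w, z)} \<union> SC" using T'(2) nS' by auto
      show "sat R U dec (Meet A B) x \<inter> sat R U dec C x \<noteq> {} \<longleftrightarrow> sat R U dec T' z \<inter> dec w z \<inter> U z \<noteq> {}"
        for R U and dec :: "nat \<Rightarrow> 'x \<Rightarrow> 'd set" using T'(3)[rule_format, of R U dec] by (simp add: Int_assoc)
    qed (fact T'(1))
  next
    case False
    then have True: "(w, z) \<in> S'" using wft_Meet.prems(1) by auto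
    have "wft H G Sp x (Meet A C) (S \<union> SC)"
      by (rule wft.wft_Meet) (use wft_Meet C in auto)
    note wft = this
    have "fst ` S' \<inter> fst ` (S \<union> SC) = {}" using wft_Meet(4) wft_Meet.prems(3) by blast
    from wft_Meet.IH(2)[OF True disjI2[OF disjI1[OF wft]] this]
    obtain T' S'' where T': "(T' = Free \<and> S'' = {}) \<or> wft H G Sp z T' S'' \<or> wfe H G Sp z T' S''"
      "S'' = S' - {(w, z)} \<union> (S \<union> SC)"
      "\<forall>R U (dec :: nat \<Rightarrow> 'x \<Rightarrow> 'd set). sat R U dec B x \<inter> sat R U dec (Meet A C) x \<noteq> {} \<longleftrightarrow> sat R U dec T' z \<inter> dec w z \<inter> U z \<noteq> {}"
      by (elim exE conjE)
    show ?thesis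
    proof (rule exI[of _ T'], rule exI[of _ S''], intro conjI allI)
      show "S'' = S \<union> S' - {(w, z)} \<union> SC" using T'(2) False by auto
      show "sat R U dec (Meet A B) x \<inter> sat R U dec C x \<noteq> {} \<longleftrightarrow> sat R U dec T' z \<inter> dec w z \<inter> U z \<noteq> {}"
        for R U and dec :: "nat \<Rightarrow> 'x \<Rightarrow> 'd set" using T'(3)[rule_format, of R U dec] by (simp add: Int_assoc Int_left_commute)
    qed (fact T'(1))
  qed
next
  case (wft_Edge x h p ts S)
  have C: "wft H G Sp x C SC" using wft_Edge.prems(2) wfe_imp_wft[OF _ wft_Edge(1)] wft.wft_Free by metis
  obtain q0 where q0: "q0 \<in> ports h - {p}" "(w, z) \<in> S q0" using wft_Edge.prems(1) by auto
  define C' where "C' = Edge h q0 (ts(p := C))"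
  define SC' where "SC' = (\<Union>q\<in>ports h - {q0}. (S(p := SC)) q)"
  have SC'eq: "SC' = (\<Union>q\<in>ports h - {p, q0}. S q) \<union> SC"
    unfolding SC'_def using wft_Edge(3) q0(1) by (auto split: if_splits)
  have dSC: "fst ` S q \<inter> fst ` SC = {}" if "q \<in> ports h - {p}" for q
    using wft_Edge.prems(3) that by (auto simp: image_UN)
  have wfe: "wfe H G Sp (plab h q0) C' SC'"
    unfolding wfe_def
  proof (intro exI conjI)
    show "C' = Edge h q0 (ts(p := C))" "SC' = (\<Union>q\<in>ports h - {q0}. (S(p := SC)) q)" by (simp_all add: C'_def SC'_def)
    show "h \<in> H" "q0 \<in> ports h" "plab h q0 = plab h q0" using wft_Edge q0 by auto
    show "\<forall>q\<in>ports h - {q0}. wft H G Sp (plab h q) ((ts(p := C)) q) ((S(p := SC)) q)"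
      using C wft_Edge(4) wft_Edge(5) by auto
    show "\<forall>q\<in>ports h - {q0}. \<forall>q'\<in>ports h - {q0}. q \<noteq> q' \<longrightarrow> fst ` (S(p := SC)) q \<inter> fst ` (S(p := SC)) q' = {}"
    proof (intro ballI impI)
      fix q q' assume q: "q \<in> ports h - {q0}" "q' \<in> ports h - {q0}" "q \<noteq> q'"
      show "fst ` (S(p := SC)) q \<inter> fst ` (S(p := SC)) q' = {}"
        using wft_Edge(6)[of q q'] dSC[of q] dSC[of q'] q by (auto simp: Int_commute)
    qed
  qed
  have disj: "fst ` S q0 \<inter> fst ` SC' = {}"
  proof -
    have "fst ` S q0 \<inter> fst ` S q = {}" if "q \<in> ports h - {p, q0}" for q
      using wft_Edge(6)[OF q0(1), of q] that by blast
    then show ?thesis using dSC[OF q0(1)] unfolding SC'eq image_Un image_UN Int_Un_distrib Int_UN_distrib by simp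
  qed
  from wft_Edge.IH[OF q0(1) q0(2) disjI2[OF disjI2[OF wfe]] disj]
  obtain T' S'' where T': "(T' = Free \<and> S'' = {}) \<or> wft H G Sp z T' S'' \<or> wfe H G Sp z T' S''"
      "S'' = S q0 - {(w, z)} \<union> SC'"
      "\<forall>R U (dec :: nat \<Rightarrow> 'x \<Rightarrow> 'd set). sat R U dec (ts q0) (plab h q0) \<inter> sat R U dec C' (plab h q0) \<noteq> {} \<longleftrightarrow> sat R U dec T' z \<inter> dec w z \<inter> U z \<noteq> {}"
    by (elim exE conjE)
  have nw: "(w, z) \<notin> S q" if "q \<in> ports h - {p}" "q \<noteq> q0" for q
    using wft_Edge(6)[OF that(1) q0(1) that(2)] q0(2) by force
  have nw2: "(w, z) \<notin> SC" using dSC[OF q0(1)] q0(2) by force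
  have S'': "S'' = (\<Union>q\<in>ports h - {p}. S q) - {(w, z)} \<union> SC"
    unfolding T'(2) SC'eq using nw nw2 q0(1) by auto
  \<comment> \<open>Both sides assert one tuple of \<open>h\<close> that fits the context at
    \<open>p\<close> and the subtrees at all other ports.\<close>
  have sem: "sat R U dec (Edge h p ts) x \<inter> sat R U dec C x \<noteq> {} \<longleftrightarrow>
     sat R U dec (ts q0) (plab h q0) \<inter> sat R U dec C' (plab h q0) \<noteq> {}"
    for R U and dec :: "nat \<Rightarrow> 'x \<Rightarrow> 'd set"
  proof
    assume "sat R U dec (Edge h p ts) x \<inter> sat R U dec C x \<noteq> {}"
    then obtain t where t: "t \<in> R h" "t p \<in> sat R U dec C x"
      "\<forall>q\<in>ports h - {p}. t q \<in> sat R U dec (ts q) (plab h q)" by auto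
    have "t q0 \<in> sat R U dec C' (plab h q0)"
      unfolding C'_def using t wft_Edge(4) q0(1) sat_subset[of R U dec "ts q0" "plab h q0"] by auto
    then show "sat R U dec (ts q0) (plab h q0) \<inter> sat R U dec C' (plab h q0) \<noteq> {}" using t(3) q0(1) by auto
  next
    assume "sat R U dec (ts q0) (plab h q0) \<inter> sat R U dec C' (plab h q0) \<noteq> {}"
    then obtain t where t: "t \<in> R h" "t q0 \<in> sat R U dec (ts q0) (plab h q0)"
      "\<forall>q\<in>ports h - {q0}. t q \<in> sat R U dec ((ts(p := C)) q) (plab h q)"
      unfolding C'_def by auto
    have tp: "t p \<in> sat R U dec C x" using t(3) q0(1) wft_Edge(3,4) by force
    have "t q \<in> sat R U dec (ts q) (plab h q)" if "q \<in> ports h - {p}" for q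
    proof (cases "q = q0")
      case False
      then have "t q \<in> sat R U dec ((ts(p := C)) q) (plab h q)" using t(3) that by blast
      then show ?thesis using that by simp
    qed (simp add: t(2))
    then have "t p \<in> sat R U dec (Edge h p ts) x"
      using t(1) tp sat_subset[of R U dec C x] by auto
    then show "sat R U dec (Edge h p ts) x \<inter> sat R U dec C x \<noteq> {}" using tp by auto
  qed
  show ?case
    by (rule exI[of _ T'], rule exI[of _ S''], intro conjI allI) (fact T'(1), fact S'', unfold sem, rule T'(3)[rule_format])
qed auto

lemma sat_rename: "sat R U dec (rename_spots g T) x = sat R U (\<lambda>m. dec (g m)) T x"
  by (induction T arbitrary: x) auto

lemma wft_rename:
  assumes "wft H G Sp x T S" "inj g" shows "wft H G Sp x (rename_spots g T) (map_prod g id ` S)"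
  using assms(1)
proof (induction rule: wft.induct)
  case (wft_Spot x m)
  then show ?case using wft.wft_Spot[of x Sp H G "g m"] by simp
next
  case (wft_Meet x A S B S')
  have "fst ` map_prod g id ` S = g ` fst ` S" "fst ` map_prod g id ` S' = g ` fst ` S'" by force+
  then show ?case unfolding rename_spots.simps image_Un
    by (intro wft.wft_Meet wft_Meet) (use wft_Meet(4) assms(2) in \<open>auto simp flip: image_Int\<close>)
next
  case (wft_Edge x h p ts S)
  have *: "fst ` map_prod g id ` S q = g ` fst ` S q" for q by force
  have eq: "map_prod g id ` (\<Union>q\<in>ports h - {p}. S q) = (\<Union>q\<in>ports h - {p}. map_prod g id ` S q)" by auto
  show ?case unfolding rename_spots.simps eq
  proof (rule wft.wft_Edge)
    fix q q' assume "q \<in> ports h - {p}" "q' \<in> ports h - {p}" "q \<noteq> q'"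
    from wft_Edge(6)[OF this]
    show "fst ` map_prod g id ` S q \<inter> fst ` map_prod g id ` S q' = {}"
      unfolding * image_Int[OF assms(2), symmetric] by simp
  qed (use wft_Edge in blast)+
qed (auto intro: wft.intros)

text \<open>Trees can be intersected at the root, so there is a least solution set for every label, and
  the family of these sets is arc consistent.\<close>

lemma closure_family:
  fixes R :: "'h \<Rightarrow> (nat \<Rightarrow> 'd) set" and U :: "'x \<Rightarrow> 'd set" and E :: "'x \<Rightarrow> 'd set"
  assumes fin: "\<And>x. x \<in> G \<Longrightarrow> finite (U x)"
  obtains K T S where "\<And>x. x \<in> G \<Longrightarrow> wft H G Sp x (T x) (S x)"
    "\<And>x. x \<in> G \<Longrightarrow> K x = sat R U (\<lambda>m. E) (T x) x"
    "\<And>x T' S'. x \<in> G \<Longrightarrow> wft H G Sp x T' S' \<Longrightarrow> K x \<subseteq> sat R U (\<lambda>m. E) T' x"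
    "\<And>h p a. h \<in> H \<Longrightarrow> p \<in> ports h \<Longrightarrow> plab h p \<in> G \<Longrightarrow> a \<in> K (plab h p) \<Longrightarrow>
       \<exists>t\<in>R h. t p = a \<and> (\<forall>q\<in>ports h - {p}. (plab h q \<in> G \<longrightarrow> t q \<in> K (plab h q)) \<and>
          (plab h q \<in> Sp - G \<longrightarrow> t q \<in> E (plab h q)))"
proof -
  let ?sat = "sat R U (\<lambda>m. E)"
  have "\<exists>T S. wft H G Sp x T S \<and> (\<forall>T' S'. wft H G Sp x T' S' \<longrightarrow> ?sat T x \<subseteq> ?sat T' x)" if x: "x \<in> G" for x
  proof -
    obtain T S where T: "wft H G Sp x T S"
      and min: "\<And>T' S'. wft H G Sp x T' S' \<Longrightarrow> card (?sat T x) \<le> card (?sat T' x)"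
    proof -
      have "\<exists>T. (\<exists>S. wft H G Sp x T S) \<and> (\<forall>T'. (\<exists>S. wft H G Sp x T' S) \<longrightarrow> card (?sat T x) \<le> card (?sat T' x))"
        by (rule ex_has_least_nat) (use wft_Free in blast)
      then show ?thesis using that by blast
    qed
    have "?sat T x \<subseteq> ?sat T' x" if T': "wft H G Sp x T' S'" for T' S'
    proof -
      \<comment> \<open>Even and odd numbers keep the spots of the two trees apart. The meet cannot
        fall below the least cardinality, so the solution set of \<open>T\<close> lies inside that
        of \<open>T'\<close>.\<close>
      let ?T = "Meet (rename_spots (\<lambda>m. 2 * m) T) (rename_spots (\<lambda>m. 2 * m + 1) T')"
      have "wft H G Sp x ?T (map_prod (\<lambda>m. 2 * m) id ` S \<union> map_prod (\<lambda>m. 2 * m + 1) id ` S')"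
      proof (rule wft_Meet[OF x wft_rename[OF T] wft_rename[OF T']])
        show "inj (\<lambda>m :: nat. 2 * m)" "inj (\<lambda>m :: nat. 2 * m + 1)" by (auto intro: injI)
        show "fst ` map_prod (\<lambda>m. 2 * m) id ` S \<inter> fst ` map_prod (\<lambda>m :: nat. 2 * m + 1) id ` S' = {}"
          by (auto) presburger
      qed
      from min[OF this] have "card (?sat T x) \<le> card (?sat T x \<inter> ?sat T' x)"
        by (simp add: sat_rename)
      moreover have "finite (?sat T x)" using fin[OF x] sat_subset finite_subset by metis
      ultimately have "?sat T x \<inter> ?sat T' x = ?sat T x"
        by (metis card_seteq inf_le1)
      then show ?thesis by auto
    qed
    then show ?thesis using T by blast
  qed
  then obtain T S where TS: "\<And>x. x \<in> G \<Longrightarrow> wft H G Sp x (T x) (S x)"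
    "\<And>x T' S'. x \<in> G \<Longrightarrow> wft H G Sp x T' S' \<Longrightarrow> ?sat (T x) x \<subseteq> ?sat T' x" by metis
  define K where "K x = ?sat (T x) x" for x
  show ?thesis
  proof (rule that[of T S K])
    show "x \<in> G \<Longrightarrow> K x = ?sat (T x) x" for x by (simp add: K_def)
    show "x \<in> G \<Longrightarrow> wft H G Sp x T' S' \<Longrightarrow> K x \<subseteq> ?sat T' x" for x T' S' using TS(2) by (simp add: K_def)
    fix h p a assume hp: "h \<in> H" "p \<in> ports h" "plab h p \<in> G" "a \<in> K (plab h p)"
    \<comment> \<open>A hyperedge whose other ports carry the optimal trees is again a tree at
      \<open>plab h p\<close>, so leastness of \<open>K\<close> puts \<open>a\<close> into its
      solution set and supplies the tuple. Tagging spots with their port keeps them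
      distinct.\<close>
    define ts where "ts q = (if plab h q \<in> G then rename_spots (\<lambda>m. prod_encode (q, m)) (T (plab h q))
      else if plab h q \<in> Sp then Spot (prod_encode (q, 0)) else Free)" for q
    define Sq where "Sq q = (if plab h q \<in> G then map_prod (\<lambda>m. prod_encode (q, m)) id ` (S (plab h q))
      else if plab h q \<in> Sp then {(prod_encode (q, 0), plab h q)} else {})" for q
    have inj: "inj (\<lambda>m. prod_encode (q, m))" for q by (auto intro: injI)
    have "wft H G Sp (plab h p) (Edge h p ts) (\<Union>q\<in>ports h - {p}. Sq q)"
    proof (rule wft_Edge)
      show "wft H G Sp (plab h q) (ts q) (Sq q)" for q
        unfolding ts_def Sq_def using TS(1) inj by (auto intro: wft_rename wft_Spot wft_Free)
      have "m \<in> fst ` Sq q \<Longrightarrow> fst (prod_decode m) = q" for m q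
        unfolding Sq_def by (auto split: if_splits)
      then show "q \<noteq> q' \<Longrightarrow> fst ` Sq q \<inter> fst ` Sq q' = {}" for q q' by blast
    qed (use hp in auto)
    from TS(2)[OF hp(3) this] hp(4) have "a \<in> ?sat (Edge h p ts) (plab h p)" by (auto simp: K_def)
    then obtain t where t: "t \<in> R h" "t p = a" "\<And>q. q \<in> ports h - {p} \<Longrightarrow> t q \<in> ?sat (ts q) (plab h q)"
      by auto
    show "\<exists>t\<in>R h. t p = a \<and> (\<forall>q\<in>ports h - {p}. (plab h q \<in> G \<longrightarrow> t q \<in> K (plab h q)) \<and>
          (plab h q \<in> Sp - G \<longrightarrow> t q \<in> E (plab h q)))"
    proof (intro bexI[OF _ t(1)] conjI ballI impI)
      fix q assume q: "q \<in> ports h - {p}"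
      show "t q \<in> K (plab h q)" if "plab h q \<in> G" using t(3)[OF q] that by (simp add: ts_def K_def sat_rename)
      show "t q \<in> E (plab h q)" if "plab h q \<in> Sp - G" using t(3)[OF q] that by (simp add: ts_def)
    qed (fact t(2))
  qed (fact TS(1))
qed

end

lemma card_le_1: "A \<subseteq> {a} \<Longrightarrow> card A \<le> 1"
  using card_mono[of "{a}" A] by simp

context hyperedges
begin

lemma wft_inj_fst: "wft H G Sp x T S \<Longrightarrow> inj_on fst S"
proof (induction rule: wft.induct)
  case (wft_Meet x A S B S')
  then show ?case by (force simp: inj_on_def)
next
  case (wft_Edge x h p ts S)
  show ?case
  proof (rule inj_onI)
    fix a b assume ab: "a \<in> (\<Union>q\<in>ports h - {p}. S q)" "b \<in> (\<Union>q\<in>ports h - {p}. S q)" "fst a = fst b"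
    then obtain q q' where q: "q \<in> ports h - {p}" "a \<in> S q" "q' \<in> ports h - {p}" "b \<in> S q'" by blast
    have "q = q'"
    proof (rule ccontr)
      assume "q \<noteq> q'"
      from wft_Edge(6)[OF q(1,3) this] have "fst a \<notin> fst ` S q'" using q(2) by blast
      then show False using ab(3) q(4) by simp
    qed
    then show "a = b" using wft_Edge.IH[OF q(1)] q ab(3) by (auto dest: inj_onD)
  qed
qed auto

end

section \<open>Minimal absorbing families\<close>

text \<open>In the application, \<open>R\<close> holds the tuples of a hyperedge regardless of
  earlier assignments and \<open>R'\<close> those that respect them. \<open>R'\<close> absorbs one
  argument from \<open>R\<close>, whereas the extension of every single value is assumed for
  \<open>R\<close> alone.\<close>

locale nu_instance = hyperedges ports plab
  for ports :: "'h \<Rightarrow> nat set" and plab :: "'h \<Rightarrow> nat \<Rightarrow> 'x" +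
  fixes N :: nat and F :: "(nat \<Rightarrow> 'd) \<Rightarrow> 'd" and H :: "'h set" and X :: "'x set"
    and Q :: "'x \<Rightarrow> 'd set" and R R' :: "'h \<Rightarrow> (nat \<Rightarrow> 'd) set"
  assumes N_pos: "0 < N"
    and fin_X: "finite X" and fin_Q: "finite (Q x)" and Q_outside: "x \<notin> X \<Longrightarrow> Q x = {}"
    and plab_X: "h \<in> H \<Longrightarrow> p \<in> ports h \<Longrightarrow> plab h p \<in> X"
    and fin_ports: "h \<in> H \<Longrightarrow> finite (ports h)"
    and R'_subset: "h \<in> H \<Longrightarrow> R' h \<subseteq> R h"
    and R_Q: "h \<in> H \<Longrightarrow> t \<in> R h \<Longrightarrow> p \<in> ports h \<Longrightarrow> t p \<in> Q (plab h p)"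
    and F_cong: "(\<And>i. i < N \<Longrightarrow> u i = v i) \<Longrightarrow> F u = F v"
    and F_R: "h \<in> H \<Longrightarrow> (\<And>i. i < N \<Longrightarrow> T i \<in> R h) \<Longrightarrow> (\<lambda>p. F (\<lambda>i. T i p)) \<in> R h"
    and F_R': "h \<in> H \<Longrightarrow> (\<And>i. i < N \<Longrightarrow> T i \<in> R h) \<Longrightarrow> card {i. i < N \<and> T i \<notin> R' h} \<le> 1 \<Longrightarrow>
       (\<lambda>p. F (\<lambda>i. T i p)) \<in> R' h"
    and F_nu: "(\<And>i. i < N \<Longrightarrow> v i \<in> Q x) \<Longrightarrow> a \<in> Q x \<Longrightarrow> card {i. i < N \<and> v i \<noteq> a} \<le> 1 \<Longrightarrow> F v = a"
    and R_ac: "h \<in> H \<Longrightarrow> p \<in> ports h \<Longrightarrow> a \<in> Q (plab h p) \<Longrightarrow> \<exists>t\<in>R h. t p = a"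
begin

section \<open>Relations along paths of ports\<close>

primrec chain :: "'x \<Rightarrow> ('h \<times> nat \<times> nat) list \<Rightarrow> 'x \<Rightarrow> bool" where
  "chain x [] y \<longleftrightarrow> x = y"
| "chain x (s # P) y \<longleftrightarrow> (case s of (h, a, b) \<Rightarrow> h \<in> H \<and> a \<in> ports h \<and> b \<in> ports h \<and> a \<noteq> b \<and>
     plab h a = x \<and> chain (plab h b) P y)"

primrec prel :: "('h \<Rightarrow> (nat \<Rightarrow> 'd) set) \<Rightarrow> ('h \<times> nat \<times> nat) list \<Rightarrow> ('d \<times> 'd) set" where
  "prel Rel [] = Id"
| "prel Rel (s # P) = (case s of (h, a, b) \<Rightarrow> {(t a, t b) |t. t \<in> Rel h}) O prel Rel P"

lemma chain_append: "chain x (P @ P') y \<longleftrightarrow> (\<exists>z. chain x P z \<and> chain z P' y)"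
  by (induction P arbitrary: x) auto

lemma prel_append: "prel Rel (P @ P') = prel Rel P O prel Rel P'"
  by (induction P) auto

lemma chain_X: "chain x P y \<Longrightarrow> x \<in> X \<Longrightarrow> y \<in> X"
  by (induction P arbitrary: x) (auto simp: plab_X)

lemma prel_apply:
  assumes "\<And>h t. h \<in> H \<Longrightarrow> (\<And>i. i < N \<Longrightarrow> t i \<in> Rel i h) \<Longrightarrow> (\<lambda>p. F (\<lambda>i. t i p)) \<in> Rel' h"
  shows "chain x P y \<Longrightarrow> (\<And>i. i < N \<Longrightarrow> (u i, v i) \<in> prel (Rel i) P) \<Longrightarrow> (F u, F v) \<in> prel Rel' P"
proof (induction P arbitrary: x u)
  case Nil
  then show ?case using F_cong[of u v] by auto
next
  case (Cons s P)
  obtain h a b where s: "s = (h, a, b)" by (cases s)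
  have "\<forall>i. \<exists>t. i < N \<longrightarrow> t \<in> Rel i h \<and> t a = u i \<and> (t b, v i) \<in> prel (Rel i) P"
    using Cons.prems(2) unfolding s by fastforce
  then obtain t where t: "\<And>i. i < N \<Longrightarrow> t i \<in> Rel i h" "\<And>i. i < N \<Longrightarrow> t i a = u i"
    "\<And>i. i < N \<Longrightarrow> (t i b, v i) \<in> prel (Rel i) P" by metis
  have h: "h \<in> H" "chain (plab h b) P y" using Cons.prems(1) s by auto
  have "(F (\<lambda>i. t i b), F v) \<in> prel Rel' P" by (rule Cons.IH[OF h(2)]) (use t in auto)
  moreover have "(\<lambda>p. F (\<lambda>i. t i p)) \<in> Rel' h" by (rule assms[OF h(1)]) (use t in auto)
  moreover have "F u = F (\<lambda>i. t i a)" by (rule F_cong) (use t in auto)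
  ultimately show ?case unfolding s by auto
qed

text \<open>\<open>tol 0\<close> is closure under \<open>F\<close>; the near-unanimity identities
  say that singletons have \<open>tol 1\<close>.\<close>

definition tol :: "nat \<Rightarrow> 'd set \<Rightarrow> 'd set \<Rightarrow> bool" where
  "tol k A B \<longleftrightarrow> A \<subseteq> B \<and> (\<forall>v. (\<forall>i<N. v i \<in> B) \<and> card {i. i < N \<and> v i \<notin> A} \<le> k \<longrightarrow> F v \<in> A)"

lemma tolD: "tol k A B \<Longrightarrow> (\<And>i. i < N \<Longrightarrow> v i \<in> B) \<Longrightarrow> card {i. i < N \<and> v i \<notin> A} \<le> k \<Longrightarrow> F v \<in> A"
  unfolding tol_def by blast

definition arc_cons :: "('x \<Rightarrow> 'd set) \<Rightarrow> bool" where
  "arc_cons D' \<longleftrightarrow> (\<forall>h\<in>H. \<forall>p\<in>ports h. \<forall>a\<in>D' (plab h p).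
     \<exists>t\<in>R' h. t p = a \<and> (\<forall>q\<in>ports h. t q \<in> D' (plab h q)))"

text \<open>Absorption is measured against the fixed domain \<open>Q\<close>, so it keeps its
  strength when the family shrinks and applies to values met along paths in \<open>R\<close>. Arc
  consistency, in contrast, refers to \<open>R'\<close>.\<close>

definition absorbing_family :: "('x \<Rightarrow> 'd set) \<Rightarrow> bool" where
  "absorbing_family D' \<longleftrightarrow> (\<forall>x\<in>X. D' x \<noteq> {}) \<and> (\<forall>x. tol 1 (D' x) (Q x)) \<and> arc_cons D'"

end

locale nu_subinstance = nu_instance +
  fixes D' :: "'b \<Rightarrow> 'c set"
  assumes D'_family: "absorbing_family D'"
    and pq: "chain x P x \<Longrightarrow> chain x P' x \<Longrightarrow> P \<noteq> [] \<Longrightarrow> P' \<noteq> [] \<Longrightarrow> a \<in> Q x \<Longrightarrow>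
      \<exists>j. (a, a) \<in> prel R (concat (replicate j (P @ P')) @ P)"
begin

lemma D'_nonempty: "x \<in> X \<Longrightarrow> D' x \<noteq> {}"
  and D'_tol: "tol 1 (D' x) (Q x)"
  and D'_ac: "h \<in> H \<Longrightarrow> p \<in> ports h \<Longrightarrow> a \<in> D' (plab h p) \<Longrightarrow>
     \<exists>t\<in>R' h. t p = a \<and> (\<forall>q\<in>ports h. t q \<in> D' (plab h q))"
  using D'_family unfolding absorbing_family_def arc_cons_def by blast+

lemma D'_Q: "D' x \<subseteq> Q x" using D'_tol[of x] unfolding tol_def by blast

lemma D'_outside: "x \<notin> X \<Longrightarrow> D' x = {}" using D'_Q[of x] Q_outside[of x] by auto

lemma F_D': "(\<And>i. i < N \<Longrightarrow> v i \<in> D' x) \<Longrightarrow> F v \<in> D' x"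
proof (rule tolD[OF D'_tol])
  assume v: "\<And>i. i < N \<Longrightarrow> v i \<in> D' x"
  show "v i \<in> Q x" if "i < N" for i using v[OF that] D'_Q by blast
  have "{i. i < N \<and> v i \<notin> D' x} \<subseteq> {0}" using v by blast
  then show "card {i. i < N \<and> v i \<notin> D' x} \<le> 1" by (rule card_le_1)
qed

lemma F_D'_one: "i0 < N \<Longrightarrow> (\<And>i. i < N \<Longrightarrow> i \<noteq> i0 \<Longrightarrow> v i \<in> D' x) \<Longrightarrow> v i0 \<in> Q x \<Longrightarrow> F v \<in> D' x"
proof (rule tolD[OF D'_tol])
  assume *: "\<And>i. i < N \<Longrightarrow> i \<noteq> i0 \<Longrightarrow> v i \<in> D' x" "v i0 \<in> Q x"
  show "v i \<in> Q x" if "i < N" for i using * D'_Q[of x] that by (cases "i = i0") auto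
  have "{i. i < N \<and> v i \<notin> D' x} \<subseteq> {i0}" using * by auto
  then show "card {i. i < N \<and> v i \<notin> D' x} \<le> 1" by (rule card_le_1)
qed

definition rst :: "'a \<Rightarrow> (nat \<Rightarrow> 'c) set" where
  "rst h = {t \<in> R' h. \<forall>p\<in>ports h. t p \<in> D' (plab h p)}"

lemma rst_mix:
  assumes h: "h \<in> H" and i0: "i0 < N" and t: "\<And>i. i < N \<Longrightarrow> i \<noteq> i0 \<Longrightarrow> t i \<in> rst h" "t i0 \<in> R h"
  shows "(\<lambda>p. F (\<lambda>i. t i p)) \<in> rst h"
proof -
  have "(\<lambda>p. F (\<lambda>i. t i p)) \<in> R' h"
  proof (rule F_R'[OF h])
    show "t i \<in> R h" if "i < N" for i using t that R'_subset[OF h] unfolding rst_def by (cases "i = i0") auto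
    have "{i. i < N \<and> t i \<notin> R' h} \<subseteq> {i0}" using t unfolding rst_def by auto
    then show "card {i. i < N \<and> t i \<notin> R' h} \<le> 1" by (rule card_le_1)
  qed
  moreover have "F (\<lambda>i. t i p) \<in> D' (plab h p)" if p: "p \<in> ports h" for p
    by (rule F_D'_one[OF i0]) (use t p R_Q[OF h t(2) p] in \<open>auto simp: rst_def\<close>)
  ultimately show ?thesis unfolding rst_def by blast
qed

text \<open>At every hyperedge of the path, one tuple from \<open>R\<close> is absorbed by
  \<open>R'\<close> and by the sets \<open>D'\<close>. Thus one unrestricted path combines with
  restricted ones to a restricted path.\<close>

lemma prel_mix:
  assumes "chain x P y" "i0 < N" "\<And>i. i < N \<Longrightarrow> i \<noteq> i0 \<Longrightarrow> (u i, v i) \<in> prel rst P" "(u i0, v i0) \<in> prel R P"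
  shows "(F u, F v) \<in> prel rst P"
proof (rule prel_apply[where Rel = "\<lambda>i. if i = i0 then R else rst", OF _ assms(1)])
  fix h t assume "h \<in> H" and t: "\<And>i. i < N \<Longrightarrow> t i \<in> (if i = i0 then R else rst) h"
  then show "(\<lambda>p. F (\<lambda>i. t i p)) \<in> rst h" using rst_mix[OF \<open>h \<in> H\<close> assms(2), of t] t[OF assms(2)]
    by (metis (full_types))
qed (use assms in auto)

lemma prel_rst_R: "chain x P y \<Longrightarrow> prel rst P \<subseteq> prel R P"
proof (induction P arbitrary: x)
  case (Cons s P)
  obtain h a b where s: "s = (h, a, b)" by (cases s)
  have h: "h \<in> H" "chain (plab h b) P y" using Cons.prems s by auto
  have "{(t a, t b) |t. t \<in> rst h} \<subseteq> {(t a, t b) |t. t \<in> R h}"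
    using R'_subset[OF h(1)] unfolding rst_def by auto
  then show ?case unfolding s using relcomp_mono[OF _ Cons.IH[OF h(2)]] by simp
qed simp

lemma prel_back: "chain x P y \<Longrightarrow> d \<in> D' y \<Longrightarrow> \<exists>c\<in>D' x. (c, d) \<in> prel rst P"
proof (induction P arbitrary: x)
  case (Cons s P)
  obtain h a b where s: "s = (h, a, b)" by (cases s)
  have h: "h \<in> H" "chain (plab h b) P y" "b \<in> ports h" "a \<in> ports h" "plab h a = x" using Cons.prems s by auto
  obtain c where c: "c \<in> D' (plab h b)" "(c, d) \<in> prel rst P" using Cons.IH[OF h(2) Cons.prems(2)] by blast
  obtain t where "t \<in> R' h" "t b = c" "\<forall>q\<in>ports h. t q \<in> D' (plab h q)" using D'_ac[OF h(1,3) c(1)] by blast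
  then have "t a \<in> D' x" "(t a, d) \<in> prel rst (s # P)" using c(2) h unfolding s rst_def by auto
  then show ?case by blast
qed auto

lemma prel_forth: "chain x P y \<Longrightarrow> c \<in> D' x \<Longrightarrow> \<exists>d\<in>D' y. (c, d) \<in> prel rst P"
proof (induction P arbitrary: x c)
  case (Cons s P)
  obtain h a b where s: "s = (h, a, b)" by (cases s)
  have h: "h \<in> H" "chain (plab h b) P y" "b \<in> ports h" "a \<in> ports h" "plab h a = x" using Cons.prems s by auto
  obtain t where t: "t \<in> R' h" "t a = c" "\<forall>q\<in>ports h. t q \<in> D' (plab h q)" using D'_ac[OF h(1,4)] h(5) Cons.prems(2) by blast
  then obtain d where "d \<in> D' y" "(t b, d) \<in> prel rst P" using Cons.IH[OF h(2)] h(3) by blast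
  then show ?case using t unfolding s rst_def by auto
qed auto

lemma prel_back_Q: "chain x P y \<Longrightarrow> d \<in> Q y \<Longrightarrow> \<exists>c\<in>Q x. (c, d) \<in> prel R P"
proof (induction P arbitrary: x)
  case (Cons s P)
  obtain h a b where s: "s = (h, a, b)" by (cases s)
  have h: "h \<in> H" "chain (plab h b) P y" "b \<in> ports h" "a \<in> ports h" "plab h a = x" using Cons.prems s by auto
  obtain c where c: "c \<in> Q (plab h b)" "(c, d) \<in> prel R P" using Cons.IH[OF h(2) Cons.prems(2)] by blast
  obtain t where t: "t \<in> R h" "t b = c" using R_ac[OF h(1,3) c(1)] by blast
  then have "t a \<in> Q x" "(t a, d) \<in> prel R (s # P)" using c(2) h R_Q[OF h(1) t(1) h(4)] unfolding s by auto
  then show ?case by blast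
qed auto

lemma prel_range: "chain x P y \<Longrightarrow> (c, d) \<in> prel R P \<Longrightarrow> c \<in> Q x \<Longrightarrow> d \<in> Q y"
proof (induction P arbitrary: x c)
  case (Cons s P)
  then show ?case using R_Q by (cases s) auto
qed auto

lemma prel_range_rst: "chain x P y \<Longrightarrow> (c, d) \<in> prel rst P \<Longrightarrow> c \<in> D' x \<Longrightarrow> d \<in> D' y"
proof (induction P arbitrary: x c)
  case (Cons s P)
  then show ?case by (cases s) (auto simp: rst_def)
qed auto

section \<open>Absorbing sets of maximal tolerance\<close>

definition absorbs :: "nat \<Rightarrow> 'b \<Rightarrow> 'c set \<Rightarrow> bool" where
  "absorbs k x A \<longleftrightarrow> A \<noteq> {} \<and> tol k A (D' x) \<and> tol 1 A (Q x)"

text \<open>For \<open>k\<close> at least \<open>N\<close> all arguments may deviate, and since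
  \<open>F\<close> is idempotent on \<open>D' x\<close>, constant tuples would force every element
  of \<open>D' x\<close> into \<open>A\<close>.\<close>

lemma absorbs_less_N: "absorbs k x A \<Longrightarrow> A \<noteq> D' x \<Longrightarrow> k < N"
proof (rule ccontr)
  assume A: "absorbs k x A" "A \<noteq> D' x" "\<not> k < N"
  then obtain d where d: "d \<in> D' x" "d \<notin> A" unfolding absorbs_def tol_def by blast
  have "card {i. i < N \<and> d \<notin> A} \<le> card {..<N}" by (rule card_mono) auto
  then have "F (\<lambda>_. d) \<in> A" using A(1,3) d unfolding absorbs_def by (intro tolD[of k A "D' x"]) auto
  moreover have "F (\<lambda>_. d) = d" by (rule F_nu[of _ x]) (use d D'_Q in auto)
  ultimately show False using d by simp
qed

lemma absorbs_singleton: "a \<in> D' x \<Longrightarrow> absorbs 1 x {a}"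
proof -
  assume a: "a \<in> D' x"
  have "tol 1 {a} B" if "B \<subseteq> Q x" "a \<in> B" for B
    unfolding tol_def using F_nu[of _ x a] that by (auto simp: subset_iff)
  then show ?thesis unfolding absorbs_def using a D'_Q by auto
qed

text \<open>A singleton inside a set with at least two elements starts the search at
  \<open>k = 1\<close>, and \<open>absorbs_less_N\<close> bounds it.\<close>

lemma maximal_absorbing:
  assumes "x0 \<in> X" "2 \<le> card (D' x0)"
  obtains k x A where "1 \<le> k" "x \<in> X" "absorbs k x A" "A \<noteq> D' x"
    "\<And>y B. absorbs (Suc k) y B \<Longrightarrow> B = D' y"
proof -
  let ?P = "\<lambda>k. \<exists>x\<in>X. \<exists>A. absorbs k x A \<and> A \<noteq> D' x"
  obtain a where a: "a \<in> D' x0" using D'_nonempty[OF assms(1)] by blast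
  have "{a} \<noteq> D' x0" using assms(2) by (metis card.empty card_insert_disjoint empty_iff finite.emptyI not_numeral_le_zero numeral_2_eq_2 not_less_eq_eq le_refl One_nat_def)
  then have P1: "?P 1" using absorbs_singleton[OF a] assms(1) by blast
  have bound: "\<forall>k. ?P k \<longrightarrow> id k < N" using absorbs_less_N by force
  obtain k where k: "?P k" "\<And>k'. ?P k' \<Longrightarrow> k' \<le> k"
    using ex_has_greatest_nat[OF P1 bound] by (metis id_apply)
  from k(1) obtain x A where xA: "x \<in> X" "absorbs k x A" "A \<noteq> D' x" by blast
  show ?thesis
  proof (rule that[OF _ xA])
    show "1 \<le> k" using k(2)[OF P1] .
    fix y B assume B: "absorbs (Suc k) y B"
    show "B = D' y"
    proof (rule ccontr)
      assume nB: "B \<noteq> D' y"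
      have "y \<in> X" using B D'_outside[of y] unfolding absorbs_def tol_def by auto
      then show False using k(2)[of "Suc k"] B nB by auto
    qed
  qed
qed

end

section \<open>Images of a set of maximal tolerance\<close>

locale nu_maximal = nu_subinstance +
  fixes k :: nat and x1 :: 'b and A0 :: "'c set"
  assumes k_pos: "1 \<le> k" and x1_X: "x1 \<in> X" and A0_abs: "absorbs k x1 A0" and A0_proper: "A0 \<noteq> D' x1"
    and k_max: "absorbs (Suc k) y B \<Longrightarrow> B = D' y"
begin

definition img :: "('a \<times> nat \<times> nat) list \<Rightarrow> 'c set \<Rightarrow> 'c set" where
  "img P S = prel R P `` S"

definition img' :: "('a \<times> nat \<times> nat) list \<Rightarrow> 'c set \<Rightarrow> 'c set" where
  "img' P S = prel rst P `` S"

lemma img_Nil: "img [] S = S"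
  by (simp add: img_def)

lemma img_append: "img (P @ P') S = img P' (img P S)"
  unfolding img_def prel_append by auto

lemma img'_append: "img' (P @ P') S = img' P' (img' P S)"
  unfolding img'_def prel_append by auto

lemma img_Q: "chain x P y \<Longrightarrow> S \<subseteq> Q x \<Longrightarrow> img P S \<subseteq> Q y"
  unfolding img_def using prel_range by blast

lemma k_less_N: "k < N" using absorbs_less_N[OF A0_abs A0_proper] .

lemma A0_D': "A0 \<subseteq> D' x1" using A0_abs unfolding absorbs_def tol_def by blast

lemma A0_Q: "A0 \<subseteq> Q x1" using A0_D' D'_Q by blast

text \<open>Images are taken along \<open>R\<close>, because the return condition concerns
  \<open>R\<close>. An image counts as long as it misses part of \<open>D' z\<close>; it may well
  contain elements outside \<open>D' z\<close>.\<close>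

definition images :: "('c set \<times> 'b) set" where
  "images = {(S, z). \<exists>P. chain x1 P z \<and> S = img P A0 \<and> \<not> D' z \<subseteq> S}"

definition reach :: "'c set \<times> 'b \<Rightarrow> ('c set \<times> 'b) set" where
  "reach q = {(S, z) \<in> images. \<exists>P. chain (snd q) P z \<and> S = img P (fst q)}"

lemma images_sub: "images \<subseteq> (SIGMA z:X. Pow (Q z))\<inverse>"
  unfolding images_def using chain_X[OF _ x1_X] img_Q[OF _ A0_Q] by (fastforce simp: subset_iff)

lemma finite_images: "finite images"
  by (rule finite_subset[OF images_sub]) (use fin_X fin_Q in auto)

lemma reach_trans: "(S, z) \<in> reach q \<Longrightarrow> reach (S, z) \<subseteq> reach q"
  unfolding reach_def by (auto simp: img_append[symmetric]) (use chain_append in blast)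

text \<open>The proper images form a finite directed graph. A vertex with fewest reachable vertices
  lies in a terminal strongly connected component, so whatever proper image is reached from it leads
  back.\<close>

lemma terminal_image:
  obtains H0 z0 where "(H0, z0) \<in> images"
    "\<And>P z. chain z0 P z \<Longrightarrow> \<not> D' z \<subseteq> img P H0 \<Longrightarrow> \<exists>P'. chain z P' z0 \<and> img P' (img P H0) = H0"
proof -
  have "(A0, x1) \<in> images" unfolding images_def using A0_D' A0_proper
    by (auto simp: img_def intro!: exI[of _ "[]"])
  then obtain q where q: "q \<in> images" "\<And>q'. q' \<in> images \<Longrightarrow> card (reach q) \<le> card (reach q')"
    using ex_has_least_nat[of "\<lambda>q. q \<in> images" "(A0, x1)" "\<lambda>q. card (reach q)"] by blast
  obtain H0 z0 where q_eq: "q = (H0, z0)" by (cases q)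
  have refl: "q \<in> reach q" unfolding reach_def using q(1) by (auto simp: q_eq img_def intro!: exI[of _ "[]"])
  show ?thesis
  proof (rule that[of H0 z0])
    show "(H0, z0) \<in> images" using q(1) q_eq by simp
    fix P z assume P: "chain z0 P z" "\<not> D' z \<subseteq> img P H0"
    obtain P0 where P0: "chain x1 P0 z0" "H0 = img P0 A0" using q(1) unfolding q_eq images_def by auto
    have "(img P H0, z) \<in> images" unfolding images_def using P P0 chain_append[of x1 P0 P z] img_append[of P0 P A0]
      by (auto intro!: exI[of _ "P0 @ P"])
    moreover from this have "(img P H0, z) \<in> reach q" unfolding reach_def using P(1) by (auto simp: q_eq)
    ultimately have "reach (img P H0, z) \<subseteq> reach q" "card (reach q) \<le> card (reach (img P H0, z))"
      using reach_trans q(2) by auto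
    moreover have "finite (reach q)" by (rule finite_subset[OF _ finite_images]) (auto simp: reach_def)
    ultimately have "reach (img P H0, z) = reach q" using card_seteq by blast
    then have "(H0, z0) \<in> reach (img P H0, z)" using refl by (simp add: q_eq)
    then show "\<exists>P'. chain z P' z0 \<and> img P' (img P H0) = H0" unfolding reach_def by auto
  qed
qed

end

section \<open>The shadow of a terminal image\<close>

locale nu_shadow = nu_maximal +
  fixes H0 :: "'c set" and z0 :: 'b
  assumes H0_image: "(H0, z0) \<in> images"
    and H0_return: "chain z0 P z \<Longrightarrow> \<not> D' z \<subseteq> img P H0 \<Longrightarrow> \<exists>P'. chain z P' z0 \<and> img P' (img P H0) = H0"
begin

definition W :: "'b set" where
  "W = {z. \<exists>P. chain z0 P z \<and> \<not> D' z \<subseteq> img P H0}"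

definition shadow :: "'b \<Rightarrow> 'c set" where
  "shadow z = img (SOME P. chain z0 P z \<and> \<not> D' z \<subseteq> img P H0) H0"

definition E :: "'b \<Rightarrow> 'c set" where
  "E z = shadow z \<inter> D' z"

lemma iterate_img:
  assumes "img (P @ P') S = S" shows "img (concat (replicate j (P @ P'))) S = S"
  by (induction j) (simp_all only: replicate.simps concat.simps img_append[of "P @ P'"] assms img_Nil)

text \<open>This is the only place where the condition on pairs of closed paths is used.\<close>

lemma image_unique_le:
  assumes P: "chain z0 P z" "\<not> D' z \<subseteq> img P H0" and P': "chain z0 P' z" "\<not> D' z \<subseteq> img P' H0"
  shows "img P H0 \<subseteq> img P' H0"
proof -
  let ?S = "img P H0" and ?S' = "img P' H0"
  obtain B where B: "chain z B z0" "img B ?S = H0" using H0_return[OF P] by blast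
  obtain B' where B': "chain z B' z0" "img B' ?S' = H0" using H0_return[OF P'] by blast
  \<comment> \<open>The closed path \<open>B @ P'\<close> carries \<open>?S\<close> to
    \<open>?S'\<close>, and \<open>B' @ P\<close> carries it back. Full rounds of both fix
    \<open>?S\<close>, and the final \<open>B @ P'\<close> ends in \<open>?S'\<close>; an element of
    \<open>?S\<close> that returns to itself along this pattern therefore lies in
    \<open>?S'\<close>.\<close>
  have p: "img (B @ P') ?S = ?S'" and q: "img (B' @ P) ?S' = ?S" by (simp_all add: img_append B B')
  have ch: "chain z (B @ P') z" "chain z (B' @ P) z" using B B' P P' chain_append by blast+
  \<comment> \<open>The return condition concerns non-empty closed paths; an empty one makes the two
    images equal at once.\<close>
  show ?thesis
  proof (cases "B @ P' = [] \<or> B' @ P = []")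
    case True
    then show ?thesis using p q img_Nil by (metis order_refl)
  next
    case False
    have z0: "z0 \<in> X" and H0: "H0 \<subseteq> Q z0" using H0_image images_sub by auto
    show ?thesis
    proof
      fix a assume a: "a \<in> ?S"
      have "a \<in> Q z" using a img_Q[OF P(1) H0] by blast
      from pq[OF ch _ _ this] False obtain j
        where "(a, a) \<in> prel R (concat (replicate j ((B @ P') @ B' @ P)) @ B @ P')" by blast
      then have "a \<in> img (concat (replicate j ((B @ P') @ B' @ P)) @ B @ P') ?S" using a unfolding img_def by blast
      also have "\<dots> = img (B @ P') (img (concat (replicate j ((B @ P') @ B' @ P))) ?S)" by (rule img_append)
      also have "img (concat (replicate j ((B @ P') @ B' @ P))) ?S = ?S"
        by (rule iterate_img) (simp only: img_append[of "B @ P'"] p q)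
      finally show "a \<in> ?S'" unfolding p .
    qed
  qed
qed

lemma shadow_eq:
  assumes "chain z0 P z" "\<not> D' z \<subseteq> img P H0" shows "z \<in> W" "shadow z = img P H0"
proof -
  show "z \<in> W" using assms unfolding W_def by blast
  let ?P = "SOME P. chain z0 P z \<and> \<not> D' z \<subseteq> img P H0"
  have "chain z0 ?P z \<and> \<not> D' z \<subseteq> img ?P H0" by (rule someI[of _ P]) (use assms in blast)
  then show "shadow z = img P H0" unfolding shadow_def using image_unique_le assms by blast
qed

text \<open>The path from \<open>z0\<close> serves to prolong the image, the path from
  \<open>x1\<close> to pull elements of the shadow back into \<open>A0\<close>, where the tolerance
  is known.\<close>

lemma W_E:
  assumes "z \<in> W"
  obtains P P1 where "chain z0 P z" "shadow z = img P H0" "\<not> D' z \<subseteq> shadow z" "chain x1 P1 z" "shadow z = img P1 A0"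
proof -
  obtain P where P: "chain z0 P z" "\<not> D' z \<subseteq> img P H0" using assms unfolding W_def by blast
  obtain P0 where P0: "chain x1 P0 z0" "H0 = img P0 A0" using H0_image unfolding images_def by auto
  show ?thesis by (rule that[of P "P0 @ P"]) (use P P0 shadow_eq[OF P] chain_append img_append in auto)
qed

lemma W_X: "z \<in> W \<Longrightarrow> z \<in> X" by (erule W_E) (use chain_X x1_X in blast)

lemma shadow_Q: "z \<in> W \<Longrightarrow> shadow z \<subseteq> Q z" by (erule W_E) (use img_Q[OF _ A0_Q] in blast)

lemma E_proper: "z \<in> W \<Longrightarrow> E z \<subset> D' z" by (erule W_E) (auto simp: E_def)

lemma E_nonempty: "z \<in> W \<Longrightarrow> E z \<noteq> {}"
proof (erule W_E)
  fix P P1 assume P1: "chain x1 P1 z" "shadow z = img P1 A0"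
  obtain a where a: "a \<in> A0" using A0_abs unfolding absorbs_def by blast
  then obtain d where "d \<in> D' z" "(a, d) \<in> prel rst P1" using prel_forth[OF P1(1)] A0_D' by blast
  then have "d \<in> E z" using a P1 prel_rst_R[OF P1(1)] unfolding E_def img_def by auto
  then show ?thesis by blast
qed

lemma prel_F: "chain x P y \<Longrightarrow> (\<And>i. i < N \<Longrightarrow> (u i, v i) \<in> prel R P) \<Longrightarrow> (F u, F v) \<in> prel R P"
  by (rule prel_apply[where Rel = "\<lambda>_. R"]) (use F_R in auto)

text \<open>Pull the arguments back along the path from \<open>x1\<close>: elements of the shadow
  come from \<open>A0\<close>, the at most \<open>k\<close> others from \<open>D' x1\<close>, and
  \<open>A0\<close> absorbs them. The argument \<open>i0\<close> may lie outside
  \<open>D' z\<close>, since \<open>D' z\<close> absorbs one argument from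
  \<open>Q z\<close>.\<close>

lemma shadow_absorbs:
  assumes z: "z \<in> W" and i0: "i0 < N" and v: "\<And>i. i < N \<Longrightarrow> i \<noteq> i0 \<Longrightarrow> v i \<in> D' z" "v i0 \<in> shadow z"
    and c: "card {i. i < N \<and> i \<noteq> i0 \<and> v i \<notin> E z} \<le> k"
  shows "F v \<in> E z"
  using z
proof (rule W_E)
  fix P P1 assume P1: "chain x1 P1 z" "shadow z = img P1 A0"
  have "\<exists>c\<in>D' x1. (c, v i) \<in> prel R P1 \<and> (i = i0 \<or> v i \<in> E z \<longrightarrow> c \<in> A0)" if i: "i < N" for i
  proof (cases "i = i0 \<or> v i \<in> E z")
    case True
    then have "v i \<in> shadow z" using v(2) by (auto simp: E_def)
    then obtain c where "c \<in> A0" "(c, v i) \<in> prel R P1" unfolding P1(2) img_def by blast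
    then show ?thesis using A0_D' by blast
  next
    case False
    then show ?thesis using prel_back[OF P1(1)] v(1) i prel_rst_R[OF P1(1)] by blast
  qed
  then have "\<forall>i. \<exists>c. i < N \<longrightarrow> c \<in> D' x1 \<and> (c, v i) \<in> prel R P1 \<and> (i = i0 \<or> v i \<in> E z \<longrightarrow> c \<in> A0)" by blast
  from choice[OF this]
  obtain u where u: "\<And>i. i < N \<Longrightarrow> u i \<in> D' x1" "\<And>i. i < N \<Longrightarrow> (u i, v i) \<in> prel R P1"
    "\<And>i. i < N \<Longrightarrow> i = i0 \<or> v i \<in> E z \<Longrightarrow> u i \<in> A0" by blast
  have "{i. i < N \<and> u i \<notin> A0} \<subseteq> {i. i < N \<and> i \<noteq> i0 \<and> v i \<notin> E z}" using u(3) by blast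
  from card_mono[OF _ this] c have "card {i. i < N \<and> u i \<notin> A0} \<le> k" by simp
  then have "F u \<in> A0" using A0_abs u(1) unfolding absorbs_def by (intro tolD[of k A0 "D' x1"]) auto
  moreover have "(F u, F v) \<in> prel R P1" by (rule prel_F[OF P1(1) u(2)])
  ultimately have "F v \<in> shadow z" unfolding P1(2) img_def by blast
  moreover have "F v \<in> D' z" by (rule F_D'_one[OF i0]) (use v shadow_Q[OF z] in auto)
  ultimately show ?thesis unfolding E_def by blast
qed

lemma E_tol: assumes z: "z \<in> W" shows "tol k (E z) (D' z)"
  unfolding tol_def
proof (intro conjI allI impI)
  fix v assume v: "(\<forall>i<N. v i \<in> D' z) \<and> card {i. i < N \<and> v i \<notin> E z} \<le> k"
  \<comment> \<open>As \<open>k < N\<close>, some argument does not deviate; it plays the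
    distinguished role in \<open>shadow_absorbs\<close>.\<close>
  have "\<exists>i0<N. v i0 \<in> E z"
  proof (rule ccontr)
    assume "\<not> ?thesis"
    then have "{i. i < N \<and> v i \<notin> E z} = {..<N}" by auto
    then show False using v k_less_N by simp
  qed
  then obtain i0 where i0: "i0 < N" "v i0 \<in> E z" by blast
  show "F v \<in> E z"
  proof (rule shadow_absorbs[OF z i0(1)])
    show "v i0 \<in> shadow z" using i0 by (simp add: E_def)
    have "card {i. i < N \<and> i \<noteq> i0 \<and> v i \<notin> E z} \<le> card {i. i < N \<and> v i \<notin> E z}" by (rule card_mono) auto
    then show "card {i. i < N \<and> i \<noteq> i0 \<and> v i \<notin> E z} \<le> k" using v by linarith
  qed (use v in auto)
qed (use E_proper[OF z] in auto)

lemma tol_1I: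
  assumes "A \<subseteq> B" "\<And>v i0. i0 < N \<Longrightarrow> (\<And>i. i < N \<Longrightarrow> i \<noteq> i0 \<Longrightarrow> v i \<in> A) \<Longrightarrow> v i0 \<in> B \<Longrightarrow> F v \<in> A"
  shows "tol 1 A B"
  unfolding tol_def
proof (intro conjI allI impI)
  fix v assume v: "(\<forall>i<N. v i \<in> B) \<and> card {i. i < N \<and> v i \<notin> A} \<le> 1"
  have "\<exists>i0<N. \<forall>i<N. i \<noteq> i0 \<longrightarrow> v i \<in> A"
  proof (cases "{i. i < N \<and> v i \<notin> A} = {}")
    case True
    then show ?thesis using N_pos by blast
  next
    case False
    then obtain i0 where i0: "i0 < N" "v i0 \<notin> A" by blast
    have "card {i. i < N \<and> v i \<notin> A} \<le> Suc 0" using v by simp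
    from this[unfolded card_le_Suc0_iff_eq[OF finite_Collect_conjI[OF disjI1[OF finite_Collect_less_nat]]]]
    show ?thesis using i0 by blast
  qed
  then show "F v \<in> A" using assms(2) v by blast
qed (fact assms(1))

lemma E_tol_Q: assumes z: "z \<in> W" shows "tol 1 (E z) (Q z)"
proof (rule tol_1I)
  show "E z \<subseteq> Q z" using E_proper[OF z] D'_Q by blast
  fix v i0 assume i0: "i0 < N" and v: "\<And>i. i < N \<Longrightarrow> i \<noteq> i0 \<Longrightarrow> v i \<in> E z" "v i0 \<in> Q z"
  show "F v \<in> E z"
    using z
  proof (rule W_E)
    fix P P1 assume P1: "chain x1 P1 z" "shadow z = img P1 A0"
    have "\<exists>c\<in>Q x1. (c, v i) \<in> prel R P1 \<and> (i \<noteq> i0 \<longrightarrow> c \<in> A0)" if i: "i < N" for i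
    proof (cases "i = i0")
      case True
      then show ?thesis using prel_back_Q[OF P1(1) v(2)] by blast
    next
      case False
      then have "v i \<in> shadow z" using v(1)[OF i] by (auto simp: E_def)
      then obtain c where "c \<in> A0" "(c, v i) \<in> prel R P1" unfolding P1(2) img_def by blast
      then show ?thesis using A0_Q by blast
    qed
    then have "\<forall>i. \<exists>c. i < N \<longrightarrow> c \<in> Q x1 \<and> (c, v i) \<in> prel R P1 \<and> (i \<noteq> i0 \<longrightarrow> c \<in> A0)" by blast
    from choice[OF this]
    obtain u where u: "\<And>i. i < N \<Longrightarrow> u i \<in> Q x1" "\<And>i. i < N \<Longrightarrow> (u i, v i) \<in> prel R P1"
      "\<And>i. i < N \<Longrightarrow> i \<noteq> i0 \<Longrightarrow> u i \<in> A0" by blast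
    have "{i. i < N \<and> u i \<notin> A0} \<subseteq> {i0}" using u(3) by blast
    then have "F u \<in> A0" using A0_abs u(1) unfolding absorbs_def
      by (intro tolD[of 1 A0 "Q x1"] card_le_1[of _ i0]) auto
    moreover have "(F u, F v) \<in> prel R P1" by (rule prel_F[OF P1(1) u(2)])
    ultimately have "F v \<in> shadow z" unfolding P1(2) img_def by blast
    moreover have "F v \<in> D' z" by (rule F_D'_one[OF i0]) (use v E_proper[OF z] in auto)
    ultimately show ?thesis unfolding E_def by blast
  qed
qed

text \<open>If the unrestricted image of the shadow is everything, one more argument of the operation
  becomes free, and \<open>k\<close> was maximal.\<close>

lemma image_full_or_in_E:
  assumes z: "z \<in> W" and P: "chain z P w"
  shows "img' P (E z) = D' w \<or> (w \<in> W \<and> img' P (E z) \<subseteq> E w)"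
proof (cases "D' w \<subseteq> img P (shadow z)")
  case False
  from z obtain P0 where P0: "chain z0 P0 z" "shadow z = img P0 H0" by (rule W_E)
  have "chain z0 (P0 @ P) w" "\<not> D' w \<subseteq> img (P0 @ P) H0" using P0 P False by (auto simp: chain_append img_append)
  from shadow_eq[OF this] have w: "w \<in> W" "shadow w = img P (shadow z)" by (simp_all add: img_append P0)
  have "img' P (E z) \<subseteq> img P (shadow z)" using prel_rst_R[OF P] unfolding img'_def img_def E_def by blast
  moreover have "img' P (E z) \<subseteq> D' w" using prel_range_rst[OF P] unfolding img'_def E_def by blast
  ultimately show ?thesis using w unfolding E_def[of w] by blast
next
  case True
  let ?B = "img' P (E z)"
  have BD: "?B \<subseteq> D' w" using prel_range_rst[OF P] unfolding img'_def E_def by blast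
  have "absorbs (Suc k) w ?B"
    unfolding absorbs_def
  proof (intro conjI)
    obtain e where "e \<in> E z" using E_nonempty[OF z] by blast
    then show "?B \<noteq> {}" using prel_forth[OF P, of e] E_proper[OF z] unfolding img'_def by blast
    show "tol (Suc k) ?B (D' w)"
      unfolding tol_def
    proof (intro conjI allI impI)
      fix v assume v: "(\<forall>i<N. v i \<in> D' w) \<and> card {i. i < N \<and> v i \<notin> ?B} \<le> Suc k"
      \<comment> \<open>One deviating argument is set apart. It is pulled back through
        \<open>R\<close> into the shadow, which is possible because the image of the shadow covers
        \<open>D' w\<close>. The at most \<open>k\<close> other deviating ones are pulled back
        through \<open>rst\<close>, and \<open>prel_mix\<close> carries the result forward
        again.\<close>
      obtain i0 where i0: "i0 < N" "card {i. i < N \<and> i \<noteq> i0 \<and> v i \<notin> ?B} \<le> k"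
      proof (cases "\<exists>i<N. v i \<notin> ?B")
        case True
        then obtain i0 where i0: "i0 < N" "v i0 \<notin> ?B" by blast
        have "{i. i < N \<and> v i \<notin> ?B} = insert i0 {i. i < N \<and> i \<noteq> i0 \<and> v i \<notin> ?B}" using i0 by blast
        then have "card {i. i < N \<and> v i \<notin> ?B} = Suc (card {i. i < N \<and> i \<noteq> i0 \<and> v i \<notin> ?B})" by simp
        then show ?thesis using that i0 v by simp
      next
        case False
        then have e: "{i. i < N \<and> i \<noteq> 0 \<and> v i \<notin> ?B} = {}" by blast
        show ?thesis by (rule that[of 0]) (use N_pos in \<open>simp_all only: e card.empty le0\<close>)
      qed
      have "\<exists>c. (i = i0 \<longrightarrow> c \<in> shadow z \<and> (c, v i) \<in> prel R P) \<and>
          (i \<noteq> i0 \<longrightarrow> c \<in> D' z \<and> (c, v i) \<in> prel rst P \<and> (v i \<in> ?B \<longrightarrow> c \<in> E z))" if i: "i < N" for i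
      proof (cases "i = i0")
        case True
        then have "v i \<in> img P (shadow z)" using v \<open>D' w \<subseteq> img P (shadow z)\<close> i by blast
        then show ?thesis using True unfolding img_def by blast
      next
        case False
        show ?thesis
        proof (cases "v i \<in> ?B")
          case True
          then show ?thesis using False E_proper[OF z] unfolding img'_def by blast
        next
          case nB: False
          then show ?thesis using False prel_back[OF P, of "v i"] v i by blast
        qed
      qed
      then have "\<forall>i. \<exists>c. i < N \<longrightarrow> (i = i0 \<longrightarrow> c \<in> shadow z \<and> (c, v i) \<in> prel R P) \<and>
          (i \<noteq> i0 \<longrightarrow> c \<in> D' z \<and> (c, v i) \<in> prel rst P \<and> (v i \<in> ?B \<longrightarrow> c \<in> E z))" by blast
      from choice[OF this]
      obtain u where u: "u i0 \<in> shadow z" "(u i0, v i0) \<in> prel R P"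
        "\<And>i. i < N \<Longrightarrow> i \<noteq> i0 \<Longrightarrow> u i \<in> D' z" "\<And>i. i < N \<Longrightarrow> i \<noteq> i0 \<Longrightarrow> (u i, v i) \<in> prel rst P"
        "\<And>i. i < N \<Longrightarrow> i \<noteq> i0 \<Longrightarrow> v i \<in> ?B \<Longrightarrow> u i \<in> E z" using i0(1) by blast
      have "{i. i < N \<and> i \<noteq> i0 \<and> u i \<notin> E z} \<subseteq> {i. i < N \<and> i \<noteq> i0 \<and> v i \<notin> ?B}" using u(5) by blast
      from card_mono[OF _ this] i0(2) have "card {i. i < N \<and> i \<noteq> i0 \<and> u i \<notin> E z} \<le> k" by simp
      then have "F u \<in> E z" by (intro shadow_absorbs[OF z i0(1)] u) auto
      moreover have "(F u, F v) \<in> prel rst P" by (rule prel_mix[OF P i0(1)]) (use u in auto)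
      ultimately show "F v \<in> ?B" unfolding img'_def by blast
    qed (fact BD)
    show "tol 1 ?B (Q w)"
    proof (rule tol_1I)
      show "?B \<subseteq> Q w" using BD D'_Q by blast
      fix v i0 assume i0: "i0 < N" and v: "\<And>i. i < N \<Longrightarrow> i \<noteq> i0 \<Longrightarrow> v i \<in> ?B" "v i0 \<in> Q w"
      have "\<exists>c. (i = i0 \<longrightarrow> c \<in> Q z \<and> (c, v i) \<in> prel R P) \<and>
          (i \<noteq> i0 \<longrightarrow> c \<in> E z \<and> (c, v i) \<in> prel rst P)" if i: "i < N" for i
        using v i prel_back_Q[OF P v(2)] unfolding img'_def by (cases "i = i0") blast+
      then have "\<forall>i. \<exists>c. i < N \<longrightarrow> (i = i0 \<longrightarrow> c \<in> Q z \<and> (c, v i) \<in> prel R P) \<and>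
          (i \<noteq> i0 \<longrightarrow> c \<in> E z \<and> (c, v i) \<in> prel rst P)" by blast
      from choice[OF this]
      obtain u where u: "u i0 \<in> Q z" "(u i0, v i0) \<in> prel R P"
        "\<And>i. i < N \<Longrightarrow> i \<noteq> i0 \<Longrightarrow> u i \<in> E z" "\<And>i. i < N \<Longrightarrow> i \<noteq> i0 \<Longrightarrow> (u i, v i) \<in> prel rst P"
        using i0(1) by blast
      have "F u \<in> E z"
      proof (rule tolD[OF E_tol_Q[OF z]])
        show "u i \<in> Q z" if "i < N" for i using u that E_proper[OF z] D'_Q[of z] by (cases "i = i0") auto
        show "card {i. i < N \<and> u i \<notin> E z} \<le> 1" by (rule card_le_1[of _ i0]) (use u(3) in blast)
      qed
      moreover have "(F u, F v) \<in> prel rst P" by (rule prel_mix[OF P i0]) (use u in auto)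
      ultimately show "F v \<in> ?B" unfolding img'_def by blast
    qed
  qed
  then show ?thesis using k_max by blast
qed


section \<open>Trees whose spots are restricted to the shadow\<close>

definition spots :: "nat set \<Rightarrow> nat \<Rightarrow> 'b \<Rightarrow> 'c set" where
  "spots Z m x = (if m \<in> Z then E x else D' x)"

definition tsat :: "nat set \<Rightarrow> 'a gtree \<Rightarrow> 'b \<Rightarrow> 'c set" where
  "tsat Z = sat R' D' (spots Z)"

abbreviation wtree :: "'b \<Rightarrow> 'a gtree \<Rightarrow> (nat \<times> 'b) set \<Rightarrow> bool" where
  "wtree \<equiv> wft H X W"

lemma tsat_D': "tsat Z T x \<subseteq> D' x"
  unfolding tsat_def by (rule sat_subset)

lemma tsat_full: "wtree x T S \<Longrightarrow> Z \<inter> fst ` S = {} \<Longrightarrow> tsat Z T x = D' x"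
  unfolding tsat_def
proof (rule sat_full)
  fix m z assume "Z \<inter> fst ` S = {}" "(m, z) \<in> S"
  then have "m \<notin> Z" by force
  then show "D' z \<subseteq> spots Z m z" by (simp add: spots_def)
qed (use D'_ac in auto)

text \<open>By arc consistency of \<open>D'\<close>, branches without a restricted spot impose
  nothing, so the tree acts like the path from its one restricted spot to the root.\<close>

lemma tsat_path:
  assumes "wtree x T S" "(w, z) \<in> S" "Z \<inter> fst ` S = {w}"
  shows "\<exists>P. chain z P x \<and> tsat Z T x = img' P (E z)"
  using assms
proof (induction rule: wft.induct)
  case (wft_Spot x m)
  then have "w = m" "z = x" "m \<in> Z" by auto
  then have "tsat Z (Spot m) x = E x" using E_proper[OF wft_Spot(1)] by (auto simp: tsat_def spots_def)
  then show ?case using \<open>z = x\<close> by (intro exI[of _ "[]"]) (simp add: img'_def)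
next
  case (wft_Meet x A S B S')
  show ?case
  proof (cases "(w, z) \<in> S")
    case True
    have "w \<in> fst ` S" using True by force
    then have "Z \<inter> fst ` S = {w}" "Z \<inter> fst ` S' = {}" using wft_Meet.prems(2) wft_Meet(4) by auto
    then have "\<exists>P. chain z P x \<and> tsat Z A x = img' P (E z)" "tsat Z B x = D' x"
      using wft_Meet.IH(1)[OF True] tsat_full[OF wft_Meet(3)] by auto
    moreover have "tsat Z (Meet A B) x = tsat Z A x \<inter> tsat Z B x" by (simp add: tsat_def)
    ultimately show ?thesis using tsat_D'[of Z A x] by (metis inf.orderE)
  next
    case False
    then have True: "(w, z) \<in> S'" using wft_Meet.prems(1) by auto
    then have "w \<in> fst ` S'" by force
    then have "Z \<inter> fst ` S' = {w}" "Z \<inter> fst ` S = {}" using wft_Meet.prems(2) wft_Meet(4) by auto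
    then have "\<exists>P. chain z P x \<and> tsat Z B x = img' P (E z)" "tsat Z A x = D' x"
      using wft_Meet.IH(2)[OF True] tsat_full[OF wft_Meet(2)] by auto
    moreover have "tsat Z (Meet A B) x = tsat Z A x \<inter> tsat Z B x" by (simp add: tsat_def)
    ultimately show ?thesis using tsat_D'[of Z B x] by (metis inf.orderE inf_commute)
  qed
next
  case (wft_Edge x h p ts S)
  obtain q0 where q0: "q0 \<in> ports h - {p}" "(w, z) \<in> S q0" using wft_Edge.prems(1) by auto
  have "w \<in> fst ` S q0" using q0(2) by force
  then have Zq0: "Z \<inter> fst ` S q0 = {w}" using wft_Edge.prems(2) q0(1) by auto
  have Zq: "tsat Z (ts q) (plab h q) = D' (plab h q)" if q: "q \<in> ports h - {p}" "q \<noteq> q0" for q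
  proof (rule tsat_full[OF wft_Edge(5)[OF q(1)]])
    have "Z \<inter> fst ` S q \<subseteq> {w}" using wft_Edge.prems(2) q(1) by auto
    moreover have "w \<notin> fst ` S q" using wft_Edge(6)[OF q(1) q0(1) q(2)] \<open>w \<in> fst ` S q0\<close> by blast
    ultimately show "Z \<inter> fst ` S q = {}" by blast
  qed
  obtain P where P: "chain z P (plab h q0)" "tsat Z (ts q0) (plab h q0) = img' P (E z)"
    using wft_Edge.IH[OF q0(1) q0(2) Zq0] by blast
  have ch: "chain z (P @ [(h, q0, p)]) x" using P(1) wft_Edge(2-4) q0(1) by (auto simp: chain_append)
  have "tsat Z (Edge h p ts) x = img' (P @ [(h, q0, p)]) (E z)"
  proof (rule set_eqI)
    fix a
    have *: "a \<in> tsat Z (Edge h p ts) x \<longleftrightarrow> a \<in> D' x \<and> (\<exists>t\<in>R' h. t p = a \<and> (\<forall>q\<in>ports h - {p}. t q \<in> tsat Z (ts q) (plab h q)))"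
      by (simp add: tsat_def)
    have **: "a \<in> img' (P @ [(h, q0, p)]) (E z) \<longleftrightarrow> (\<exists>t\<in>rst h. t p = a \<and> t q0 \<in> img' P (E z))"
      unfolding img'_append by (auto simp: img'_def)
    show "a \<in> tsat Z (Edge h p ts) x \<longleftrightarrow> a \<in> img' (P @ [(h, q0, p)]) (E z)"
      unfolding * **
    proof
      assume "a \<in> D' x \<and> (\<exists>t\<in>R' h. t p = a \<and> (\<forall>q\<in>ports h - {p}. t q \<in> tsat Z (ts q) (plab h q)))"
      then obtain t where t: "a \<in> D' x" "t \<in> R' h" "t p = a" "\<And>q. q \<in> ports h - {p} \<Longrightarrow> t q \<in> tsat Z (ts q) (plab h q)" by blast
      have "t q \<in> D' (plab h q)" if "q \<in> ports h" for q
        using t wft_Edge(4) tsat_D' that by (cases "q = p") blast+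
      then have "t \<in> rst h" using t(2) unfolding rst_def by blast
      then show "\<exists>t\<in>rst h. t p = a \<and> t q0 \<in> img' P (E z)" using t P(2) q0(1) by blast
    next
      assume "\<exists>t\<in>rst h. t p = a \<and> t q0 \<in> img' P (E z)"
      then obtain t where t: "t \<in> rst h" "t p = a" "t q0 \<in> img' P (E z)" by blast
      have "t q \<in> tsat Z (ts q) (plab h q)" if "q \<in> ports h - {p}" for q
        using t P(2) Zq[OF that] that unfolding rst_def by (cases "q = q0") auto
      moreover have "a \<in> D' x" "t \<in> R' h" using t wft_Edge(3,4) unfolding rst_def by auto
      ultimately show "a \<in> D' x \<and> (\<exists>t\<in>R' h. t p = a \<and> (\<forall>q\<in>ports h - {p}. t q \<in> tsat Z (ts q) (plab h q)))"
        using t(2) by blast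
    qed
  qed
  then show ?case using ch by blast
qed simp

text \<open>The deviating argument solves the tree with \<open>R\<close>, \<open>Q\<close> and no
  prescription, which allows all of \<open>Q x\<close> by \<open>R_ac\<close>. Relations, domains
  and spots each absorb one such argument.\<close>

lemma tsat_tol_Q: assumes "wtree x T S" shows "tol 1 (tsat Z T x) (Q x)"
proof (rule tol_1I)
  show "tsat Z T x \<subseteq> Q x" using tsat_D' D'_Q by blast
  fix v i0 assume i0: "i0 < N" and v: "\<And>i. i < N \<Longrightarrow> i \<noteq> i0 \<Longrightarrow> v i \<in> tsat Z T x" "v i0 \<in> Q x"
  let ?R = "\<lambda>i. if i = i0 then R else R'" and ?U = "\<lambda>i. if i = i0 then Q else D'"
    and ?dec = "\<lambda>i. if i = i0 then (\<lambda>_ _. UNIV) else spots Z"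
  show "F v \<in> tsat Z T x"
    unfolding tsat_def
  proof (rule sat_apply[OF assms, where R = ?R and U = ?U and dec = ?dec and N = N and F = F and v = v])
    fix h and t :: "nat \<Rightarrow> nat \<Rightarrow> 'c" assume h: "h \<in> H" and t: "\<And>i. i < N \<Longrightarrow> t i \<in> ?R i h"
    show "(\<lambda>p. F (\<lambda>i. t i p)) \<in> R' h"
    proof (rule F_R'[OF h, of t])
      show "t i \<in> R h" if "i < N" for i using t[OF that] R'_subset[OF h] by (auto split: if_splits)
      have "t i \<in> R' h" if "i < N" "i \<noteq> i0" for i using t[OF that(1)] that(2) by simp
      then show "card {i. i < N \<and> t i \<notin> R' h} \<le> 1" by (intro card_le_1[of _ i0]) blast
    qed
  next
    fix x v assume v: "\<And>i. i < N \<Longrightarrow> v i \<in> ?U i x"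
    show "F v \<in> D' x"
    proof (rule F_D'_one[OF i0])
      show "v i \<in> D' x" if "i < N" "i \<noteq> i0" for i using v[OF that(1)] that(2) by simp
      show "v i0 \<in> Q x" using v[OF i0] by simp
    qed
  next
    fix m z v assume mz: "(m, z) \<in> S" and v: "\<And>i. i < N \<Longrightarrow> v i \<in> ?dec i m z \<inter> ?U i z"
    have vi0: "v i0 \<in> Q z" using v[OF i0] by simp
    have vD: "v i \<in> D' z" "v i \<in> spots Z m z" if "i < N" "i \<noteq> i0" for i using v[OF that(1)] that(2) by auto
    have vQ: "v i \<in> Q z" if "i < N" for i using vi0 vD[OF that] D'_Q[of z] by (cases "i = i0") auto
    show "F v \<in> spots Z m z"
    proof (cases "m \<in> Z")
      case True
      have "F v \<in> E z"
      proof (rule tolD[OF E_tol_Q])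
        show "z \<in> W" using wft_spot_label[OF assms mz] .
        show "card {i. i < N \<and> v i \<notin> E z} \<le> 1" by (rule card_le_1[of _ i0]) (use vD(2) True in \<open>auto simp: spots_def\<close>)
      qed (fact vQ)
      then show ?thesis using True by (simp add: spots_def)
    next
      case False
      then show ?thesis using F_D'_one[OF i0, of v z] vD(1) vi0 by (simp add: spots_def)
    qed
  next
    fix i assume i: "i < N"
    show "v i \<in> sat (?R i) (?U i) (?dec i) T x"
    proof (cases "i = i0")
      case True
      have "sat R Q (\<lambda>_ _. UNIV) T x = Q x"
      proof (rule sat_full[OF assms])
        fix h p a assume h: "h \<in> H" "p \<in> ports h" "a \<in> Q (plab h p)"
        then show "\<exists>t\<in>R h. t p = a \<and> (\<forall>q\<in>ports h. t q \<in> Q (plab h q))" using R_ac[OF h] R_Q by blast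
      qed auto
      then show ?thesis using True v(2) by simp
    next
      case False
      then show ?thesis using v(1)[OF i] by (simp add: tsat_def)
    qed
  qed
qed

lemma tsat_mono: assumes "wtree x T S" "Z \<subseteq> Z'" shows "tsat Z' T x \<subseteq> tsat Z T x"
  unfolding tsat_def
proof (rule sat_mono[OF assms(1)])
  fix m z assume "(m, z) \<in> S"
  then have "z \<in> W" using wft_spot_label[OF assms(1)] by blast
  then show "spots Z' m z \<inter> D' z \<subseteq> spots Z m z" using assms(2) E_proper by (auto simp: spots_def)
qed auto

text \<open>One restricted spot is the case of a path. With several, either freeing some spot
  already leaves a value inside \<open>E x\<close>, or freeing any single one gives
  \<open>D' x\<close>; in the second case two spots can share the deviating arguments, which yields
  tolerance \<open>k + 1\<close>.\<close>

lemma tsat_dichotomy: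
  "\<lbrakk>wtree x T S; x \<in> X; card (Z \<inter> fst ` S) = c\<rbrakk> \<Longrightarrow>
    tsat Z T x \<noteq> {} \<and> (tsat Z T x = D' x \<or> (x \<in> W \<and> tsat Z T x \<subseteq> E x))"
proof (induction c arbitrary: x T S Z rule: less_induct)
  case (less c)
  note T = less.prems(1)
  have finS: "finite (Z \<inter> fst ` S)" using wft_finite[OF fin_ports T] by blast
  consider "c = 0" | "c = 1" | "c \<ge> 2" by linarith
  then show ?case
  proof cases
    case 1
    then have "Z \<inter> fst ` S = {}" using less.prems(3) finS by simp
    then show ?thesis using tsat_full[OF T] D'_nonempty[OF less.prems(2)] by simp
  next
    case 2
    then obtain w where w: "Z \<inter> fst ` S = {w}" using less.prems(3) by (auto simp: card_1_singleton_iff)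
    then obtain z where z: "(w, z) \<in> S" by (metis IntE fst_conv imageE insertI1 surj_pair)
    from tsat_path[OF T z w] obtain P where P: "chain z P x" "tsat Z T x = img' P (E z)" by blast
    have zW: "z \<in> W" using wft_spot_label[OF T z] .
    obtain e where e: "e \<in> E z" using E_nonempty[OF zW] by blast
    then have "img' P (E z) \<noteq> {}" using prel_forth[OF P(1), of e] E_proper[OF zW] unfolding img'_def by blast
    then show ?thesis using image_full_or_in_E[OF zW P(1)] P(2) by simp
  next
    case 3
    \<comment> \<open>Seen from a restricted spot, the rest of the tree has fewer restricted spots.
      By induction its value there is \<open>D' z\<close> or a non-empty part of \<open>E z\<close>,
      and both meet \<open>E z\<close>.\<close>
    have ne: "tsat Z T x \<noteq> {}"
    proof -
      have "Z \<inter> fst ` S \<noteq> {}" using less.prems(3) 3 by auto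
      then obtain w z where wz: "(w, z) \<in> S" "w \<in> Z" by force
      have zW: "z \<in> W" using wft_spot_label[OF T wz(1)] .
      obtain T' S' where T': "(T' = Free \<and> S' = {}) \<or> wtree z T' S' \<or> wfe H X W z T' S'" "S' = S - {(w, z)} \<union> {}"
        "\<forall>R U dec. sat R U dec T x \<inter> sat R U dec Free x \<noteq> {} \<longleftrightarrow> sat R U dec T' z \<inter> dec w z \<inter> U z \<noteq> ({} :: 'c set)"
      proof -
        have "(Free = Free \<and> {} = {}) \<or> wtree x Free {} \<or> wfe H X W x Free {}" "fst ` S \<inter> fst ` {} = {}" by auto
        from reroot[OF T wz(1) this] that show ?thesis by (elim exE conjE)
      qed
      have wT': "wtree z T' S'" using T'(1) wfe_imp_wft W_X[OF zW] wft_Free by blast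
      have "Z \<inter> fst ` S' = Z \<inter> fst ` S - {w}"
      proof -
        have "fst ` (S - {(w, z)}) = fst ` S - {w}"
          using inj_on_image_set_diff[OF wft_inj_fst[OF T], of S "{(w, z)}"] wz(1) by simp
        then show ?thesis using T'(2) by auto
      qed
      moreover have "w \<in> Z \<inter> fst ` S" using wz by force
      ultimately have "card (Z \<inter> fst ` S') = c - 1" using finS less.prems(3) by (simp add: card_Diff_singleton)
      then have "card (Z \<inter> fst ` S') < c" using 3 by simp
      from less.IH[OF this wT' W_X[OF zW] refl]
      have "tsat Z T' z \<noteq> {} \<and> (tsat Z T' z = D' z \<or> tsat Z T' z \<subseteq> E z)" by blast
      then have "tsat Z T' z \<inter> E z \<noteq> {}" using E_nonempty[OF zW] E_proper[OF zW] by blast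
      then have "sat R' D' (spots Z) T' z \<inter> spots Z w z \<inter> D' z \<noteq> {}"
        using wz(2) E_proper[OF zW] by (auto simp: tsat_def spots_def)
      then have "sat R' D' (spots Z) T x \<inter> sat R' D' (spots Z) Free x \<noteq> {}" using T'(3) by blast
      then show ?thesis unfolding tsat_def by blast
    qed
    show ?thesis
    proof (cases "\<exists>m\<in>Z \<inter> fst ` S. x \<in> W \<and> tsat (Z - {m}) T x \<subseteq> E x")
      case True
      then obtain m where "x \<in> W" "tsat (Z - {m}) T x \<subseteq> E x" by blast
      then show ?thesis using ne tsat_mono[OF T, of "Z - {m}" Z] by blast
    next
      case False
      have full: "tsat (Z - {m}) T x = D' x" if m: "m \<in> Z \<inter> fst ` S" for m
      proof -
        have "(Z - {m}) \<inter> fst ` S = Z \<inter> fst ` S - {m}" by blast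
        then have "card ((Z - {m}) \<inter> fst ` S) < c" using card_Diff1_less[OF finS m] less.prems(3) by simp
        from less.IH[OF this T less.prems(2) refl] show ?thesis using False m by blast
      qed
      obtain m1 m2 where m: "m1 \<in> Z \<inter> fst ` S" "m2 \<in> Z \<inter> fst ` S" "m1 \<noteq> m2"
        using 3 less.prems(3) finS by (metis card_le_Suc0_iff_eq not_less_eq_eq numeral_2_eq_2)
      have "absorbs (Suc k) x (tsat Z T x)"
        unfolding absorbs_def
      proof (intro conjI)
        show "tsat Z T x \<noteq> {}" by (fact ne)
        show "tol 1 (tsat Z T x) (Q x)" by (rule tsat_tol_Q[OF T])
        show "tol (Suc k) (tsat Z T x) (D' x)"
          unfolding tol_def
        proof (intro conjI allI impI)
          show "tsat Z T x \<subseteq> D' x" by (rule tsat_D')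
          fix v assume v: "(\<forall>i<N. v i \<in> D' x) \<and> card {i. i < N \<and> v i \<notin> tsat Z T x} \<le> Suc k"
          show "F v \<in> tsat Z T x"
          proof (cases "{i. i < N \<and> v i \<notin> tsat Z T x} = {}")
            case True
            show ?thesis
              by (rule tolD[OF tsat_tol_Q[OF T]]) (use True v D'_Q in \<open>auto simp only: card.empty\<close>)
          next
            case False
            then obtain i0 where i0: "i0 < N" "v i0 \<notin> tsat Z T x" by blast
            have "{i. i < N \<and> v i \<notin> tsat Z T x} = insert i0 {i. i < N \<and> i \<noteq> i0 \<and> v i \<notin> tsat Z T x}" using i0 by blast
            then have ck: "card {i. i < N \<and> i \<noteq> i0 \<and> v i \<notin> tsat Z T x} \<le> k" using v by simp
            \<comment> \<open>Each deviating argument may violate one spot: \<open>i0\<close>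
              violates \<open>m2\<close>, the at most \<open>k\<close> others violate
              \<open>m1\<close>. Hence at most \<open>k\<close> arguments leave \<open>E z\<close>
              at \<open>m1\<close>, only \<open>i0\<close> does so at \<open>m2\<close>, which
              \<open>1 \<le> k\<close> allows, and none at any other spot of
              \<open>Z\<close>.\<close>
            define Zi where "Zi i = (if v i \<in> tsat Z T x then Z else if i = i0 then Z - {m2} else Z - {m1})" for i
            show ?thesis
              unfolding tsat_def
            proof (rule sat_apply[OF T, where R = "\<lambda>_. R'" and U = "\<lambda>_. D'" and dec = "\<lambda>i. spots (Zi i)" and N = N and F = F and v = v])
              fix h and t :: "nat \<Rightarrow> nat \<Rightarrow> 'c" assume h: "h \<in> H" and t: "\<And>i. i < N \<Longrightarrow> t i \<in> R' h"
              show "(\<lambda>p. F (\<lambda>i. t i p)) \<in> R' h"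
              proof (rule F_R'[OF h, of t])
                show "t i \<in> R h" if "i < N" for i using t[OF that] R'_subset[OF h] by auto
                show "card {i. i < N \<and> t i \<notin> R' h} \<le> 1" by (rule card_le_1[of _ i0]) (use t in auto)
              qed
            next
              fix x v assume "\<And>i. i < N \<Longrightarrow> v i \<in> D' x"
              then show "F v \<in> D' x" by (rule F_D')
            next
              fix m z u assume mz: "(m, z) \<in> S" and u: "\<And>i. i < N \<Longrightarrow> u i \<in> spots (Zi i) m z \<inter> D' z"
              have uD: "\<And>i. i < N \<Longrightarrow> u i \<in> D' z" using u by blast
              show "F u \<in> spots Z m z"
              proof (cases "m \<in> Z")
                case mZ: True
                have zW: "z \<in> W" using wft_spot_label[OF T mz] .
                have uE: "u i \<in> E z" if "i < N" "m \<in> Zi i" for i using u[OF that(1)] that(2) by (simp add: spots_def)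
                have "card {i. i < N \<and> u i \<notin> E z} \<le> k"
                proof (cases "m = m1")
                  case True
                  have "{i. i < N \<and> u i \<notin> E z} \<subseteq> {i. i < N \<and> i \<noteq> i0 \<and> v i \<notin> tsat Z T x}"
                    using uE mZ True m(3) by (auto simp: Zi_def)
                  from card_mono[OF _ this] ck show ?thesis by simp
                next
                  case False
                  have "m \<in> Zi i" if "i \<noteq> i0" for i using that mZ False by (simp add: Zi_def)
                  then have "{i. i < N \<and> u i \<notin> E z} \<subseteq> {i0}" using uE by blast
                  from card_le_1[OF this] k_pos show ?thesis by simp
                qed
                then have "F u \<in> E z" using tolD[OF E_tol[OF zW], of u] uD by blast
                then show ?thesis using mZ by (simp add: spots_def)
              next
                case False
                then show ?thesis using F_D'[of u z] uD by (simp add: spots_def)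
              qed
            next
              fix i assume i: "i < N"
              have "v i \<in> D' x" using v i by blast
              then have "v i \<in> tsat (Zi i) T x" using full[OF m(1)] full[OF m(2)] by (auto simp: Zi_def)
              then show "v i \<in> sat R' D' (spots (Zi i)) T x" by (simp add: tsat_def)
            qed
          qed
        qed
      qed
      then show ?thesis using k_max ne by blast
    qed
  qed
qed

text \<open>Each set of the arc-consistent closure is the solution set of a single tree, so the
  dichotomy makes it non-empty and \<open>tsat_tol_Q\<close> makes it absorbing.\<close>

lemma smaller_family: "\<exists>D''. absorbing_family D'' \<and> (\<forall>x. D'' x \<subseteq> D' x) \<and> (\<exists>x\<in>X. D'' x \<noteq> D' x)"
proof -
  have fin: "\<And>x. x \<in> X \<Longrightarrow> finite (D' x)" using fin_Q D'_Q finite_subset by blast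
  show ?thesis
  proof (rule closure_family[where R = R' and U = D' and G = X and H = H and Sp = W and E = E, OF fin])
    fix K T S
    assume K: "\<And>x. x \<in> X \<Longrightarrow> wtree x (T x) (S x)"
      "\<And>x. x \<in> X \<Longrightarrow> K x = sat R' D' (\<lambda>m. E) (T x) x"
      "\<And>x T' S'. x \<in> X \<Longrightarrow> wtree x T' S' \<Longrightarrow> K x \<subseteq> sat R' D' (\<lambda>m. E) T' x"
      "\<And>h p a. h \<in> H \<Longrightarrow> p \<in> ports h \<Longrightarrow> plab h p \<in> X \<Longrightarrow> a \<in> K (plab h p) \<Longrightarrow>
         \<exists>t\<in>R' h. t p = a \<and> (\<forall>q\<in>ports h - {p}. (plab h q \<in> X \<longrightarrow> t q \<in> K (plab h q)) \<and>
            (plab h q \<in> W - X \<longrightarrow> t q \<in> E (plab h q)))"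
    have all: "(\<lambda>m. E) = spots UNIV" by (intro ext) (simp add: spots_def)
    have KT: "K x = tsat UNIV (T x) x" if "x \<in> X" for x using K(2)[OF that] unfolding tsat_def all .
    define D'' where "D'' x = (if x \<in> X then K x else {})" for x
    have "absorbing_family D''"
      unfolding absorbing_family_def arc_cons_def
    proof (intro conjI ballI allI)
      fix x assume "x \<in> X"
      then show "D'' x \<noteq> {}" using tsat_dichotomy[OF K(1) _ refl] KT by (simp add: D''_def)
    next
      fix x
      show "tol 1 (D'' x) (Q x)"
      proof (cases "x \<in> X")
        case True
        then show ?thesis using tsat_tol_Q[OF K(1)] KT by (simp add: D''_def)
      next
        case False
        then show ?thesis unfolding tol_def using Q_outside N_pos by (auto simp: D''_def)
      qed
    next
      fix h p a assume h: "h \<in> H" "p \<in> ports h" and a: "a \<in> D'' (plab h p)"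
      have "plab h p \<in> X" using plab_X[OF h] .
      then obtain t where t: "t \<in> R' h" "t p = a" "\<forall>q\<in>ports h - {p}. plab h q \<in> X \<longrightarrow> t q \<in> K (plab h q)"
        using K(4)[OF h] a by (auto simp: D''_def)
      have "t q \<in> D'' (plab h q)" if "q \<in> ports h" for q
        using t a plab_X[OF h(1) that] that by (cases "q = p") (auto simp: D''_def)
      then show "\<exists>t\<in>R' h. t p = a \<and> (\<forall>q\<in>ports h. t q \<in> D'' (plab h q))" using t by blast
    qed
    moreover have "D'' x \<subseteq> D' x" for x using KT tsat_D' by (auto simp: D''_def)
    moreover have "D'' z0 \<noteq> D' z0"
    proof -
      \<comment> \<open>The empty path puts \<open>z0\<close> into \<open>W\<close>, and the tree
        consisting of one spot at \<open>z0\<close> already cuts \<open>K z0\<close> down to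
        \<open>E z0\<close>.\<close>
      obtain z0X: "z0 \<in> X" and nb: "\<not> D' z0 \<subseteq> H0" using H0_image images_sub by (auto simp: images_def)
      have "z0 \<in> W" using shadow_eq(1)[of "[]" z0] nb by (simp add: img_def)
      then have "K z0 \<subseteq> E z0" using K(3)[OF z0X wft_Spot[of z0 W H X 0]] by auto
      then show ?thesis using E_proper[OF \<open>z0 \<in> W\<close>] z0X by (auto simp: D''_def)
    qed
    moreover have "z0 \<in> X" using H0_image images_sub by auto
    ultimately show ?thesis by blast
  qed
qed

end

section \<open>Solutions from minimal families\<close>

context nu_instance
begin

text \<open>An arc-consistent family of singletons is a solution, and a family of least total size
  must be one. Hyperedges without ports are excepted, since arc consistency yields a tuple only by
  extending the value at some port.\<close>

theorem pq_solution:
  assumes "absorbing_family D0"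
    and pq: "\<And>x P P' a. chain x P x \<Longrightarrow> chain x P' x \<Longrightarrow> P \<noteq> [] \<Longrightarrow> P' \<noteq> [] \<Longrightarrow> a \<in> Q x \<Longrightarrow>
      \<exists>j. (a, a) \<in> prel R (concat (replicate j (P @ P')) @ P)"
  shows "\<exists>s. (\<forall>x\<in>X. s x \<in> Q x) \<and> (\<forall>h\<in>H. ports h \<noteq> {} \<longrightarrow> (\<exists>t\<in>R' h. \<forall>p\<in>ports h. t p = s (plab h p)))"
proof -
  obtain D' where D': "absorbing_family D'"
    and min: "\<And>D''. absorbing_family D'' \<Longrightarrow> (\<Sum>x\<in>X. card (D' x)) \<le> (\<Sum>x\<in>X. card (D'' x))"
    using ex_has_least_nat[of absorbing_family D0 "\<lambda>D'. \<Sum>x\<in>X. card (D' x)"] assms(1) by blast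
  interpret S: nu_subinstance ports plab N F H X Q R R' D'
    by unfold_locales (use D' pq in auto)
  have small: "card (D' x) < 2" if x: "x \<in> X" for x
  proof (rule ccontr)
    assume "\<not> card (D' x) < 2"
    then have "2 \<le> card (D' x)" by simp
    from S.maximal_absorbing[OF x this] obtain k x1 A0
      where k: "1 \<le> k" "x1 \<in> X" "S.absorbs k x1 A0" "A0 \<noteq> D' x1" "\<And>y B. S.absorbs (Suc k) y B \<Longrightarrow> B = D' y" by metis
    interpret M: nu_maximal ports plab N F H X Q R R' D' k x1 A0
      by unfold_locales (use k in auto)
    obtain H0 z0 where H0: "(H0, z0) \<in> M.images"
      "\<And>P z. chain z0 P z \<Longrightarrow> \<not> D' z \<subseteq> M.img P H0 \<Longrightarrow> \<exists>P'. chain z P' z0 \<and> M.img P' (M.img P H0) = H0"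
      by (rule M.terminal_image) blast
    interpret L: nu_shadow ports plab N F H X Q R R' D' k x1 A0 H0 z0
      by unfold_locales (use H0 in auto)
    obtain D'' y where D'': "absorbing_family D''" "\<And>x. D'' x \<subseteq> D' x" "y \<in> X" "D'' y \<noteq> D' y"
      using L.smaller_family by blast
    have fin: "finite (D' x)" for x using fin_Q S.D'_Q finite_subset by blast
    have "(\<Sum>x\<in>X. card (D'' x)) < (\<Sum>x\<in>X. card (D' x))"
    proof (rule sum_strict_mono_ex1[OF fin_X])
      show "\<forall>x\<in>X. card (D'' x) \<le> card (D' x)" using card_mono[OF fin D''(2)] by blast
      show "\<exists>x\<in>X. card (D'' x) < card (D' x)"
        using psubset_card_mono[OF fin, of "D'' y" y] D''(2)[of y] D''(3,4) by blast
    qed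
    then show False using min[OF D''(1)] by simp
  qed
  have "\<exists>a. D' x = {a}" if x: "x \<in> X" for x
  proof -
    have "finite (D' x)" using fin_Q S.D'_Q finite_subset by blast
    then have "card (D' x) = 1" using small[OF x] S.D'_nonempty[OF x] card_gt_0_iff[of "D' x"] by linarith
    then show ?thesis by (simp add: card_1_singleton_iff)
  qed
  then obtain s where s: "\<And>x. x \<in> X \<Longrightarrow> D' x = {s x}" by metis
  show ?thesis
  proof (intro exI[of _ s] conjI ballI impI)
    show "s x \<in> Q x" if "x \<in> X" for x using s[OF that] S.D'_Q[of x] by blast
    fix h assume h: "h \<in> H" "ports h \<noteq> {}"
    then obtain p where p: "p \<in> ports h" by blast
    then have "s (plab h p) \<in> D' (plab h p)" using s plab_X[OF h(1)] by blast
    from S.D'_ac[OF h(1) p this] obtain t where "t \<in> R' h" "\<forall>q\<in>ports h. t q \<in> D' (plab h q)" by blast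
    then show "\<exists>t\<in>R' h. \<forall>p\<in>ports h. t p = s (plab h p)" using s plab_X[OF h(1)] by (intro bexI[of _ t]) auto
  qed
qed

end

section \<open>Trees as patterns\<close>

text \<open>Every non-root vertex \<open>b\<close> also names the arc to its parent, so
  \<open>B\<close> is the set of arcs. \<open>prt b\<close> tells where the parent sits:
  \<open>0\<close> for the tail, any other number for the head.\<close>

definition pgraph :: "nat \<Rightarrow> nat set \<Rightarrow> (nat \<Rightarrow> nat) \<Rightarrow> (nat \<Rightarrow> nat) \<Rightarrow> (nat, nat) pre_digraph" where
  "pgraph rt B par prt = \<lparr> verts = insert rt B, arcs = B,
     tail = (\<lambda>b. if prt b = 0 then par b else b), head = (\<lambda>b. if prt b = 0 then b else par b) \<rparr>"

text \<open>A rank that falls towards the root excludes cycles of parents and makes every vertex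
  lead to \<open>rt\<close>.\<close>

locale parent_tree =
  fixes rt :: nat and B :: "nat set" and par rk :: "nat \<Rightarrow> nat"
  assumes fin_B: "finite B" and root_B: "rt \<notin> B"
    and par_in: "b \<in> B \<Longrightarrow> par b \<in> insert rt B" and rk_par: "b \<in> B \<Longrightarrow> rk (par b) < rk b"
begin

lemma par_neq: "b \<in> B \<Longrightarrow> par b \<noteq> b"
  using rk_par[of b] by auto

lemma adjacent:
  "(u, v) \<in> arcs_ends (with_proj (mk_symmetric (pgraph rt B par prt))) \<longleftrightarrow>
    (v \<in> B \<and> u = par v) \<or> (u \<in> B \<and> v = par u)"
  by (auto simp: parcs_mk_symmetric pgraph_def split: if_splits)

lemma wf: "wf_digraph (pgraph rt B par prt)"
  by unfold_locales (use par_in in \<open>auto simp: pgraph_def\<close>)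

lemma fin: "fin_digraph (pgraph rt B par prt)"
  by (intro fin_digraph.intro fin_digraph_axioms.intro wf) (use fin_B in \<open>auto simp: pgraph_def\<close>)

lemma loopfree: "loopfree_digraph (pgraph rt B par prt)"
  by (intro loopfree_digraph.intro loopfree_digraph_axioms.intro wf) (use par_neq in \<open>fastforce simp: pgraph_def split: if_splits\<close>)

lemma vwalk_arcs_conv: "set (vwalk_arcs c) = {(c ! j, c ! Suc j) |j. Suc j < length c}"
proof (induction c rule: vwalk_arcs.induct)
  case (3 x y c)
  have "{((x # y # c) ! j, (x # y # c) ! Suc j) |j. Suc j < length (x # y # c)} =
      insert (x, y) {((y # c) ! j, (y # c) ! Suc j) |j. Suc j < length (y # c)}" (is "?L = ?R")
  proof (rule set_eqI)
    fix e
    show "e \<in> ?L \<longleftrightarrow> e \<in> ?R"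
    proof
      assume "e \<in> ?L"
      then obtain j where j: "e = ((x # y # c) ! j, (x # y # c) ! Suc j)" "Suc j < length (x # y # c)" by blast
      then show "e \<in> ?R" by (cases j) auto
    next
      assume "e \<in> ?R"
      then consider "e = (x, y)" | j where "e = ((y # c) ! j, (y # c) ! Suc j)" "Suc j < length (y # c)" by blast
      then show "e \<in> ?L"
      proof cases
        case 1
        then show ?thesis by (intro CollectI exI[of _ 0]) auto
      next
        case 2
        then show ?thesis by (intro CollectI exI[of _ "Suc j"]) auto
      qed
    qed
  qed
  then show ?case using 3 by simp
qed auto

text \<open>Both neighbours of a vertex of maximal rank on a cycle would have to be its parent.\<close>

lemma no_cycle: "\<not> undirected_cycle (pgraph rt B par prt) c"
proof
  let ?adj = "\<lambda>u v. (v \<in> B \<and> u = par v) \<or> (u \<in> B \<and> v = par u)"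
  let ?n = "length c"
  assume c: "undirected_cycle (pgraph rt B par prt) c"
  have len: "3 \<le> ?n" and dist: "distinct c" using c unfolding undirected_cycle_def vpath_def by auto
  have sub: "set (vwalk_arcs c) \<subseteq> arcs_ends (with_proj (mk_symmetric (pgraph rt B par prt)))"
    and close: "(last c, hd c) \<in> arcs_ends (with_proj (mk_symmetric (pgraph rt B par prt)))"
    using c unfolding undirected_cycle_def vpath_def vwalk_def by auto
  have adj: "?adj (c ! j) (c ! (Suc j mod ?n))" if j: "j < ?n" for j
  proof (cases "Suc j = ?n")
    case True
    have "c \<noteq> []" using len by auto
    then have "c ! j = last c" "c ! (Suc j mod ?n) = hd c"
      using True by (simp_all add: last_conv_nth hd_conv_nth flip: True)
    then show ?thesis using close unfolding adjacent by simp
  next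
    case False
    then have "Suc j < ?n" using j by simp
    then have "(c ! j, c ! Suc j) \<in> set (vwalk_arcs c)" unfolding vwalk_arcs_conv by blast
    then show ?thesis using sub adjacent \<open>Suc j < ?n\<close> by (auto simp: subset_iff)
  qed
  have fin: "finite (rk ` set c)" "rk ` set c \<noteq> {}" using len by auto
  obtain v where v: "v \<in> set c" "rk v = Max (rk ` set c)" using Max_in[OF fin] by auto
  obtain i where i: "i < ?n" "c ! i = v" using v(1) by (auto simp: in_set_conv_nth)
  have max: "rk u \<le> rk v" if "u \<in> set c" for u using that v(2) fin by simp
  define i1 where "i1 = (if i = 0 then ?n - 1 else i - 1)"
  define i2 where "i2 = Suc i mod ?n"
  have i1: "i1 < ?n" "Suc i1 mod ?n = i" using i len unfolding i1_def by auto
  have i2: "i2 < ?n" using len unfolding i2_def by (intro mod_less_divisor) auto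
  have ne: "i1 \<noteq> i2"
  proof
    assume e: "i1 = i2"
    show False
    proof (cases "Suc i = ?n")
      case True
      then have "i2 = 0" "i1 = i - 1" "i \<ge> 2" using len unfolding i1_def i2_def by auto
      then show False using e by simp
    next
      case False
      then have "i2 = Suc i" using i(1) unfolding i2_def by simp
      then show False using e i(1) len unfolding i1_def by (auto split: if_splits)
    qed
  qed
  have par: "u = par v" if "u \<in> set c" "?adj u v \<or> ?adj v u" for u
    using that max[OF that(1)] rk_par[of u] by auto
  have "c ! i1 = par v" using adj[OF i1(1)] i1 i(2) by (intro par) auto
  moreover have "c ! i2 = par v" using adj[OF i(1)] i(2) i2 unfolding i2_def[symmetric] by (intro par) auto
  ultimately show False using dist ne i1(1) i2 nth_eq_iff_index_eq[of c i1 i2] by simp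
qed

lemma connected: "connected (pgraph rt B par prt)"
proof -
  let ?S = "mk_symmetric (pgraph rt B par prt)"
  interpret G: wf_digraph "pgraph rt B par prt" by (rule wf)
  interpret S: pair_wf_digraph ?S by (rule G.wellformed_mk_symmetric)
  have wfS: "wf_digraph (with_proj ?S)" by unfold_locales
  have sym: "symmetric (with_proj ?S)" by (rule symmetric_mk_symmetric)
  have to_root: "u \<rightarrow>\<^sup>*\<^bsub>with_proj ?S\<^esub> rt" if "u \<in> insert rt B" for u
    using that
  proof (induction "rk u" arbitrary: u rule: less_induct)
    case less
    show ?case
    proof (cases "u = rt")
      case True
      moreover have "rt \<in> verts (with_proj ?S)" by (simp add: pgraph_def)
      ultimately show ?thesis using S.reachable_refl by simp
    next
      case False
      then have u: "u \<in> B" using less.prems by simp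
      have "u \<rightarrow>\<^bsub>with_proj ?S\<^esub> par u" using adjacent u by blast
      moreover have "par u \<rightarrow>\<^sup>*\<^bsub>with_proj ?S\<^esub> rt" by (rule less.hyps) (use rk_par[OF u] par_in[OF u] in auto)
      ultimately show ?thesis by (rule wf_digraph.adj_reachable_trans[OF wfS])
    qed
  qed
  show ?thesis unfolding connected_def strongly_connected_def
  proof (intro conjI ballI)
    fix u v assume u: "u \<in> verts (with_proj ?S)" and v: "v \<in> verts (with_proj ?S)"
    have verts: "verts (with_proj ?S) = insert rt B" by (simp add: pgraph_def)
    show "u \<rightarrow>\<^sup>*\<^bsub>with_proj ?S\<^esub> v"
      by (rule wf_digraph.reachable_trans[OF wfS to_root symmetric_reachable[OF sym to_root]])
        (use u v verts in simp_all)
  qed (simp add: pgraph_def)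
qed

lemma oriented_tree: "oriented_tree (pgraph rt B par prt)"
  unfolding oriented_tree_def
proof (intro conjI loopfree connected)
  show "inj_on (\<lambda>e. {tail (pgraph rt B par prt) e, head (pgraph rt B par prt) e}) (arcs (pgraph rt B par prt))"
  proof (rule inj_onI)
    fix b b' assume "b \<in> arcs (pgraph rt B par prt)" "b' \<in> arcs (pgraph rt B par prt)"
      and e: "{tail (pgraph rt B par prt) b, head (pgraph rt B par prt) b} =
        {tail (pgraph rt B par prt) b', head (pgraph rt B par prt) b'}"
    then have b: "b \<in> B" "b' \<in> B" by (auto simp: pgraph_def)
    have "{tail (pgraph rt B par prt) b, head (pgraph rt B par prt) b} = {par b, b}" for b
      by (auto simp: pgraph_def)
    then have "{par b, b} = {par b', b'}" using e by simp
    then show "b = b'" using rk_par[OF b(1)] rk_par[OF b(2)] by (auto simp: doubleton_eq_iff)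
  qed
  show "\<nexists>c. undirected_cycle (pgraph rt B par prt) c" using no_cycle by blast
qed

lemma degree:
  "in_degree (pgraph rt B par prt) v + out_degree (pgraph rt B par prt) v =
    card {b \<in> B. par b = v} + (if v \<in> B then 1 else 0)"
proof -
  let ?G = "pgraph rt B par prt"
  have fins: "finite (in_arcs ?G v)" "finite (out_arcs ?G v)"
    using fin_B by (auto simp: in_arcs_def out_arcs_def pgraph_def)
  have "in_arcs ?G v \<inter> out_arcs ?G v = {}"
    using par_neq by (fastforce simp: in_arcs_def out_arcs_def pgraph_def split: if_splits)
  then have "in_degree ?G v + out_degree ?G v = card (in_arcs ?G v \<union> out_arcs ?G v)"
    using fins by (simp add: in_degree_def out_degree_def card_Un_disjoint)
  also have "in_arcs ?G v \<union> out_arcs ?G v = {b \<in> B. par b = v} \<union> (if v \<in> B then {v} else {})"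
    by (auto simp: in_arcs_def out_arcs_def pgraph_def split: if_splits)
  also have "card \<dots> = card {b \<in> B. par b = v} + (if v \<in> B then 1 else 0)"
    using par_neq fin_B by (subst card_Un_disjoint) auto
  finally show ?thesis .
qed

lemma leaves_subset: "leaves (pgraph rt B par prt) \<subseteq> insert rt {b \<in> B. b \<notin> par ` B}"
proof
  fix v assume "v \<in> leaves (pgraph rt B par prt)"
  then have v: "v \<in> insert rt B" "card {b \<in> B. par b = v} + (if v \<in> B then 1 else 0) = 1"
    unfolding leaves_def degree by (auto simp: pgraph_def)
  then show "v \<in> insert rt {b \<in> B. b \<notin> par ` B}" using fin_B by (auto split: if_splits)
qed

lemma leafI: "b \<in> B \<Longrightarrow> b \<notin> par ` B \<Longrightarrow> b \<in> leaves (pgraph rt B par prt)"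
  unfolding leaves_def degree by (auto simp: pgraph_def image_iff card_eq_0_iff)

lemma root_leafI: "card {b \<in> B. par b = rt} = 1 \<Longrightarrow> rt \<in> leaves (pgraph rt B par prt)"
  unfolding leaves_def degree using root_B by (auto simp: pgraph_def)

end

section \<open>Binary constraints as hyperedges, and their trees as graphs\<close>

definition clab :: "('x, 'd) bin_constraint \<Rightarrow> nat \<Rightarrow> 'x" where
  "clab c i = (if i = 0 then fst (fst c) else snd (fst c))"

definition crel :: "('x, 'd) bin_constraint \<Rightarrow> (nat \<Rightarrow> 'd) set" where
  "crel c = {t. (t 0, t 1) \<in> snd c}"

definition cports :: "('x, 'd) bin_constraint \<Rightarrow> nat set" where
  "cports c = {0, 1}"

interpretation plain: hyperedges cports clab .

lemma cports_minus: "p \<in> cports c \<Longrightarrow> cports c - {p} = {1 - p}"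
  unfolding cports_def by auto

text \<open>\<open>br\<close> counts the leaves strictly below the root; a root without edges contributes none.\<close>

primrec br :: "'h gtree \<Rightarrow> nat" where
  "br Free = 0"
| "br (Spot m) = 0"
| "br (Meet A B) = br A + br B"
| "br (Edge h p ts) = max 1 (br (ts (1 - p)))"

primrec dg :: "'h gtree \<Rightarrow> nat" where
  "dg Free = 0"
| "dg (Spot m) = 0"
| "dg (Meet A B) = dg A + dg B"
| "dg (Edge h p ts) = 1"

primrec root_free :: "'h gtree \<Rightarrow> bool" where
  "root_free Free \<longleftrightarrow> True"
| "root_free (Spot m) \<longleftrightarrow> False"
| "root_free (Meet A B) \<longleftrightarrow> root_free A \<and> root_free B"
| "root_free (Edge h p ts) \<longleftrightarrow> True"

text \<open>A spot glued to another branch could become an inner vertex, so \<open>Meet\<close>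
  excludes spots at its root. Patterns have to begin and end at leaves.\<close>

primrec leaf_spots :: "'h gtree \<Rightarrow> bool" where
  "leaf_spots Free \<longleftrightarrow> True"
| "leaf_spots (Spot m) \<longleftrightarrow> True"
| "leaf_spots (Meet A B) \<longleftrightarrow> root_free A \<and> root_free B \<and> leaf_spots A \<and> leaf_spots B"
| "leaf_spots (Edge h p ts) \<longleftrightarrow> leaf_spots (ts (1 - p))"

definition obeys :: "nat \<Rightarrow> nat set \<Rightarrow> (nat \<Rightarrow> nat) \<Rightarrow> (nat \<Rightarrow> nat) \<Rightarrow> (nat \<Rightarrow> ('x, 'd) bin_constraint) \<Rightarrow>
    (nat \<Rightarrow> 'x) \<Rightarrow> ('x \<Rightarrow> 'd set) \<Rightarrow> (nat \<Rightarrow> 'd) \<Rightarrow> bool" where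
  "obeys rt B par prt con lab U r \<longleftrightarrow> (\<forall>v\<in>insert rt B. r v \<in> U (lab v)) \<and>
     (\<forall>b\<in>B. (if prt b = 0 then (r (par b), r b) else (r b, r (par b))) \<in> snd (con b))"

lemma obeys_cong:
  assumes "\<And>v. v \<in> insert rt B \<Longrightarrow> r v = r' v" "\<And>b. b \<in> B \<Longrightarrow> par b \<in> insert rt B"
  shows "obeys rt B par prt con lab U r \<longleftrightarrow> obeys rt B par prt con lab U r'"
  unfolding obeys_def using assms by auto

text \<open>Links a recursive tree to a flat graph with non-root vertices \<open>B\<close>;
  \<open>nd\<close> places the spots. The bound on the leaves and the degree of the root are carried
  along because they decide whether the graph is an \<open>n\<close>-tree pattern. The last conjunct
  identifies \<open>sat\<close> with realizations.\<close>

definition tree_structure :: "('x, 'd) bin_constraint set \<Rightarrow> nat \<Rightarrow> 'x \<Rightarrow> ('x, 'd) bin_constraint gtree \<Rightarrow> (nat \<times> 'x) set \<Rightarrow>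
    nat set \<Rightarrow> (nat \<Rightarrow> nat) \<Rightarrow> (nat \<Rightarrow> nat) \<Rightarrow> (nat \<Rightarrow> nat) \<Rightarrow> (nat \<Rightarrow> ('x, 'd) bin_constraint) \<Rightarrow>
    (nat \<Rightarrow> 'x) \<Rightarrow> (nat \<Rightarrow> nat) \<Rightarrow> bool" where
  "tree_structure C rt x T S B par rk prt con lab nd \<longleftrightarrow> parent_tree rt B par rk \<and> rk rt = 0 \<and>
     lab rt = x \<and>
     (\<forall>b\<in>B. con b \<in> C \<and> prt b \<in> {0, 1} \<and> clab (con b) (prt b) = lab (par b) \<and> clab (con b) (1 - prt b) = lab b) \<and>
     (\<forall>(m, z)\<in>S. nd m \<in> insert rt B \<and> lab (nd m) = z \<and>
        (leaf_spots T \<longrightarrow> nd m \<notin> par ` B \<and> (root_free T \<longrightarrow> nd m \<in> B))) \<and>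
     card {b \<in> B. b \<notin> par ` B} \<le> br T \<and> card {b \<in> B. par b = rt} = dg T \<and>
     (\<forall>U dec a. a \<in> plain.sat crel U dec T x \<longleftrightarrow>
        (\<exists>r. r rt = a \<and> obeys rt B par prt con lab U r \<and> (\<forall>(m, z)\<in>S. r (nd m) \<in> dec m z)))"


lemma obeys_union:
  assumes B1: "\<And>b. b \<in> B1 \<Longrightarrow> par1 b \<in> insert rt B1" and B2: "\<And>b. b \<in> B2 \<Longrightarrow> par2 b \<in> insert rt B2"
    and disj: "B1 \<inter> B2 = {}" "rt \<notin> B1" "rt \<notin> B2" and lab: "lab1 rt = lab2 rt"
  shows "obeys rt (B1 \<union> B2) (\<lambda>b. if b \<in> B1 then par1 b else par2 b) (\<lambda>b. if b \<in> B1 then prt1 b else prt2 b)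
      (\<lambda>b. if b \<in> B1 then con1 b else con2 b) (\<lambda>b. if b \<in> B1 then lab1 b else lab2 b) U r \<longleftrightarrow>
    obeys rt B1 par1 prt1 con1 lab1 U r \<and> obeys rt B2 par2 prt2 con2 lab2 U r" (is "?L \<longleftrightarrow> ?R1 \<and> ?R2")
proof
  assume L: ?L
  have notB1: "b \<notin> B1" if "b \<in> B2" for b using that disj by blast
  show "?R1 \<and> ?R2"
    unfolding obeys_def
  proof (intro conjI ballI)
    fix v assume "v \<in> insert rt B1"
    then show "r v \<in> U (lab1 v)" using L disj lab unfolding obeys_def by (cases "v = rt") force+
  next
    fix b assume "b \<in> B1"
    then show "(if prt1 b = 0 then (r (par1 b), r b) else (r b, r (par1 b))) \<in> snd (con1 b)"
      using L unfolding obeys_def by force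
  next
    fix v assume v: "v \<in> insert rt B2"
    then have "v \<notin> B1" using notB1 disj by blast
    then show "r v \<in> U (lab2 v)" using L v unfolding obeys_def by force
  next
    fix b assume b: "b \<in> B2"
    from notB1[OF b] show "(if prt2 b = 0 then (r (par2 b), r b) else (r b, r (par2 b))) \<in> snd (con2 b)"
      using L b unfolding obeys_def by force
  qed
next
  assume R: "?R1 \<and> ?R2"
  show ?L
    unfolding obeys_def
  proof (intro conjI ballI)
    fix v assume "v \<in> insert rt (B1 \<union> B2)"
    then show "r v \<in> U (if v \<in> B1 then lab1 v else lab2 v)" using R unfolding obeys_def by auto
  next
    fix b assume "b \<in> B1 \<union> B2"
    then show "(if (if b \<in> B1 then prt1 b else prt2 b) = 0 then (r (if b \<in> B1 then par1 b else par2 b), r b)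
          else (r b, r (if b \<in> B1 then par1 b else par2 b))) \<in> snd (if b \<in> B1 then con1 b else con2 b)"
      using R unfolding obeys_def by auto
  qed
qed

lemma tree_structure_Meet:
  assumes 1: "tree_structure C rt x T1 S1 B1 par1 rk1 prt1 con1 lab1 nd1"
    and 2: "tree_structure C rt x T2 S2 B2 par2 rk2 prt2 con2 lab2 nd2"
    and disj: "B1 \<inter> B2 = {}" and S: "fst ` S1 \<inter> fst ` S2 = {}"
  shows "tree_structure C rt x (Meet T1 T2) (S1 \<union> S2) (B1 \<union> B2) (\<lambda>b. if b \<in> B1 then par1 b else par2 b)
    (\<lambda>b. if b \<in> B1 then rk1 b else rk2 b) (\<lambda>b. if b \<in> B1 then prt1 b else prt2 b)
    (\<lambda>b. if b \<in> B1 then con1 b else con2 b) (\<lambda>b. if b \<in> B1 then lab1 b else lab2 b)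
    (\<lambda>m. if m \<in> fst ` S1 then nd1 m else nd2 m)"
    (is "tree_structure _ _ _ _ _ _ ?par ?rk ?prt ?con ?lab ?nd")
proof -
  have f1: "parent_tree rt B1 par1 rk1" "rk1 rt = 0" "lab1 rt = x"
     "\<forall>b\<in>B1. con1 b \<in> C \<and> prt1 b \<in> {0, 1} \<and> clab (con1 b) (prt1 b) = lab1 (par1 b) \<and> clab (con1 b) (1 - prt1 b) = lab1 b"
     "\<forall>(m, z)\<in>S1. nd1 m \<in> insert rt B1 \<and> lab1 (nd1 m) = z \<and>
        (leaf_spots T1 \<longrightarrow> nd1 m \<notin> par1 ` B1 \<and> (root_free T1 \<longrightarrow> nd1 m \<in> B1))"
     "card {b \<in> B1. b \<notin> par1 ` B1} \<le> br T1" "card {b \<in> B1. par1 b = rt} = dg T1"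
     "\<forall>U dec a. a \<in> plain.sat crel U dec T1 x \<longleftrightarrow>
        (\<exists>r. r rt = a \<and> obeys rt B1 par1 prt1 con1 lab1 U r \<and> (\<forall>(m, z)\<in>S1. r (nd1 m) \<in> dec m z))"
    by (insert 1[unfolded tree_structure_def], (elim conjE, assumption)+)
  have f2: "parent_tree rt B2 par2 rk2" "rk2 rt = 0" "lab2 rt = x"
     "\<forall>b\<in>B2. con2 b \<in> C \<and> prt2 b \<in> {0, 1} \<and> clab (con2 b) (prt2 b) = lab2 (par2 b) \<and> clab (con2 b) (1 - prt2 b) = lab2 b"
     "\<forall>(m, z)\<in>S2. nd2 m \<in> insert rt B2 \<and> lab2 (nd2 m) = z \<and>
        (leaf_spots T2 \<longrightarrow> nd2 m \<notin> par2 ` B2 \<and> (root_free T2 \<longrightarrow> nd2 m \<in> B2))"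
     "card {b \<in> B2. b \<notin> par2 ` B2} \<le> br T2" "card {b \<in> B2. par2 b = rt} = dg T2"
     "\<forall>U dec a. a \<in> plain.sat crel U dec T2 x \<longleftrightarrow>
        (\<exists>r. r rt = a \<and> obeys rt B2 par2 prt2 con2 lab2 U r \<and> (\<forall>(m, z)\<in>S2. r (nd2 m) \<in> dec m z))"
    by (insert 2[unfolded tree_structure_def], (elim conjE, assumption)+)
  interpret p1: parent_tree rt B1 par1 rk1 by (rule f1(1))
  interpret p2: parent_tree rt B2 par2 rk2 by (rule f2(1))
  note rk = f1(2) f2(2) and lab = f1(3) f2(3)
  have s1: "nd1 m \<in> insert rt B1" "lab1 (nd1 m) = z"
     "leaf_spots T1 \<Longrightarrow> nd1 m \<notin> par1 ` B1" "leaf_spots T1 \<Longrightarrow> root_free T1 \<Longrightarrow> nd1 m \<in> B1" if "(m, z) \<in> S1" for m z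
    using bspec[OF f1(5) that, unfolded prod.case] by (elim conjE, simp)+
  note lv1 = f1(6,7) and sem1 = f1(8)[rule_format] and c1 = f1(4)[rule_format]
  have s2: "nd2 m \<in> insert rt B2" "lab2 (nd2 m) = z"
     "leaf_spots T2 \<Longrightarrow> nd2 m \<notin> par2 ` B2" "leaf_spots T2 \<Longrightarrow> root_free T2 \<Longrightarrow> nd2 m \<in> B2" if "(m, z) \<in> S2" for m z
    using bspec[OF f2(5) that, unfolded prod.case] by (elim conjE, simp)+
  note lv2 = f2(6,7) and sem2 = f2(8)[rule_format] and c2 = f2(4)[rule_format]
  have nB1: "b \<notin> B1" if "b \<in> B2" for b using that disj by blast
  have lab2': "?lab v = lab2 v" if "v \<in> insert rt B2" for v using that nB1 p1.root_B by auto
  have lab1': "?lab v = lab1 v" if "v \<in> insert rt B1" for v using that lab by auto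
  have nd1': "?nd m = nd1 m" if "(m, z) \<in> S1" for m z using that by force
  have nd2': "?nd m = nd2 m" if "(m, z) \<in> S2" for m z using that S by force
  have parB: "?par ` (B1 \<union> B2) = par1 ` B1 \<union> par2 ` B2" using nB1 by auto
  have im1: "par1 ` B1 \<subseteq> insert rt B1" and im2: "par2 ` B2 \<subseteq> insert rt B2" using p1.par_in p2.par_in by auto
  show ?thesis
    unfolding tree_structure_def
  proof (intro conjI allI)
    show "parent_tree rt (B1 \<union> B2) ?par ?rk"
    proof
      fix b assume b: "b \<in> B1 \<union> B2"
      show "?par b \<in> insert rt (B1 \<union> B2)" using b p1.par_in[of b] p2.par_in[of b] by auto
      show "?rk (?par b) < ?rk b"
      proof (cases "b \<in> B1")
        case True
        then show ?thesis using p1.rk_par[OF True] p1.par_in[OF True] rk by (auto split: if_splits)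
      next
        case False
        then have b2: "b \<in> B2" using b by blast
        then have "par2 b \<notin> B1" using p2.par_in[OF b2] nB1 p1.root_B by auto
        then show ?thesis using False p2.rk_par[OF b2] by simp
      qed
    qed (use p1.fin_B p2.fin_B p1.root_B p2.root_B in auto)
    show "?rk rt = 0" "?lab rt = x" using rk lab by auto
    show "\<forall>b\<in>B1 \<union> B2. ?con b \<in> C \<and> ?prt b \<in> {0, 1} \<and> clab (?con b) (?prt b) = ?lab (?par b) \<and> clab (?con b) (1 - ?prt b) = ?lab b"
    proof
      fix b assume b: "b \<in> B1 \<union> B2"
      show "?con b \<in> C \<and> ?prt b \<in> {0, 1} \<and> clab (?con b) (?prt b) = ?lab (?par b) \<and> clab (?con b) (1 - ?prt b) = ?lab b"
      proof (cases "b \<in> B1")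
        case True
        have "?par b = par1 b" using True by simp
        then have l: "?lab (?par b) = lab1 (par1 b)" using lab1'[OF p1.par_in[OF True]] by (rule ssubst)
        show ?thesis unfolding l using c1[OF True] True by simp
      next
        case False
        then have b2: "b \<in> B2" using b by blast
        have "?par b = par2 b" using False by simp
        then have l: "?lab (?par b) = lab2 (par2 b)" using lab2'[OF p2.par_in[OF b2]] by (rule ssubst)
        show ?thesis unfolding l using c2[OF b2] False by simp
      qed
    qed
    show "\<forall>(m, z)\<in>S1 \<union> S2. ?nd m \<in> insert rt (B1 \<union> B2) \<and> ?lab (?nd m) = z \<and>
        (leaf_spots (Meet T1 T2) \<longrightarrow> ?nd m \<notin> ?par ` (B1 \<union> B2) \<and> (root_free (Meet T1 T2) \<longrightarrow> ?nd m \<in> B1 \<union> B2))"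
    proof (intro ballI, split prod.split, intro allI impI)
      fix mz m z assume mz: "mz \<in> S1 \<union> S2" "mz = (m, z)"
      show "?nd m \<in> insert rt (B1 \<union> B2) \<and> ?lab (?nd m) = z \<and>
        (leaf_spots (Meet T1 T2) \<longrightarrow> ?nd m \<notin> ?par ` (B1 \<union> B2) \<and> (root_free (Meet T1 T2) \<longrightarrow> ?nd m \<in> B1 \<union> B2))"
      proof (cases "(m, z) \<in> S1")
        case True
        have nd: "?nd m = nd1 m" by (rule nd1'[OF True])
        have "nd1 m \<notin> par2 ` B2" if "nd1 m \<in> B1" using that im2 nB1 p1.root_B by blast
        then show ?thesis unfolding nd parB using s1[OF True] lab1'[OF s1(1)[OF True]] by auto
      next
        case False
        then have T: "(m, z) \<in> S2" using mz by blast
        have nd: "?nd m = nd2 m" by (rule nd2'[OF T])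
        have "nd2 m \<notin> par1 ` B1" if "nd2 m \<in> B2" using that im1 nB1 p2.root_B by blast
        then show ?thesis unfolding nd parB using s2[OF T] lab2'[OF s2(1)[OF T]] by auto
      qed
    qed
    have "{b \<in> B1 \<union> B2. b \<notin> ?par ` (B1 \<union> B2)} \<subseteq> {b \<in> B1. b \<notin> par1 ` B1} \<union> {b \<in> B2. b \<notin> par2 ` B2}"
      unfolding parB by blast
    then have "card {b \<in> B1 \<union> B2. b \<notin> ?par ` (B1 \<union> B2)} \<le> card ({b \<in> B1. b \<notin> par1 ` B1} \<union> {b \<in> B2. b \<notin> par2 ` B2})"
      using p1.fin_B p2.fin_B by (intro card_mono) auto
    also have "\<dots> \<le> br T1 + br T2" using card_Un_le lv1(1) lv2(1) by (meson add_mono order_trans)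
    finally show "card {b \<in> B1 \<union> B2. b \<notin> ?par ` (B1 \<union> B2)} \<le> br (Meet T1 T2)" by simp
    have "{b \<in> B1 \<union> B2. ?par b = rt} = {b \<in> B1. par1 b = rt} \<union> {b \<in> B2. par2 b = rt}" using nB1 by auto
    moreover have "card ({b \<in> B1. par1 b = rt} \<union> {b \<in> B2. par2 b = rt}) = dg T1 + dg T2"
      using p1.fin_B p2.fin_B disj by (subst card_Un_disjoint) (auto simp: lv1 lv2)
    ultimately show "card {b \<in> B1 \<union> B2. ?par b = rt} = dg (Meet T1 T2)" by simp
  next
    fix U :: "'a \<Rightarrow> 'b set" and dec :: "nat \<Rightarrow> 'a \<Rightarrow> 'b set" and a
    have ob: "obeys rt (B1 \<union> B2) ?par ?prt ?con ?lab U r \<longleftrightarrow>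
      obeys rt B1 par1 prt1 con1 lab1 U r \<and> obeys rt B2 par2 prt2 con2 lab2 U r" for r
      by (rule obeys_union) (use p1.par_in p2.par_in disj p1.root_B p2.root_B lab in auto)
    have sp: "(\<forall>(m, z)\<in>S1 \<union> S2. r (?nd m) \<in> dec m z) \<longleftrightarrow>
       (\<forall>(m, z)\<in>S1. r (nd1 m) \<in> dec m z) \<and> (\<forall>(m, z)\<in>S2. r (nd2 m) \<in> dec m z)" for r
    proof -
      have "(\<forall>(m, z)\<in>S1. r (?nd m) \<in> dec m z) \<longleftrightarrow> (\<forall>(m, z)\<in>S1. r (nd1 m) \<in> dec m z)"
        by (rule ball_cong[OF refl]) (use nd1' in \<open>auto simp del: if_image_distrib\<close>)
      moreover have "(\<forall>(m, z)\<in>S2. r (?nd m) \<in> dec m z) \<longleftrightarrow> (\<forall>(m, z)\<in>S2. r (nd2 m) \<in> dec m z)"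
        by (rule ball_cong[OF refl]) (use nd2' in \<open>auto simp del: if_image_distrib\<close>)
      ultimately show ?thesis unfolding ball_Un by (rule arg_cong2[of _ _ _ _ "(\<and>)"])
    qed
    show "a \<in> plain.sat crel U dec (Meet T1 T2) x \<longleftrightarrow> (\<exists>r. r rt = a \<and> obeys rt (B1 \<union> B2) ?par ?prt ?con ?lab U r \<and>
       (\<forall>(m, z)\<in>S1 \<union> S2. r (?nd m) \<in> dec m z))"
      unfolding ob sp
    proof
      assume "a \<in> plain.sat crel U dec (Meet T1 T2) x"
      then have "a \<in> plain.sat crel U dec T1 x" "a \<in> plain.sat crel U dec T2 x" by auto
      then obtain r1 r2 where r1: "r1 rt = a" "obeys rt B1 par1 prt1 con1 lab1 U r1" "\<forall>(m, z)\<in>S1. r1 (nd1 m) \<in> dec m z"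
        and r2: "r2 rt = a" "obeys rt B2 par2 prt2 con2 lab2 U r2" "\<forall>(m, z)\<in>S2. r2 (nd2 m) \<in> dec m z"
        unfolding sem1 sem2 by blast
      \<comment> \<open>The two realizations agree at the root, the only shared vertex, so they can
        be pasted.\<close>
      define r where "r v = (if v \<in> B1 then r1 v else r2 v)" for v
      have e1: "r v = r1 v" if "v \<in> insert rt B1" for v using that r1(1) r2(1) by (auto simp: r_def)
      have e2: "r v = r2 v" if "v \<in> insert rt B2" for v using that nB1 p1.root_B by (auto simp: r_def)
      have "obeys rt B1 par1 prt1 con1 lab1 U r" using obeys_cong[of rt B1 r r1] e1 p1.par_in r1(2) by blast
      moreover have "obeys rt B2 par2 prt2 con2 lab2 U r" using obeys_cong[of rt B2 r r2] e2 p2.par_in r2(2) by blast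
      moreover have "\<forall>(m, z)\<in>S1. r (nd1 m) \<in> dec m z" using r1(3) e1 s1(1) by fastforce
      moreover have "\<forall>(m, z)\<in>S2. r (nd2 m) \<in> dec m z" using r2(3) e2 s2(1) by fastforce
      moreover have "r rt = a" using e1 r1(1) by simp
      ultimately show "\<exists>r. r rt = a \<and> (obeys rt B1 par1 prt1 con1 lab1 U r \<and> obeys rt B2 par2 prt2 con2 lab2 U r) \<and>
         (\<forall>(m, z)\<in>S1. r (nd1 m) \<in> dec m z) \<and> (\<forall>(m, z)\<in>S2. r (nd2 m) \<in> dec m z)" by blast
    next
      assume "\<exists>r. r rt = a \<and> (obeys rt B1 par1 prt1 con1 lab1 U r \<and> obeys rt B2 par2 prt2 con2 lab2 U r) \<and>
         (\<forall>(m, z)\<in>S1. r (nd1 m) \<in> dec m z) \<and> (\<forall>(m, z)\<in>S2. r (nd2 m) \<in> dec m z)"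
      then have "a \<in> plain.sat crel U dec T1 x" "a \<in> plain.sat crel U dec T2 x" unfolding sem1 sem2 by blast+
      then show "a \<in> plain.sat crel U dec (Meet T1 T2) x" by simp
    qed
  qed
qed

lemma tree_structure_single:
  assumes "T = Free \<and> S = {} \<or> T = Spot m \<and> S = {(m, x)}"
  shows "tree_structure C rt x T S {} id (\<lambda>_. 0) (\<lambda>_. 0) con (\<lambda>_. x) (\<lambda>_. rt)"
proof -
  have "parent_tree rt {} id (\<lambda>_. 0)" by unfold_locales auto
  note pt = this
  have ex: "(\<exists>r :: nat \<Rightarrow> 'b. r rt = a \<and> P (r rt)) \<longleftrightarrow> P a" for a P
    by (rule iffI) (blast, rule exI[of _ "\<lambda>_. a"], blast)
  have ob: "obeys rt {} id (\<lambda>_. 0) con (\<lambda>_. x) U r \<longleftrightarrow> r rt \<in> U x" for U :: "'a \<Rightarrow> 'b set" and r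
    by (simp add: obeys_def)
  have "a \<in> plain.sat crel U dec T x \<longleftrightarrow>
     (\<exists>r. r rt = a \<and> r rt \<in> U x \<and> (\<forall>(m, z)\<in>S. r rt \<in> dec m z))" for U :: "'a \<Rightarrow> 'b set" and dec a
    using assms ex[of a "\<lambda>b. b \<in> U x \<and> (\<forall>(m, z)\<in>S. b \<in> dec m z)"] by auto
  moreover have "\<forall>(m, z)\<in>S. x = z \<and> (leaf_spots T \<longrightarrow> \<not> root_free T)" using assms by auto
  moreover have "br T = 0" "dg T = 0" using assms by auto
  ultimately show ?thesis unfolding tree_structure_def ob using pt by (intro conjI allI) auto
qed

lemma tree_structure_Edge:
  assumes T: "tree_structure C w y (ts (1 - p)) S B par rk prt con lab nd"
    and c: "c \<in> C" "p \<in> {0, 1}" "clab c p = x" "clab c (1 - p) = y" and rt: "rt \<notin> insert w B"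
  shows "tree_structure C rt x (Edge c p ts) S (insert w B) (par(w := rt))
    (\<lambda>v. if v = rt then 0 else Suc (rk v)) (prt(w := p)) (con(w := c)) (lab(rt := x)) nd"
    (is "tree_structure _ _ _ _ _ ?B ?par ?rk ?prt ?con ?lab _")
proof -
  have f: "parent_tree w B par rk" "rk w = 0" "lab w = y"
     "\<forall>b\<in>B. con b \<in> C \<and> prt b \<in> {0, 1} \<and> clab (con b) (prt b) = lab (par b) \<and> clab (con b) (1 - prt b) = lab b"
     "\<forall>(m, z)\<in>S. nd m \<in> insert w B \<and> lab (nd m) = z \<and>
        (leaf_spots (ts (1 - p)) \<longrightarrow> nd m \<notin> par ` B \<and> (root_free (ts (1 - p)) \<longrightarrow> nd m \<in> B))"
     "card {b \<in> B. b \<notin> par ` B} \<le> br (ts (1 - p))"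
     "\<forall>U dec a. a \<in> plain.sat crel U dec (ts (1 - p)) y \<longleftrightarrow>
        (\<exists>r. r w = a \<and> obeys w B par prt con lab U r \<and> (\<forall>(m, z)\<in>S. r (nd m) \<in> dec m z))"
    by (insert T[unfolded tree_structure_def], (elim conjE, assumption)+)
  interpret parent_tree w B par rk by (rule f(1))
  have par_rt: "par b \<noteq> rt" if "b \<in> B" for b using par_in[OF that] rt by blast
  have par_w: "?par b = par b" if "b \<in> B" for b using that root_B by auto
  have par_im: "?par ` ?B = insert rt (par ` B)" using image_cong[of B B ?par par] par_w by (simp del: fun_upd_apply add: fun_upd_same)
  have s: "nd m \<in> insert w B" "lab (nd m) = z" "leaf_spots (ts (1 - p)) \<Longrightarrow> nd m \<notin> par ` B" if "(m, z) \<in> S" for m z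
    using bspec[OF f(5) that, unfolded prod.case] by (elim conjE, simp)+
  have nd_rt: "nd m \<noteq> rt" if "(m, z) \<in> S" for m z using s(1)[OF that] rt by blast
  show ?thesis
    unfolding tree_structure_def
  proof (intro conjI allI)
    show "parent_tree rt ?B ?par ?rk"
    proof
      fix b assume b: "b \<in> ?B"
      show "?par b \<in> insert rt ?B" using b par_in[of b] by auto
      show "?rk (?par b) < ?rk b" using b rt par_rt[of b] rk_par[of b] by auto
    qed (use fin_B rt in auto)
    show "?rk rt = 0" "?lab rt = x" by auto
    show "\<forall>b\<in>?B. ?con b \<in> C \<and> ?prt b \<in> {0, 1} \<and> clab (?con b) (?prt b) = ?lab (?par b) \<and> clab (?con b) (1 - ?prt b) = ?lab b"
    proof
      fix b assume b: "b \<in> ?B"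
      show "?con b \<in> C \<and> ?prt b \<in> {0, 1} \<and> clab (?con b) (?prt b) = ?lab (?par b) \<and> clab (?con b) (1 - ?prt b) = ?lab b"
      proof (cases "b = w")
        case True
        then show ?thesis using c f(3) rt by auto
      next
        case False
        then have b: "b \<in> B" using b by blast
        then have "?con b = con b" "?prt b = prt b" "?lab (?par b) = lab (par b)" "?lab b = lab b"
          using False par_rt[OF b] rt by auto
        then show ?thesis using f(4) b by simp
      qed
    qed
    show "\<forall>(m, z)\<in>S. nd m \<in> insert rt ?B \<and> ?lab (nd m) = z \<and>
        (leaf_spots (Edge c p ts) \<longrightarrow> nd m \<notin> ?par ` ?B \<and> (root_free (Edge c p ts) \<longrightarrow> nd m \<in> ?B))"
      unfolding par_im
    proof (intro ballI, split prod.split, intro allI impI)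
      fix mz m z assume mz: "mz \<in> S" "mz = (m, z)"
      then have m: "(m, z) \<in> S" by simp
      show "nd m \<in> insert rt ?B \<and> ?lab (nd m) = z \<and>
        (leaf_spots (Edge c p ts) \<longrightarrow> nd m \<notin> insert rt (par ` B) \<and> (root_free (Edge c p ts) \<longrightarrow> nd m \<in> ?B))"
        using s[OF m] nd_rt[OF m] by simp
    qed
    \<comment> \<open>The old root \<open>w\<close> is a leaf only if nothing lies below it;
      otherwise a vertex of least rank in \<open>B\<close> has \<open>w\<close> as its parent. This
      accounts for the \<open>max 1\<close> in \<open>br\<close>.\<close>
    have leaf: "{b \<in> ?B. b \<notin> ?par ` ?B} \<subseteq> (if B = {} then {w} else {b \<in> B. b \<notin> par ` B})"
    proof (cases "B = {}")
      case False
      then obtain b where b: "b \<in> B" "\<And>b'. b' \<in> B \<Longrightarrow> rk b \<le> rk b'"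
        using ex_has_least_nat[of "\<lambda>b. b \<in> B" _ rk] by blast
      have "par b = w" using par_in[OF b(1)] rk_par[OF b(1)] b(2)[of "par b"] by auto
      then show ?thesis using b(1) False unfolding par_im by auto
    qed auto
    have "finite (if B = {} then {w} else {b \<in> B. b \<notin> par ` B})" using fin_B by simp
    from card_mono[OF this leaf] show "card {b \<in> ?B. b \<notin> ?par ` ?B} \<le> br (Edge c p ts)"
      using f(6) by (auto split: if_splits)
    have "{b \<in> ?B. ?par b = rt} = {w}" using par_rt by auto
    then show "card {b \<in> ?B. ?par b = rt} = dg (Edge c p ts)" by simp
  next
    fix U :: "'a \<Rightarrow> 'b set" and dec :: "nat \<Rightarrow> 'a \<Rightarrow> 'b set" and a
    have pp: "cports c - {p} = {1 - p}" using c(2) by (intro cports_minus) (simp add: cports_def)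
    have ob: "obeys rt ?B ?par ?prt ?con ?lab U r \<longleftrightarrow> r rt \<in> U x \<and>
        (if p = 0 then (r rt, r w) else (r w, r rt)) \<in> snd c \<and> obeys w B par prt con lab U r" for r
    proof -
      have 1: "(\<forall>v\<in>insert rt ?B. r v \<in> U (?lab v)) \<longleftrightarrow> r rt \<in> U x \<and> (\<forall>v\<in>insert w B. r v \<in> U (lab v))"
        using rt by auto
      have 2: "(\<forall>b\<in>?B. (if ?prt b = 0 then (r (?par b), r b) else (r b, r (?par b))) \<in> snd (?con b)) \<longleftrightarrow>
        (if p = 0 then (r rt, r w) else (r w, r rt)) \<in> snd c \<and>
        (\<forall>b\<in>B. (if prt b = 0 then (r (par b), r b) else (r b, r (par b))) \<in> snd (con b))"
        unfolding ball_simps using root_B by (intro arg_cong2[of _ _ _ _ "(\<and>)"] ball_cong) (auto simp del: if_image_distrib)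
      show ?thesis unfolding obeys_def 1 2 by blast
    qed
    have ed: "a \<in> plain.sat crel U dec (Edge c p ts) x \<longleftrightarrow> a \<in> U x \<and>
       (\<exists>b. (if p = 0 then (a, b) else (b, a)) \<in> snd c \<and> b \<in> plain.sat crel U dec (ts (1 - p)) y)"
    proof
      assume "a \<in> plain.sat crel U dec (Edge c p ts) x"
      then obtain t where "a \<in> U x" "t \<in> crel c" "t p = a" "t (1 - p) \<in> plain.sat crel U dec (ts (1 - p)) y"
        using pp c(4) by auto
      then show "a \<in> U x \<and> (\<exists>b. (if p = 0 then (a, b) else (b, a)) \<in> snd c \<and> b \<in> plain.sat crel U dec (ts (1 - p)) y)"
        using c(2) unfolding crel_def by auto
    next
      assume "a \<in> U x \<and> (\<exists>b. (if p = 0 then (a, b) else (b, a)) \<in> snd c \<and> b \<in> plain.sat crel U dec (ts (1 - p)) y)"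
      then obtain b where b: "a \<in> U x" "(if p = 0 then (a, b) else (b, a)) \<in> snd c" "b \<in> plain.sat crel U dec (ts (1 - p)) y" by blast
      define t where "t q = (if q = p then a else b)" for q
      have t: "t \<in> crel c" using b(2) c(2) unfolding crel_def t_def by auto
      have "t p = a" "t (1 - p) = b" using c(2) unfolding t_def by auto
      then show "a \<in> plain.sat crel U dec (Edge c p ts) x"
        unfolding plain.sat.simps pp using b(1,3) t c(4) by blast
    qed
    show "a \<in> plain.sat crel U dec (Edge c p ts) x \<longleftrightarrow> (\<exists>r. r rt = a \<and> obeys rt ?B ?par ?prt ?con ?lab U r \<and>
       (\<forall>(m, z)\<in>S. r (nd m) \<in> dec m z))"
      unfolding ob ed f(7)[rule_format]
    proof
      assume "a \<in> U x \<and> (\<exists>b. (if p = 0 then (a, b) else (b, a)) \<in> snd c \<and> (\<exists>r. r w = b \<and>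
        obeys w B par prt con lab U r \<and> (\<forall>(m, z)\<in>S. r (nd m) \<in> dec m z)))"
      then obtain b r where r': "a \<in> U x" "(if p = 0 then (a, b) else (b, a)) \<in> snd c" "r w = b"
        "obeys w B par prt con lab U r" "\<forall>(m, z)\<in>S. r (nd m) \<in> dec m z" by (elim exE conjE)
      note r = r'(1) r'(2)[folded r'(3)] r'(4,5)
      define r0 where "r0 = r(rt := a)"
      have e: "r0 v = r v" if "v \<in> insert w B" for v using that rt unfolding r0_def by auto
      have "obeys w B par prt con lab U r0"
        by (rule obeys_cong[of w B r0 r, THEN iffD2]) (fact e, fact par_in, fact r(3))
      moreover have "\<forall>(m, z)\<in>S. r0 (nd m) \<in> dec m z"
      proof (intro ballI, split prod.split, intro allI impI)
        fix mz m z assume "mz \<in> S" "mz = (m, z)"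
        then have m: "(m, z) \<in> S" by simp
        show "r0 (nd m) \<in> dec m z" unfolding e[OF s(1)[OF m]] using r(4) m by blast
      qed
      moreover have "r0 w = r w" "r0 rt = a" using e unfolding r0_def by simp_all
      ultimately show "\<exists>r. r rt = a \<and> (r rt \<in> U x \<and> (if p = 0 then (r rt, r w) else (r w, r rt)) \<in> snd c \<and>
         obeys w B par prt con lab U r) \<and> (\<forall>(m, z)\<in>S. r (nd m) \<in> dec m z)"
        using r(1,2) by (intro exI[of _ r0]) (simp split: if_splits)
    next
      assume "\<exists>r. r rt = a \<and> (r rt \<in> U x \<and> (if p = 0 then (r rt, r w) else (r w, r rt)) \<in> snd c \<and>
         obeys w B par prt con lab U r) \<and> (\<forall>(m, z)\<in>S. r (nd m) \<in> dec m z)"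
      then obtain r where r: "r rt = a" "r rt \<in> U x" "(if p = 0 then (r rt, r w) else (r w, r rt)) \<in> snd c"
         "obeys w B par prt con lab U r" "\<forall>(m, z)\<in>S. r (nd m) \<in> dec m z" by (elim exE conjE)
      show "a \<in> U x \<and> (\<exists>b. (if p = 0 then (a, b) else (b, a)) \<in> snd c \<and> (\<exists>r. r w = b \<and>
        obeys w B par prt con lab U r \<and> (\<forall>(m, z)\<in>S. r (nd m) \<in> dec m z)))"
        using r(2,3)[unfolded r(1)] r(4,5) by (intro conjI exI[of _ "r w"] exI[of _ r]) simp_all
    qed
  qed
qed

text \<open>\<open>A\<close> collects the vertices already taken elsewhere. Fresh numbers always
  exist, so branches can be realized on disjoint vertex sets before they are glued.\<close>

lemma tree_structure_exists:
  assumes "plain.wft C G Sp x T S" "finite A" "rt \<notin> A"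
  shows "\<exists>B par rk prt con lab nd. tree_structure C rt x T S B par rk prt con lab nd \<and> B \<inter> A = {}"
  using assms
proof (induction arbitrary: rt A rule: plain.wft.induct)
  case (wft_Free x)
  then show ?case using tree_structure_single[of Free "{}" 0 x C rt undefined] by blast
next
  case (wft_Spot x m)
  then show ?case using tree_structure_single[of "Spot m" "{(m, x)}" m x C rt undefined] by blast
next
  case (wft_Meet x T1 S1 T2 S2)
  obtain B1 par1 rk1 prt1 con1 lab1 nd1 where 1: "tree_structure C rt x T1 S1 B1 par1 rk1 prt1 con1 lab1 nd1" "B1 \<inter> A = {}"
    using wft_Meet.IH(1)[OF wft_Meet.prems] by (elim exE conjE)
  have "parent_tree rt B1 par1 rk1" using 1(1) unfolding tree_structure_def by (elim conjE)
  then have "finite (A \<union> B1)" "rt \<notin> A \<union> B1" using wft_Meet.prems parent_tree.fin_B parent_tree.root_B by blast+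
  from wft_Meet.IH(2)[OF this]
  obtain B2 par2 rk2 prt2 con2 lab2 nd2 where 2: "tree_structure C rt x T2 S2 B2 par2 rk2 prt2 con2 lab2 nd2" "B2 \<inter> (A \<union> B1) = {}"
    by (elim exE conjE)
  have "B1 \<inter> B2 = {}" "(B1 \<union> B2) \<inter> A = {}" using 1(2) 2(2) by blast+
  then show ?case using tree_structure_Meet[OF 1(1) 2(1) _ wft_Meet(4)] by blast
next
  case (wft_Edge x c p ts S)
  have q: "1 - p \<in> cports c - {p}" "cports c - {p} = {1 - p}" using cports_minus[OF wft_Edge(3)] by auto
  have p: "p \<in> {0, 1}" using wft_Edge(3) by (simp add: cports_def)
  have finA: "finite (insert rt A)" using wft_Edge.prems by simp
  obtain w where w: "w \<notin> insert rt A" using ex_new_if_finite[OF infinite_UNIV_nat finA] by blast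
  from wft_Edge.IH[OF q(1) finA w]
  obtain B par rk prt con lab nd where B: "tree_structure C w (clab c (1 - p)) (ts (1 - p)) (S (1 - p)) B par rk prt con lab nd"
     "B \<inter> insert rt A = {}" by (elim exE conjE)
  have "rt \<notin> insert w B" "insert w B \<inter> A = {}" using w B(2) by blast+
  moreover have "(\<Union>q\<in>cports c - {p}. S q) = S (1 - p)" unfolding q(2) by simp
  ultimately show ?case using tree_structure_Edge[where ts = ts, OF B(1) wft_Edge(2) p wft_Edge(4) refl] by (simp only:) blast
qed

section \<open>Paths of patterns\<close>

text \<open>The relation between beginning and end induced by realizations: adding a pattern to a
  set becomes a relational image, and sums become compositions.\<close>

definition prl :: "('x \<Rightarrow> 'd set) \<Rightarrow> ('x, 'd) pattern \<Rightarrow> ('d \<times> 'd) set" where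
  "prl U p = {(r (beginning p), r (ending p)) |r. (\<forall>v\<in>verts (graph_of p). r v \<in> U (vlabel p v)) \<and>
     (\<forall>e\<in>arcs (graph_of p). (r (tail (graph_of p) e), r (head (graph_of p) e)) \<in> snd (elabel p e))}"

lemma l_add_subset_prl: "l_add D Ds l A p \<subseteq> prl (Ds (l + 1)) p `` A"
  unfolding l_add_def l_realization_def realization_def prl_def by auto

text \<open>The root has degree one and counts as a leaf, hence \<open>Suc (br T)\<close>. It
  receives the number \<open>0\<close>, so that beginning and end can be chosen freely among the
  root and the spots, even as the same vertex.\<close>

lemma tree_pattern:
  assumes wft: "plain.wft C G Sp x T S" and T: "leaf_spots T" "root_free T" "dg T = 1" "Suc (br T) \<le> n"
    and V: "x \<in> V" "\<And>c. c \<in> C \<Longrightarrow> fst (fst c) \<in> V \<and> snd (fst c) \<in> V"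
    and S0: "0 \<notin> fst ` S" and a: "(a, y) \<in> insert (0, x) S" and b: "(b, z) \<in> insert (0, x) S"
  shows "\<exists>p. n_tree_pattern V C n p \<and> vlabel p (beginning p) = y \<and> vlabel p (ending p) = z \<and>
    (\<forall>U. prl U p \<subseteq> {(t a, t b) |t. t 0 \<in> plain.sat crel U (\<lambda>m z. {t m}) T x})"
proof -
  have "finite ({} :: nat set)" "0 \<notin> ({} :: nat set)" by auto
  from tree_structure_exists[OF wft this]
  obtain B par rk prt con lab nd where "tree_structure C 0 x T S B par rk prt con lab nd" by (elim exE conjE)
  then have f: "parent_tree 0 B par rk" "lab 0 = x"
     "\<forall>b\<in>B. con b \<in> C \<and> prt b \<in> {0, 1} \<and> clab (con b) (prt b) = lab (par b) \<and> clab (con b) (1 - prt b) = lab b"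
     "\<forall>(m, z)\<in>S. nd m \<in> insert 0 B \<and> lab (nd m) = z \<and>
        (leaf_spots T \<longrightarrow> nd m \<notin> par ` B \<and> (root_free T \<longrightarrow> nd m \<in> B))"
     "card {b \<in> B. b \<notin> par ` B} \<le> br T" "card {b \<in> B. par b = 0} = dg T"
     "\<forall>U dec a. a \<in> plain.sat crel U dec T x \<longleftrightarrow>
        (\<exists>r. r 0 = a \<and> obeys 0 B par prt con lab U r \<and> (\<forall>(m, z)\<in>S. r (nd m) \<in> dec m z))"
    unfolding tree_structure_def by - (elim conjE, assumption)+
  interpret parent_tree 0 B par rk by (rule f(1))
  have s: "nd m \<in> B" "nd m \<notin> par ` B" "lab (nd m) = z" if "(m, z) \<in> S" for m z
    using bspec[OF f(4) that] T(1,2) by simp_all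
  define nd' where "nd' m = (if m = 0 then 0 else nd m)" for m
  define p where "p = \<lparr> graph_of = pgraph 0 B par prt, vlabel = lab, elabel = con, beginning = nd' a, ending = nd' b \<rparr>"
  have S: "m \<noteq> 0" if "(m, z) \<in> S" for m z using that S0 by force
  have nd': "nd' m \<in> leaves (pgraph 0 B par prt) \<and> lab (nd' m) = z" if "(m, z) \<in> insert (0, x) S" for m z
  proof (cases "(m, z) \<in> S")
    case True
    then show ?thesis using leafI[OF s(1,2)[OF True]] s(3)[OF True] S[OF True] unfolding nd'_def by simp
  next
    case False
    then show ?thesis using that root_leafI f(2,6) T(3) unfolding nd'_def by simp
  qed
  have labV: "lab v \<in> V" if "v \<in> insert 0 B" for v
  proof (cases "v = 0")
    case False
    then have "con v \<in> C" "lab v = clab (con v) (1 - prt v)" using that f(3) by auto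
    then show ?thesis using V(2)[of "con v"] by (simp add: clab_def)
  qed (use f(2) V(1) in simp)
  have "pattern_in V C p"
    unfolding pattern_in_def
  proof (intro conjI ballI)
    show "fin_digraph (graph_of p)" using fin by (simp add: p_def)
    show "vlabel p v \<in> V" if "v \<in> verts (graph_of p)" for v using that labV by (simp add: p_def pgraph_def)
    show "elabel p e \<in> C" if "e \<in> arcs (graph_of p)" for e using that f(3) by (simp add: p_def pgraph_def)
    show "fst (elabel p e) = (vlabel p (tail (graph_of p) e), vlabel p (head (graph_of p) e))"
      if "e \<in> arcs (graph_of p)" for e
    proof -
      have e: "e \<in> B" using that by (simp add: p_def pgraph_def)
      then have "prt e \<in> {0, 1}" "clab (con e) (prt e) = lab (par e)" "clab (con e) (1 - prt e) = lab e" using f(3) by blast+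
      then show ?thesis by (auto simp: p_def pgraph_def clab_def prod_eq_iff)
    qed
    show "beginning p \<in> verts (graph_of p)" "ending p \<in> verts (graph_of p)"
      using nd'[OF a] nd'[OF b] unfolding leaves_def by (simp_all add: p_def)
  qed
  moreover have "card (leaves (pgraph 0 B par prt)) \<le> n"
  proof -
    have "card (leaves (pgraph 0 B par prt)) \<le> card (insert 0 {b \<in> B. b \<notin> par ` B})"
      using leaves_subset fin_B by (intro card_mono) auto
    also have "\<dots> \<le> Suc (card {b \<in> B. b \<notin> par ` B})" by (rule card_insert_le_m1) auto
    finally show ?thesis using f(5) T(4) by simp
  qed
  ultimately have "n_tree_pattern V C n p"
    unfolding n_tree_pattern_def using nd'[OF a] nd'[OF b] oriented_tree by (simp add: p_def)
  moreover have "vlabel p (beginning p) = y" "vlabel p (ending p) = z" using nd'[OF a] nd'[OF b] by (simp_all add: p_def)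
  moreover have "prl U p \<subseteq> {(t a, t b) |t. t 0 \<in> plain.sat crel U (\<lambda>m z. {t m}) T x}" for U
  proof
    fix e assume "e \<in> prl U p"
    then obtain r where r: "e = (r (nd' a), r (nd' b))" "\<forall>v\<in>insert 0 B. r v \<in> U (lab v)"
      "\<forall>b\<in>B. (r (tail (pgraph 0 B par prt) b), r (head (pgraph 0 B par prt) b)) \<in> snd (con b)"
      unfolding prl_def p_def by (auto simp: pgraph_def)
    have "obeys 0 B par prt con lab U r"
      using r(2,3) unfolding obeys_def by (auto simp: pgraph_def)
    moreover have "\<forall>(m, z)\<in>S. r (nd m) \<in> {r (nd' m)}" using S by (auto simp: nd'_def dest: S)
    moreover have "nd' 0 = 0" by (simp add: nd'_def)
    ultimately have "r (nd' 0) \<in> plain.sat crel U (\<lambda>m z. {r (nd' m)}) T x" unfolding f(7)[rule_format] by auto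
    then show "e \<in> {(t a, t b) |t. t 0 \<in> plain.sat crel U (\<lambda>m z. {t m}) T x}"
      using r(1) by (intro CollectI exI[of _ "\<lambda>m. r (nd' m)"]) simp
  qed
  ultimately show ?thesis by (intro exI[of _ p] conjI allI)
qed

section \<open>Sums and multiples of patterns\<close>

lemma vlabel_pinl: "vlabel (p \<oplus>\<^sub>p q) (pinl v) = vlabel p v"
  by (simp add: psum_def pinl_def)

lemma vlabel_pinr:
  "vlabel p (ending p) = vlabel q (beginning q) \<Longrightarrow> vlabel (p \<oplus>\<^sub>p q) (pinr p q v) = vlabel q v"
  by (simp add: psum_def pinl_def pinr_def)

lemma vlabel_psum:
  assumes "vlabel p (ending p) = vlabel q (beginning q)"
  shows "vlabel (p \<oplus>\<^sub>p q) (beginning (p \<oplus>\<^sub>p q)) = vlabel p (beginning p)"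
    "vlabel (p \<oplus>\<^sub>p q) (ending (p \<oplus>\<^sub>p q)) = vlabel q (ending q)"
proof -
  have "beginning (p \<oplus>\<^sub>p q) = pinl (beginning p)" "ending (p \<oplus>\<^sub>p q) = pinr p q (ending q)"
    by (simp_all add: psum_def)
  then show "vlabel (p \<oplus>\<^sub>p q) (beginning (p \<oplus>\<^sub>p q)) = vlabel p (beginning p)"
    "vlabel (p \<oplus>\<^sub>p q) (ending (p \<oplus>\<^sub>p q)) = vlabel q (ending q)"
    by (simp_all add: vlabel_pinl vlabel_pinr[OF assms])
qed

text \<open>Both summands embed into the sum and share the glued vertex, so a realization of the sum
  restricts to composable realizations. Equality of the labels gives that vertex the same domain on
  both sides.\<close>

lemma prl_psum:
  assumes "vlabel p (ending p) = vlabel q (beginning q)"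
  shows "prl U (p \<oplus>\<^sub>p q) \<subseteq> prl U p O prl U q"
proof
  fix e assume "e \<in> prl U (p \<oplus>\<^sub>p q)"
  then obtain r where e: "e = (r (beginning (p \<oplus>\<^sub>p q)), r (ending (p \<oplus>\<^sub>p q)))"
    and rv: "\<And>v. v \<in> verts (graph_of (p \<oplus>\<^sub>p q)) \<Longrightarrow> r v \<in> U (vlabel (p \<oplus>\<^sub>p q) v)"
    and re: "\<And>e. e \<in> arcs (graph_of (p \<oplus>\<^sub>p q)) \<Longrightarrow>
       (r (tail (graph_of (p \<oplus>\<^sub>p q)) e), r (head (graph_of (p \<oplus>\<^sub>p q)) e)) \<in> snd (elabel (p \<oplus>\<^sub>p q) e)"
    unfolding prl_def by blast
  have "(r (pinl (beginning p)), r (pinl (ending p))) \<in> prl U p"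
    unfolding prl_def
  proof (intro CollectI exI[of _ "\<lambda>v. r (pinl v)"] conjI ballI)
    fix v assume "v \<in> verts (graph_of p)"
    then show "r (pinl v) \<in> U (vlabel p v)" using rv[of "pinl v"] unfolding vlabel_pinl by (simp add: psum_def)
  next
    fix e assume "e \<in> arcs (graph_of p)"
    then show "(r (pinl (tail (graph_of p) e)), r (pinl (head (graph_of p) e))) \<in> snd (elabel p e)"
      using re[of "sum_encode (Inl e)"] by (simp add: psum_def InlI)
  qed simp
  moreover have "(r (pinr p q (beginning q)), r (pinr p q (ending q))) \<in> prl U q"
    unfolding prl_def
  proof (intro CollectI exI[of _ "\<lambda>v. r (pinr p q v)"] conjI ballI)
    fix v assume "v \<in> verts (graph_of q)"
    then show "r (pinr p q v) \<in> U (vlabel q v)"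
      using rv[of "pinr p q v"] unfolding vlabel_pinr[OF assms] by (simp add: psum_def)
  next
    fix e assume "e \<in> arcs (graph_of q)"
    then show "(r (pinr p q (tail (graph_of q) e)), r (pinr p q (head (graph_of q) e))) \<in> snd (elabel q e)"
      using re[of "sum_encode (Inr e)"] by (simp add: psum_def InrI)
  qed simp
  moreover have "pinr p q (beginning q) = pinl (ending p)" by (simp add: pinr_def)
  ultimately show "e \<in> prl U p O prl U q" unfolding e by (auto simp: psum_def)
qed

lemma prl_pmult:
  assumes "vlabel p (ending p) = vlabel p (beginning p)"
  shows "prl U (pmult j p) \<subseteq> prl U p ^^ j \<and> vlabel (pmult j p) (ending (pmult j p)) = vlabel p (beginning p)"
proof (induction j)
  case 0
  then show ?case by (auto simp: prl_def one_vertex_pattern_def)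
next
  case (Suc j)
  then have "prl U (pmult (Suc j) p) \<subseteq> prl U (pmult j p) O prl U p" by (simp add: prl_psum)
  then show ?case using Suc vlabel_psum(2)[of "pmult j p" p] assms by (simp add: relcomp_mono subset_trans)
qed

text \<open>Concatenation of lists is strictly associative, whereas \<open>psum\<close> encodes the
  vertices anew each time.\<close>

primrec tree_path :: "'x set \<Rightarrow> ('x, 'd) bin_constraint set \<Rightarrow> nat \<Rightarrow> 'x \<Rightarrow> ('x, 'd) pattern list \<Rightarrow> 'x \<Rightarrow> bool" where
  "tree_path V C n x [] y \<longleftrightarrow> x = y"
| "tree_path V C n x (p # ps) y \<longleftrightarrow> n_tree_pattern V C n p \<and> vlabel p (beginning p) = x \<and>
     tree_path V C n (vlabel p (ending p)) ps y"

primrec prls :: "('x \<Rightarrow> 'd set) \<Rightarrow> ('x, 'd) pattern list \<Rightarrow> ('d \<times> 'd) set" where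
  "prls U [] = Id"
| "prls U (p # ps) = prl U p O prls U ps"

lemma tree_path_append: "tree_path V C n x (ps @ qs) y \<longleftrightarrow> (\<exists>z. tree_path V C n x ps z \<and> tree_path V C n z qs y)"
  by (induction ps arbitrary: x) auto

lemma prls_append: "prls U (ps @ qs) = prls U ps O prls U qs"
  by (induction ps) auto

lemma tree_path_pattern:
  assumes "tree_path V C n x ps y" "ps \<noteq> []"
  shows "\<exists>p. path_of_n_trees V C n p \<and> pattern_from_to p x y \<and> (\<forall>U. prl U p \<subseteq> prls U ps)"
  using assms
proof (induction ps arbitrary: y rule: rev_induct)
  case (snoc p ps)
  have p: "n_tree_pattern V C n p" "tree_path V C n x ps (vlabel p (beginning p))" "vlabel p (ending p) = y"
    using snoc.prems(1) by (auto simp: tree_path_append)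
  show ?case
  proof (cases "ps = []")
    case True
    then show ?thesis using p path_of_n_trees.single[OF p(1)] by (auto simp: pattern_from_to_def)
  next
    case False
    then obtain q where q: "path_of_n_trees V C n q" "pattern_from_to q x (vlabel p (beginning p))" "\<forall>U. prl U q \<subseteq> prls U ps"
      using snoc.IH[OF p(2)] by blast
    have l: "vlabel q (ending q) = vlabel p (beginning p)" using q(2) by (simp add: pattern_from_to_def)
    show ?thesis
    proof (intro exI[of _ "q \<oplus>\<^sub>p p"] conjI allI)
      show "path_of_n_trees V C n (q \<oplus>\<^sub>p p)" by (rule path_of_n_trees.append[OF q(1) p(1) l])
      show "pattern_from_to (q \<oplus>\<^sub>p p) x y"
        using q(2) p(3) vlabel_psum[OF l] by (simp add: pattern_from_to_def)
      show "prl U (q \<oplus>\<^sub>p p) \<subseteq> prls U (ps @ [p])" for U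
        using prl_psum[OF l, of U] q(3) by (fastforce simp: prls_append)
    qed
  qed
qed simp

section \<open>The return condition under closure\<close>

inductive_set fclosure :: "nat \<Rightarrow> ((nat \<Rightarrow> 'd) \<Rightarrow> 'd) \<Rightarrow> 'd set \<Rightarrow> 'd set" for N F B where
  base: "a \<in> B \<Longrightarrow> a \<in> fclosure N F B"
| step: "(\<And>i. i < N \<Longrightarrow> v i \<in> fclosure N F B) \<Longrightarrow> F v \<in> fclosure N F B"

lemma relpow_loop: "(a, a) \<in> P ^^ k \<Longrightarrow> (a, a) \<in> P ^^ (k * m)" for P :: "('a \<times> 'a) set"
  by (induction m) (auto simp: relpow_add)

lemma relpow_relpow: "(P ^^ k) ^^ m = P ^^ (k * m)" for P :: "('a \<times> 'a) set"
  by (induction m) (simp_all add: relpow_add add.commute[of k])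

lemma relpow_apply:
  assumes "\<And>v w. (\<And>i. i < N \<Longrightarrow> (v i, w i) \<in> P) \<Longrightarrow> (F v, F w) \<in> P"
    and "\<And>u v. (\<And>i. i < N \<Longrightarrow> u i = v i) \<Longrightarrow> F u = F v"
    and "\<And>i. i < N \<Longrightarrow> (v i, w i) \<in> P ^^ k"
  shows "(F v, F w) \<in> P ^^ k"
  using assms(3)
proof (induction k arbitrary: w)
  case 0
  then show ?case using assms(2)[of v w] by auto
next
  case (Suc k)
  have "\<forall>i. \<exists>u. i < N \<longrightarrow> (v i, u) \<in> P ^^ k \<and> (u, w i) \<in> P" using Suc.prems by (fastforce elim!: relpow_Suc_E)
  from choice[OF this] obtain u where u: "\<And>i. i < N \<Longrightarrow> (v i, u i) \<in> P ^^ k \<and> (u i, w i) \<in> P" by blast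
  have "(F v, F u) \<in> P ^^ k" using u by (intro Suc.IH) blast
  moreover have "(F u, F w) \<in> P" using u by (intro assms(1)) blast
  ultimately show ?case by (auto intro: relpow_Suc_I)
qed

text \<open>Finitely many elements return along a common power of \<open>P O Q\<close>; prolonging \<open>Q\<close> by the remaining
  factors of that power makes them also return along \<open>P\<close> after a common number of rounds.\<close>

lemma fclosure_returns:
  fixes \<G> :: "('d \<times> 'd) set set"
  assumes comp: "\<And>P Q. P \<in> \<G> \<Longrightarrow> Q \<in> \<G> \<Longrightarrow> P O Q \<in> \<G>"
    and inv: "\<And>P v w. P \<in> \<G> \<Longrightarrow> (\<And>i. i < N \<Longrightarrow> (v i, w i) \<in> P) \<Longrightarrow> (F v, F w) \<in> P"
    and cong: "\<And>u v. (\<And>i. i < N \<Longrightarrow> u i = v i) \<Longrightarrow> F u = F v"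
    and B: "\<And>a P Q. a \<in> B \<Longrightarrow> P \<in> \<G> \<Longrightarrow> Q \<in> \<G> \<Longrightarrow> \<exists>j. (a, a) \<in> (P O Q) ^^ j O P"
    and "a \<in> fclosure N F B" "P \<in> \<G>" "Q \<in> \<G>"
  shows "\<exists>j. (a, a) \<in> (P O Q) ^^ j O P"
  using assms(5-7)
proof (induction arbitrary: P Q rule: fclosure.induct)
  case (base a)
  then show ?case using B by blast
next
  case (step v)
  define Z where "Z = P O Q"
  have Z: "Z \<in> \<G>" unfolding Z_def using comp step.prems by blast
  have pow: "Z ^^ Suc k \<in> \<G>" for k
    by (induction k) (use Z comp in auto)
  have "\<exists>k>0. (v i, v i) \<in> Z ^^ k" if i: "i < N" for i
  proof -
    \<comment> \<open>The pair \<open>(Z, Z)\<close> gives a return along \<open>2 * j + 1\<close>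
      copies of \<open>Z\<close>, a power that is never the zeroth.\<close>
    obtain j where "(v i, v i) \<in> (Z O Z) ^^ j O Z" using step.IH[OF i Z Z] by blast
    moreover have "(Z O Z) ^^ j = Z ^^ (2 * j)" using relpow_relpow[where P = Z and k = 2 and m = j] by (simp add: numeral_2_eq_2)
    ultimately have "(v i, v i) \<in> Z ^^ Suc (2 * j)" by simp
    then show ?thesis by blast
  qed
  then have "\<forall>i. \<exists>k. i < N \<longrightarrow> 0 < k \<and> (v i, v i) \<in> Z ^^ k" by blast
  from choice[OF this] obtain k where k: "\<And>i. i < N \<Longrightarrow> 0 < k i \<and> (v i, v i) \<in> Z ^^ k i" by blast
  define K where "K = (\<Prod>i<N. k i)"
  have K0: "0 < K" unfolding K_def using k by (intro prod_pos) auto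
  then obtain K' where K': "K = Suc K'" by (cases K) auto
  have K: "(v i, v i) \<in> Z ^^ K" if i: "i < N" for i
  proof -
    have "K = k i * (\<Prod>i\<in>{..<N} - {i}. k i)" unfolding K_def using i by (simp add: prod.remove)
    then show ?thesis using relpow_loop k[OF i] by metis
  qed
  define Q' where "Q' = (if K' = 0 then Q else Q O Z ^^ K')"
  have "Q' \<in> \<G>" unfolding Q'_def using step.prems(2) comp pow[of "K' - 1"] by (cases K') auto
  have PQ': "P O Q' = Z ^^ K"
  proof -
    have "Z ^^ K = Z O Z ^^ K'" unfolding K' by (simp add: relpow_commute)
    then show ?thesis unfolding Q'_def Z_def[symmetric] by (auto simp: Z_def O_assoc)
  qed
  have "\<forall>i. \<exists>j. i < N \<longrightarrow> (v i, v i) \<in> (Z ^^ K) ^^ j O P"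
    using step.IH[OF _ step.prems(1) \<open>Q' \<in> \<G>\<close>] unfolding PQ' by blast
  from choice[OF this] obtain j where j: "\<And>i. i < N \<Longrightarrow> (v i, v i) \<in> (Z ^^ K) ^^ j i O P" by blast
  \<comment> \<open>Element \<open>v i\<close> first idles \<open>J - j i\<close> times around
    \<open>Z ^^ K\<close>. All of them then take their last \<open>P\<close> after the same number
    of rounds, and \<open>F\<close> can be applied.\<close>
  define J where "J = (\<Sum>i<N. j i)"
  have J: "(v i, v i) \<in> (Z ^^ K) ^^ J O P" if i: "i < N" for i
  proof -
    have "j i \<le> J" unfolding J_def using i by (simp add: member_le_sum)
    then have "(Z ^^ K) ^^ J = (Z ^^ K) ^^ (J - j i) O (Z ^^ K) ^^ j i" by (simp flip: relpow_add)
    moreover have "(v i, v i) \<in> (Z ^^ K) ^^ (J - j i)"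
      using relpow_loop[where a = "v i" and P = "Z ^^ K" and k = 1 and m = "J - j i"] K[OF i] by simp
    ultimately show ?thesis using j[OF i] by (auto simp: O_assoc)
  qed
  have "\<forall>i. \<exists>u. i < N \<longrightarrow> (v i, u) \<in> Z ^^ (K * J) \<and> (u, v i) \<in> P"
    using J by (fastforce simp: relpow_relpow)
  from choice[OF this] obtain u where u: "\<And>i. i < N \<Longrightarrow> (v i, u i) \<in> Z ^^ (K * J) \<and> (u i, v i) \<in> P" by blast
  have "(F v, F u) \<in> Z ^^ (K * J)"
    by (rule relpow_apply[of N Z F, OF inv[OF Z] cong]) (use u in auto)
  moreover have "(F u, F v) \<in> P" by (rule inv[OF step.prems(1)]) (use u in auto)
  ultimately show ?case unfolding Z_def by blast
qed

section \<open>Trees as hyperedges\<close>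

primrec is_edge :: "'h gtree \<Rightarrow> bool" where
  "is_edge Free \<longleftrightarrow> False"
| "is_edge (Spot m) \<longleftrightarrow> False"
| "is_edge (Meet A B) \<longleftrightarrow> False"
| "is_edge (Edge h p ts) \<longleftrightarrow> True"

lemma is_edge_root_free: "is_edge T \<Longrightarrow> root_free T" and is_edge_dg: "is_edge T \<Longrightarrow> dg T = 1"
  by (cases T; simp)+

lemma rename_shape [simp]:
  "br (rename_spots g T) = br T" "dg (rename_spots g T) = dg T" "root_free (rename_spots g T) = root_free T"
  "leaf_spots (rename_spots g T) = leaf_spots T" "is_edge (rename_spots g T) = is_edge T"
  by (induction T) auto

lemma sat_Edge:
  assumes "p \<in> cports c"
  shows "a \<in> plain.sat R U dec (Edge c p ts) x \<longleftrightarrow> a \<in> U x \<and>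
    (\<exists>t\<in>R c. t p = a \<and> t (1 - p) \<in> plain.sat R U dec (ts (1 - p)) (clab c (1 - p)))"
  unfolding plain.sat.simps cports_minus[OF assms] by simp

lemma edge_turn:
  assumes p: "p \<in> cports c"
  shows "plain.sat R U dec (Edge c p ts) (clab c p) \<inter> plain.sat R U dec K (clab c p) \<noteq> {} \<longleftrightarrow>
    plain.sat R U dec (ts (1 - p)) (clab c (1 - p)) \<inter>
    plain.sat R U dec (Edge c (1 - p) (ts(p := K))) (clab c (1 - p)) \<noteq> {}" (is "?L \<longleftrightarrow> ?R")
proof -
  have q: "1 - p \<in> cports c" "1 - (1 - p) = p" using p by (auto simp: cports_def)
  have L: "?L \<longleftrightarrow> (\<exists>t\<in>R c. t p \<in> plain.sat R U dec K (clab c p) \<and>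
      t (1 - p) \<in> plain.sat R U dec (ts (1 - p)) (clab c (1 - p)))"
    using plain.sat_subset[of R U dec K "clab c p"] unfolding ex_in_conv[symmetric] Int_iff sat_Edge[OF p] by blast
  have R: "?R \<longleftrightarrow> (\<exists>t\<in>R c. t p \<in> plain.sat R U dec K (clab c p) \<and>
      t (1 - p) \<in> plain.sat R U dec (ts (1 - p)) (clab c (1 - p)))"
    using plain.sat_subset[of R U dec "ts (1 - p)" "clab c (1 - p)"]
    unfolding ex_in_conv[symmetric] Int_iff sat_Edge[OF q(1)] q(2) fun_upd_same by blast
  show ?thesis unfolding L R ..
qed

lemma br_pos: "plain.wft C G Sp x T S \<Longrightarrow> root_free T \<Longrightarrow> S \<noteq> {} \<Longrightarrow> 1 \<le> br T"
proof (induction rule: plain.wft.induct)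
  case (wft_Meet x A S B S')
  then show ?case by (cases "S = {}") auto
qed auto

text \<open>Rerooting at a spot below \<open>T\<close> trades that leaf for the old root, so the number of leaves
  below the root does not grow.\<close>

lemma plain_reroot:
  assumes C: "\<forall>c\<in>C. fst (fst c) \<in> V \<and> snd (fst c) \<in> V"
    and "plain.wft C V Sp x T S" "(w, z) \<in> S" "leaf_spots T"
    "plain.wft C V Sp x K SK" "leaf_spots K" "root_free K" "root_free T \<or> is_edge K" "fst ` S \<inter> fst ` SK = {}"
  shows "\<exists>T' S'. plain.wft C V Sp z T' S' \<and> S' = S - {(w, z)} \<union> SK \<and> leaf_spots T' \<and> is_edge T' \<and>
    br T' + 1 \<le> max 1 (br T) + max 1 (br K) \<and>
    (\<forall>R U (dec :: nat \<Rightarrow> 'x \<Rightarrow> 'd set). plain.sat R U dec T x \<inter> plain.sat R U dec K x \<noteq> {} \<longleftrightarrow>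
       plain.sat R U dec T' z \<inter> dec w z \<inter> U z \<noteq> {})"
  using assms(2-)
proof (induction arbitrary: K SK rule: plain.wft.induct)
  case (wft_Spot x m)
  then have [simp]: "w = m" "z = x" by auto
  \<comment> \<open>A bare spot is not \<open>root_free\<close>, so the hypotheses make the context
    \<open>K\<close> an edge, and it is the rerooted tree.\<close>
  show ?case by (rule exI[of _ K], rule exI[of _ SK]) (use wft_Spot in auto)
next
  case (wft_Meet x A S B S')
  have ls: "root_free A" "root_free B" "leaf_spots A" "leaf_spots B" using wft_Meet.prems(2) by auto
  show ?case
  proof (cases "(w, z) \<in> S")
    case True
    have nS': "(w, z) \<notin> S'" using True wft_Meet(4) by force
    have wft: "plain.wft C V Sp x (Meet B K) (S' \<union> SK)"
      by (rule plain.wft.wft_Meet) (use wft_Meet in auto)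
    have disj: "fst ` S \<inter> fst ` (S' \<union> SK) = {}" using wft_Meet(4) wft_Meet.prems(7) by blast
    have lk: "leaf_spots (Meet B K)" "root_free (Meet B K)" "root_free A \<or> is_edge (Meet B K)"
      using ls wft_Meet.prems by auto
    from wft_Meet.IH(1)[OF True ls(3) wft lk disj]
    obtain T' S'' where T': "plain.wft C V Sp z T' S''" "S'' = S - {(w, z)} \<union> (S' \<union> SK)" "leaf_spots T'" "is_edge T'"
      "br T' + 1 \<le> max 1 (br A) + max 1 (br (Meet B K))"
      "\<forall>R U (dec :: nat \<Rightarrow> 'x \<Rightarrow> 'd set). plain.sat R U dec A x \<inter> plain.sat R U dec (Meet B K) x \<noteq> {} \<longleftrightarrow>
         plain.sat R U dec T' z \<inter> dec w z \<inter> U z \<noteq> {}"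
      by (elim exE conjE)
    have "1 \<le> br A" using br_pos[OF wft_Meet(2) ls(1)] True by blast
    show ?thesis
    proof (rule exI[of _ T'], rule exI[of _ S''], intro conjI allI)
      show "S'' = S \<union> S' - {(w, z)} \<union> SK" using T'(2) nS' by auto
      show "br T' + 1 \<le> max 1 (br (Meet A B)) + max 1 (br K)" using T'(5) \<open>1 \<le> br A\<close> by simp
      show "plain.sat R U dec (Meet A B) x \<inter> plain.sat R U dec K x \<noteq> {} \<longleftrightarrow> plain.sat R U dec T' z \<inter> dec w z \<inter> U z \<noteq> {}"
        for R U and dec :: "nat \<Rightarrow> 'x \<Rightarrow> 'd set" using T'(6)[rule_format, of R U dec] by (simp add: Int_assoc)
    qed (fact T')+
  next
    case False
    then have True: "(w, z) \<in> S'" using wft_Meet.prems(1) by auto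
    have wft: "plain.wft C V Sp x (Meet A K) (S \<union> SK)"
      by (rule plain.wft.wft_Meet) (use wft_Meet in auto)
    have disj: "fst ` S' \<inter> fst ` (S \<union> SK) = {}" using wft_Meet(4) wft_Meet.prems(7) by blast
    have lk: "leaf_spots (Meet A K)" "root_free (Meet A K)" "root_free B \<or> is_edge (Meet A K)"
      using ls wft_Meet.prems by auto
    from wft_Meet.IH(2)[OF True ls(4) wft lk disj]
    obtain T' S'' where T': "plain.wft C V Sp z T' S''" "S'' = S' - {(w, z)} \<union> (S \<union> SK)" "leaf_spots T'" "is_edge T'"
      "br T' + 1 \<le> max 1 (br B) + max 1 (br (Meet A K))"
      "\<forall>R U (dec :: nat \<Rightarrow> 'x \<Rightarrow> 'd set). plain.sat R U dec B x \<inter> plain.sat R U dec (Meet A K) x \<noteq> {} \<longleftrightarrow>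
         plain.sat R U dec T' z \<inter> dec w z \<inter> U z \<noteq> {}"
      by (elim exE conjE)
    have "1 \<le> br B" using br_pos[OF wft_Meet(3) ls(2)] True by blast
    show ?thesis
    proof (rule exI[of _ T'], rule exI[of _ S''], intro conjI allI)
      show "S'' = S \<union> S' - {(w, z)} \<union> SK" using T'(2) False by auto
      show "br T' + 1 \<le> max 1 (br (Meet A B)) + max 1 (br K)" using T'(5) \<open>1 \<le> br B\<close> by simp
      show "plain.sat R U dec (Meet A B) x \<inter> plain.sat R U dec K x \<noteq> {} \<longleftrightarrow> plain.sat R U dec T' z \<inter> dec w z \<inter> U z \<noteq> {}"
        for R U and dec :: "nat \<Rightarrow> 'x \<Rightarrow> 'd set" using T'(6)[rule_format, of R U dec] by (simp add: Int_assoc Int_left_commute)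
    qed (fact T')+
  qed
next
  case (wft_Edge x c p ts S)
  have q: "cports c - {p} = {1 - p}" "1 - p \<in> cports c" "1 - (1 - p) = p" "cports c - {1 - p} = {p}"
    using wft_Edge(3) by (auto simp: cports_def)
  have qp: "1 - p \<in> cports c - {p}" using q(1) by blast
  have US: "(\<Union>q\<in>cports c - {p}. S q) = S (1 - p)" unfolding q(1) by simp
  let ?K = "Edge c (1 - p) (ts(p := K))"
  have wft: "plain.wft C V Sp (clab c (1 - p)) ?K (\<Union>q\<in>cports c - {1 - p}. (S(p := SK)) q)"
  proof (rule plain.wft.wft_Edge)
    show "clab c (1 - p) \<in> V" using bspec[OF C wft_Edge(2)] by (simp add: clab_def)
    show "plain.wft C V Sp (clab c q) ((ts(p := K)) q) ((S(p := SK)) q)" if "q \<in> cports c - {1 - p}" for q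
      using that wft_Edge.prems(3) wft_Edge(4) unfolding q(4) by simp
  qed (use wft_Edge(2) q in auto)
  then have wft: "plain.wft C V Sp (clab c (1 - p)) ?K SK" unfolding q(4) by simp
  have lk: "leaf_spots (ts (1 - p))" "leaf_spots ?K" "root_free ?K" "root_free (ts (1 - p)) \<or> is_edge ?K"
    using wft_Edge.prems q(3) by auto
  note pr = wft_Edge.prems(1,7)[unfolded US]
  from wft_Edge.IH[OF qp pr(1) lk(1) wft lk(2-4) pr(2)]
  obtain T' S'' where T': "plain.wft C V Sp z T' S''" "S'' = S (1 - p) - {(w, z)} \<union> SK" "leaf_spots T'" "is_edge T'"
      "br T' + 1 \<le> max 1 (br (ts (1 - p))) + max 1 (br ?K)"
      "\<forall>R U (dec :: nat \<Rightarrow> 'x \<Rightarrow> 'd set). plain.sat R U dec (ts (1 - p)) (clab c (1 - p)) \<inter> plain.sat R U dec ?K (clab c (1 - p)) \<noteq> {} \<longleftrightarrow>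
         plain.sat R U dec T' z \<inter> dec w z \<inter> U z \<noteq> {}"
    by (elim exE conjE)
  show ?case
  proof (rule exI[of _ T'], rule exI[of _ S''], unfold US, intro conjI allI)
    show "br T' + 1 \<le> max 1 (br (Edge c p ts)) + max 1 (br K)" using T'(5) q(3) by simp
    show "plain.sat R U dec (Edge c p ts) x \<inter> plain.sat R U dec K x \<noteq> {} \<longleftrightarrow> plain.sat R U dec T' z \<inter> dec w z \<inter> U z \<noteq> {}"
      for R U and dec :: "nat \<Rightarrow> 'x \<Rightarrow> 'd set"
      using edge_turn[OF wft_Edge(3), of R U dec ts K] T'(6) unfolding wft_Edge(4) by blast
  qed (fact T')+
qed auto

text \<open>Lets a tree that serves as a hyperedge be entered at any port. The former root must keep
  a prescribed value, so it becomes \<open>Spot 0\<close> before the tree is rerooted at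
  \<open>w\<close>.\<close>

lemma port_tree:
  fixes C :: "('x, 'd) bin_constraint set"
  assumes C: "\<forall>c\<in>C. fst (fst c) \<in> V \<and> snd (fst c) \<in> V"
    and T: "plain.wft C V Sp x T S" "is_edge T" "leaf_spots T" and x: "x \<in> Sp" and S0: "0 \<notin> fst ` S"
    and w: "(w, z) \<in> insert (0, x) S"
  shows "\<exists>T' S'. plain.wft C V Sp z T' S' \<and> S' = insert (0, x) S - {(w, z)} \<and> leaf_spots T' \<and> is_edge T' \<and>
    br T' \<le> br T \<and> (\<forall>U (t :: nat \<Rightarrow> 'd). t 0 \<in> plain.sat crel U (\<lambda>m z. {t m}) T x \<longleftrightarrow>
       t w \<in> plain.sat crel U (\<lambda>m z. {t m}) T' z)"
proof (cases "(w, z) \<in> S")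
  case False
  then have "w = 0" "z = x" "insert (0, x) S - {(w, z)} = S" using w S0 by force+
  then show ?thesis using T by (intro exI[of _ T] exI[of _ S]) auto
next
  case True
  have w0: "w \<noteq> 0" using True S0 by force
  obtain c p ts where Te: "T = Edge c p ts" using T(2) by (cases T) auto
  from T(1)[unfolded Te] obtain Sq where c: "c \<in> C" "p \<in> cports c" "clab c p = x" "x \<in> V"
    and ts: "\<And>q. q \<in> cports c - {p} \<Longrightarrow> plain.wft C V Sp (clab c q) (ts q) (Sq q)" and S: "S = (\<Union>q\<in>cports c - {p}. Sq q)"
    by (cases rule: plain.wft.cases) auto
  have q: "cports c - {p} = {1 - p}" "1 - p \<in> cports c" "1 - (1 - p) = p" "cports c - {1 - p} = {p}"
    using c(2) by (auto simp: cports_def)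
  have S': "S = Sq (1 - p)" unfolding S q(1) by simp
  have wts: "plain.wft C V Sp (clab c (1 - p)) (ts (1 - p)) S" using ts[of "1 - p"] unfolding S' q(1) by simp
  let ?K = "Edge c (1 - p) (ts(p := Spot 0))"
  have "plain.wft C V Sp (clab c (1 - p)) ?K (\<Union>q\<in>cports c - {1 - p}. {(0, clab c q)})"
  proof (rule plain.wft.wft_Edge)
    show "clab c (1 - p) \<in> V" using bspec[OF C c(1)] by (simp add: clab_def)
    show "plain.wft C V Sp (clab c q) ((ts(p := Spot 0)) q) {(0, clab c q)}" if "q \<in> cports c - {1 - p}" for q
      using that x c(3) unfolding q(4) by (auto intro: plain.wft.wft_Spot)
  qed (use c q in auto)
  then have wK: "plain.wft C V Sp (clab c (1 - p)) ?K {(0, x)}" unfolding q(4) by (simp add: c(3))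
  have ls: "leaf_spots (ts (1 - p))" "leaf_spots ?K" "root_free ?K" "root_free (ts (1 - p)) \<or> is_edge ?K"
     "fst ` S \<inter> fst ` {(0, x)} = {}"
    using T(3) q(3) S0 unfolding Te by auto
  from plain_reroot[OF C wts True ls(1) wK ls(2-5)]
  obtain T' S'' where T': "plain.wft C V Sp z T' S''" "S'' = S - {(w, z)} \<union> {(0, x)}" "leaf_spots T'" "is_edge T'"
      "br T' + 1 \<le> max 1 (br (ts (1 - p))) + max 1 (br ?K)"
      "\<forall>R U (dec :: nat \<Rightarrow> 'x \<Rightarrow> 'd set). plain.sat R U dec (ts (1 - p)) (clab c (1 - p)) \<inter> plain.sat R U dec ?K (clab c (1 - p)) \<noteq> {} \<longleftrightarrow>
         plain.sat R U dec T' z \<inter> dec w z \<inter> U z \<noteq> {}"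
    by (elim exE conjE)
  show ?thesis
  proof (intro exI[of _ T'] exI[of _ S''] conjI allI)
    show "S'' = insert (0, x) S - {(w, z)}" using T'(2) w0 by auto
    show "br T' \<le> br T" using T'(5) q(3) unfolding Te by simp
    fix U and t :: "nat \<Rightarrow> 'd"
    let ?dec = "\<lambda>m z. {t m}"
    have "t 0 \<in> plain.sat crel U ?dec T x \<longleftrightarrow> plain.sat crel U ?dec T x \<inter> plain.sat crel U ?dec (Spot 0) x \<noteq> {}"
      using plain.sat_subset[of crel U ?dec T x] by auto
    also have "\<dots> \<longleftrightarrow> plain.sat crel U ?dec T' z \<inter> {t w} \<inter> U z \<noteq> {}"
      using edge_turn[OF c(2), of crel U ?dec ts "Spot 0"] T'(6)[rule_format, of crel U ?dec] unfolding Te c(3) by (simp only:)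
    also have "\<dots> \<longleftrightarrow> t w \<in> plain.sat crel U ?dec T' z" using plain.sat_subset[of crel U ?dec T' z] by auto
    finally show "t 0 \<in> plain.sat crel U ?dec T x \<longleftrightarrow> t w \<in> plain.sat crel U ?dec T' z" .
  qed (fact T')+
qed

text \<open>A tree of constraints is used as a hyperedge \<open>(x, T, S)\<close>: port \<open>0\<close> is the root, labelled \<open>x\<close>, and the
  other ports are the spots of \<open>T\<close>, listed with their labels in \<open>S\<close>.\<close>

definition hlab :: "'x \<times> 'h gtree \<times> (nat \<times> 'x) set \<Rightarrow> nat \<Rightarrow> 'x" where
  "hlab h m = (if m = 0 then fst h else (THE z. (m, z) \<in> snd (snd h)))"

definition hports :: "'x \<times> 'h gtree \<times> (nat \<times> 'x) set \<Rightarrow> nat set" where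
  "hports h = insert 0 (fst ` snd (snd h))"

definition hrel :: "('x \<Rightarrow> 'd set) \<Rightarrow> 'x \<times> ('x, 'd) bin_constraint gtree \<times> (nat \<times> 'x) set \<Rightarrow> (nat \<Rightarrow> 'd) set" where
  "hrel U h = {t. t 0 \<in> plain.sat crel U (\<lambda>m z. {t m}) (fst (snd h)) (fst h)}"

interpretation full: hyperedges hports hlab .

lemma hlab_eq:
  assumes "inj_on fst S" "0 \<notin> fst ` S" "(m, z) \<in> insert (0, x) S" shows "hlab (x, T, S) m = z"
proof (cases "(m, z) \<in> S")
  case True
  then have "m \<noteq> 0" using assms(2) by force
  moreover have "(THE z. (m, z) \<in> S) = z" 
  proof (rule the_equality)
    show "z' = z" if "(m, z') \<in> S" for z' using inj_onD[OF assms(1) _ that True] by simp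
  qed (fact True)
  ultimately show ?thesis by (simp add: hlab_def)
next
  case False
  then show ?thesis using assms(3) by (simp add: hlab_def)
qed

section \<open>Closed level sets and trees with few leaves\<close>

locale nu_csp =
  fixes D :: "'d set" and V :: "'x set" and C :: "('x, 'd) bin_constraint set" and n :: nat
    and F :: "(nat \<Rightarrow> 'd) \<Rightarrow> 'd" and Es :: "nat \<Rightarrow> 'x \<Rightarrow> 'd set"
  assumes fin_V: "finite V" and fin_D: "finite D" and n_ge: "2 \<le> n"
    and C_V: "\<forall>c\<in>C. fst (fst c) \<in> V \<and> snd (fst c) \<in> V"
    and F_cong: "(\<And>i. i < Suc n \<Longrightarrow> u i = v i) \<Longrightarrow> F u = F v"
    and F_C: "c \<in> C \<Longrightarrow> (\<And>i. i < Suc n \<Longrightarrow> t i \<in> crel c) \<Longrightarrow> (\<lambda>p. F (\<lambda>i. t i p)) \<in> crel c"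
    and F_nu: "(\<And>i. i < Suc n \<Longrightarrow> v i \<in> D) \<Longrightarrow> a \<in> D \<Longrightarrow> card {i. i < Suc n \<and> v i \<noteq> a} \<le> 1 \<Longrightarrow> F v = a"
    and Es_D: "Es l x \<subseteq> D" and Es_F: "(\<And>i. i < Suc n \<Longrightarrow> v i \<in> Es l x) \<Longrightarrow> F v \<in> Es l x"
    and Es_nonempty: "x \<in> V \<Longrightarrow> l \<in> {1..card D + 1} \<Longrightarrow> Es l x \<noteq> {}"
    and Es_mono: "l \<in> {1..card D} \<Longrightarrow> Es l x \<subseteq> Es (l + 1) x"
    and Es_top: "x \<in> V \<Longrightarrow> Es (card D + 1) x = D"
    and returns: "l \<in> {1..card D} \<Longrightarrow> x \<in> V \<Longrightarrow> a \<in> Es l x \<Longrightarrow> tree_path V C n x ps x \<Longrightarrow> ps \<noteq> [] \<Longrightarrow>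
      tree_path V C n x qs x \<Longrightarrow> qs \<noteq> [] \<Longrightarrow>
      \<exists>j. (a, a) \<in> (prls (Es (l + 1)) ps O prls (Es (l + 1)) qs) ^^ j O prls (Es (l + 1)) ps"
begin

text \<open>Take the root as beginning and as end of the pattern. A return of \<open>a\<close>
  starts with a realization of the tree whose root has the value \<open>a\<close>, so the return
  condition contains an extension property. At a \<open>Meet\<close> the branches extend
  separately.\<close>

lemma extend:
  assumes l: "l \<in> {1..card D}"
    and "plain.wft C V Sp x T S" "leaf_spots T" "Suc (br T) \<le> n" "x \<in> V" "a \<in> Es l x"
  shows "a \<in> plain.sat crel (Es (l + 1)) (\<lambda>m z. UNIV) T x"
  using assms(2-)
proof (induction rule: plain.wft.induct)
  case (wft_Edge x c p ts S)
  let ?T = "Edge c p ts" and ?U = "Es (l + 1)"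
  have wft: "plain.wft C V Sp x ?T (\<Union>q\<in>cports c - {p}. S q)"
    by (rule plain.wft.wft_Edge) (use wft_Edge in blast)+
  define T' where "T' = rename_spots Suc ?T"
  define S' where "S' = map_prod Suc id ` (\<Union>q\<in>cports c - {p}. S q)"
  have wft': "plain.wft C V Sp x T' S'" unfolding T'_def S'_def by (rule plain.wft_rename[OF wft]) simp
  have "0 \<notin> fst ` S'" unfolding S'_def by auto
  moreover have "leaf_spots T'" "root_free T'" "dg T' = 1" "Suc (br T') \<le> n"
    unfolding T'_def rename_shape using wft_Edge.prems by auto
  ultimately obtain p where p: "n_tree_pattern V C n p" "vlabel p (beginning p) = x" "vlabel p (ending p) = x"
    "\<forall>U. prl U p \<subseteq> {(t 0, t 0) |t. t 0 \<in> plain.sat crel U (\<lambda>m z. {t m}) T' x}"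
    using tree_pattern[OF wft', of n V 0 x 0 x] wft_Edge.prems(3) C_V by blast
  have path: "tree_path V C n x [p] x" using p(1-3) by simp
  obtain j where j: "(a, a) \<in> (prls ?U [p] O prls ?U [p]) ^^ j O prls ?U [p]"
    using returns[OF l wft_Edge.prems(3,4) path _ path] by blast
  have "\<exists>b. (a, b) \<in> prl ?U p"
  proof (cases j)
    case 0
    then show ?thesis using j by auto
  next
    case (Suc j')
    then show ?thesis using j by (fastforce elim: relpow_E2)
  qed
  then obtain t where t: "a = t 0" "t 0 \<in> plain.sat crel ?U (\<lambda>m z. {t m}) T' x" using p(4) by blast
  have "plain.sat crel ?U (\<lambda>m z. {t m}) T' x \<subseteq> plain.sat crel ?U (\<lambda>m z. UNIV) T' x"
    by (rule plain.sat_mono[OF wft']) auto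
  then show ?case using t unfolding T'_def plain.sat_rename by blast
next
  case (wft_Meet x A S B S')
  then show ?case by simp
qed (use Es_mono[OF l] in auto)

definition hedges :: "'x set \<Rightarrow> ('x \<times> ('x, 'd) bin_constraint gtree \<times> (nat \<times> 'x) set) set" where
  "hedges Sp = {(x, T, S). x \<in> Sp \<and> plain.wft C V Sp x T S \<and> is_edge T \<and> leaf_spots T \<and> Suc (br T) \<le> n \<and> 0 \<notin> fst ` S}"

lemma hedge_ports:
  assumes "h \<in> hedges Sp"
  shows "finite (hports h)" "p \<in> hports h \<Longrightarrow> hlab h p \<in> Sp"
    "insert (0, fst h) (snd (snd h)) = (\<lambda>m. (m, hlab h m)) ` hports h"
proof -
  obtain x T S where h: "h = (x, T, S)" by (cases h)
  have T: "x \<in> Sp" "plain.wft C V Sp x T S" "0 \<notin> fst ` S" using assms unfolding h hedges_def by auto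
  have "finite S" by (rule plain.wft_finite[OF _ T(2)]) (simp add: cports_def)
  then show "finite (hports h)" by (simp add: h hports_def)
  note lab = hlab_eq[OF plain.wft_inj_fst[OF T(2)] T(3), where T = T]
  show "insert (0, fst h) (snd (snd h)) = (\<lambda>m. (m, hlab h m)) ` hports h"
  proof -
    have "(fst mz, hlab h (fst mz)) = mz" if "mz \<in> insert (0, x) S" for mz
      using lab[of "fst mz" "snd mz"] that unfolding h by simp
    then have "(\<lambda>mz. (fst mz, hlab h (fst mz))) ` insert (0, x) S = (\<lambda>mz. mz) ` insert (0, x) S"
      by (intro image_cong refl)
    moreover have "(\<lambda>m. (m, hlab h m)) ` hports h = (\<lambda>mz. (fst mz, hlab h (fst mz))) ` insert (0, x) S"
      by (simp add: h hports_def image_image)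
    ultimately show ?thesis by (simp add: h)
  qed
  then have "(p, hlab h p) \<in> insert (0, x) S" if "p \<in> hports h" for p
    using that imageI[of p "hports h" "\<lambda>m. (m, hlab h m)"] by (simp add: h)
  then show "p \<in> hports h \<Longrightarrow> hlab h p \<in> Sp" using T(1) plain.wft_spot_label[OF T(2)] by blast
qed

lemma hedge_port:
  assumes h: "h \<in> hedges Sp" and w: "w \<in> hports h"
  shows "\<exists>T'. plain.wft C V Sp (hlab h w) T' ((\<lambda>m. (m, hlab h m)) ` (hports h - {w})) \<and> leaf_spots T' \<and> is_edge T' \<and>
    Suc (br T') \<le> n \<and> (\<forall>U t. t \<in> hrel U h \<longleftrightarrow> t w \<in> plain.sat crel U (\<lambda>m z. {t m}) T' (hlab h w))"
proof -
  obtain x T S where e: "h = (x, T, S)" by (cases h)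
  have T: "plain.wft C V Sp x T S" "is_edge T" "leaf_spots T" "x \<in> Sp" "0 \<notin> fst ` S" "Suc (br T) \<le> n"
    using h unfolding e hedges_def by auto
  note ports = hedge_ports(3)[OF h, unfolded e fst_conv snd_conv, folded e]
  have "(w, hlab h w) \<in> insert (0, x) S" unfolding ports using w by blast
  from port_tree[OF C_V T(1-5) this]
  obtain T' S' where T': "plain.wft C V Sp (hlab h w) T' S'" "S' = insert (0, x) S - {(w, hlab h w)}" "leaf_spots T'" "is_edge T'"
    "br T' \<le> br T" "\<forall>U (t :: nat \<Rightarrow> 'd). t 0 \<in> plain.sat crel U (\<lambda>m z. {t m}) T x \<longleftrightarrow> t w \<in> plain.sat crel U (\<lambda>m z. {t m}) T' (hlab h w)"
    by (elim exE conjE)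
  have "S' = (\<lambda>m. (m, hlab h m)) ` (hports h - {w})" unfolding T'(2) ports by auto
  then show ?thesis using T' T(6) by (intro exI[of _ T']) (simp add: hrel_def e)
qed

lemma hrel_in: "h \<in> hedges Sp \<Longrightarrow> t \<in> hrel U h \<Longrightarrow> p \<in> hports h \<Longrightarrow> t p \<in> U (hlab h p)"
proof -
  assume h: "h \<in> hedges Sp" "t \<in> hrel U h" "p \<in> hports h"
  from hedge_port[OF h(1,3)] obtain T' where "t p \<in> plain.sat crel U (\<lambda>m z. {t m}) T' (hlab h p)" using h(2) by blast
  then show "t p \<in> U (hlab h p)" using plain.sat_subset by (rule rev_subsetD)
qed

lemma hrel_apply:
  assumes "h \<in> hedges Sp" "\<And>i. i < Suc n \<Longrightarrow> t i \<in> hrel (Es l) h"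
  shows "(\<lambda>p. F (\<lambda>i. t i p)) \<in> hrel (Es l) h"
proof -
  obtain x T S where e: "h = (x, T, S)" by (cases h)
  have T: "plain.wft C V Sp x T S" using assms(1) unfolding e hedges_def by auto
  have "F (\<lambda>i. t i 0) \<in> plain.sat crel (Es l) (\<lambda>m z. {F (\<lambda>i. t i m)}) T x"
  proof (rule plain.sat_apply[where F = F and N = "Suc n" and v = "\<lambda>i. t i 0" and dec = "\<lambda>i m z. {t i m}"
      and R = "\<lambda>_. crel" and U = "\<lambda>_. Es l", OF T])
    show "F v \<in> {F (\<lambda>i. t i m)}" if "\<And>i. i < Suc n \<Longrightarrow> v i \<in> {t i m} \<inter> Es l z" for m z v
      using F_cong[of v "\<lambda>i. t i m"] that by simp
  qed (use F_C Es_F assms(2) in \<open>auto simp: hrel_def e\<close>)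
  then show ?thesis by (simp add: hrel_def e)
qed

text \<open>Reroot at the port and apply \<open>extend\<close>. One level is lost: the value comes
  from level \<open>l\<close>, the tuple lives in level \<open>l + 1\<close>.\<close>

lemma hrel_extend:
  assumes l: "l \<in> {1..card D}" and h: "h \<in> hedges Sp" and Sp: "Sp \<subseteq> V" and p: "p \<in> hports h" and a: "a \<in> Es l (hlab h p)"
  shows "\<exists>t\<in>hrel (Es (l + 1)) h. t p = a"
proof -
  obtain T' where T': "plain.wft C V Sp (hlab h p) T' ((\<lambda>m. (m, hlab h m)) ` (hports h - {p}))" "leaf_spots T'"
    "Suc (br T') \<le> n" "\<forall>U t. t \<in> hrel U h \<longleftrightarrow> t p \<in> plain.sat crel U (\<lambda>m z. {t m}) T' (hlab h p)"
    using hedge_port[OF h p] by (elim exE conjE)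
  have "hlab h p \<in> V" using hedge_ports(2)[OF h p] Sp by blast
  from plain.sat_singletons[OF T'(1) extend[OF l T'(1-3) this a]]
  obtain g where g: "a \<in> plain.sat crel (Es (l + 1)) (\<lambda>m z. {g m}) T' (hlab h p)" by blast
  have "plain.sat crel (Es (l + 1)) (\<lambda>m z. {g m}) T' (hlab h p) = plain.sat crel (Es (l + 1)) (\<lambda>m z. {(g(p := a)) m}) T' (hlab h p)"
    by (rule plain.sat_cong[OF T'(1)]) auto
  then have "g(p := a) \<in> hrel (Es (l + 1)) h" unfolding T'(4)[rule_format] using g by simp
  then show ?thesis by (intro bexI[of _ "g(p := a)"]) auto
qed

text \<open>All ports are leaves of one tree, so passing from port to port is an
  \<open>n\<close>-tree pattern; paths through hyperedges thereby become paths of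
  \<open>n\<close>-trees, to which the return condition applies.\<close>

lemma hedge_pattern:
  assumes h: "h \<in> hedges Sp" and Sp: "Sp \<subseteq> V" and ab: "a \<in> hports h" "b \<in> hports h"
  shows "\<exists>p. n_tree_pattern V C n p \<and> vlabel p (beginning p) = hlab h a \<and> vlabel p (ending p) = hlab h b \<and>
    (\<forall>U. prl U p \<subseteq> {(t a, t b) |t. t \<in> hrel U h})"
proof -
  obtain x T S where e: "h = (x, T, S)" by (cases h)
  have T: "plain.wft C V Sp x T S" "leaf_spots T" "root_free T" "dg T = 1" "Suc (br T) \<le> n" "x \<in> V" "0 \<notin> fst ` S"
    using h Sp is_edge_root_free is_edge_dg unfolding e hedges_def by auto
  have ports: "insert (0, x) S = (\<lambda>m. (m, hlab h m)) ` hports h" using hedge_ports(3)[OF h] by (simp add: e)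
  have "(a, hlab h a) \<in> insert (0, x) S" "(b, hlab h b) \<in> insert (0, x) S" unfolding ports using ab by blast+
  from tree_pattern[OF T(1-6) _ T(7) this] C_V show ?thesis by (simp add: hrel_def e)
qed

end

context nu_csp
begin

text \<open>The prescription ignores the spot number: all leaves labelled by the same assigned
  variable receive the same value.\<close>

definition good :: "nat \<Rightarrow> 'x set \<Rightarrow> ('x \<Rightarrow> 'd) \<Rightarrow> bool" where
  "good l A s \<longleftrightarrow> (\<forall>x\<in>A. s x \<in> Es l x) \<and>
     (\<forall>x T S. x \<in> A \<longrightarrow> plain.wft C V A x T S \<longrightarrow> is_edge T \<longrightarrow> leaf_spots T \<longrightarrow> Suc (br T) \<le> n \<longrightarrow>
        s x \<in> plain.sat crel (Es l) (\<lambda>m z. {s z}) T x)"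

end

section \<open>Assigning the variables of one level\<close>

locale stage = nu_csp D V C n F Es
  for D :: "'d set" and V :: "'x set" and C n F Es +
  fixes l :: nat and A :: "'x set" and s :: "'x \<Rightarrow> 'd"
  assumes l: "l \<in> {1..card D}" and A_V: "A \<subseteq> V" and good: "good l A s"
begin

abbreviation U :: "'x \<Rightarrow> 'd set" where
  "U \<equiv> Es (l + 1)"

text \<open>Here the levels \<open>l\<close> and \<open>l + 1\<close> agree, so every value of the
  working domain \<open>U\<close> is subject to the return condition.\<close>

definition X :: "'x set" where
  "X = {x \<in> V. Es l x = U x} - A"

abbreviation H :: "('x \<times> ('x, 'd) bin_constraint gtree \<times> (nat \<times> 'x) set) set" where
  "H \<equiv> hedges (A \<union> X)"

abbreviation psat :: "('x, 'd) bin_constraint gtree \<Rightarrow> 'x \<Rightarrow> 'd set" where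
  "psat \<equiv> plain.sat crel (Es l) (\<lambda>m z. {s z})"

definition on :: "nat set \<Rightarrow> nat \<Rightarrow> 'x \<Rightarrow> 'd set" where
  "on Z m z = (if m \<in> Z then {s z} else UNIV)"

abbreviation hsat :: "nat set \<Rightarrow> ('x \<times> ('x, 'd) bin_constraint gtree \<times> (nat \<times> 'x) set) gtree \<Rightarrow> 'x \<Rightarrow> 'd set" where
  "hsat Z \<equiv> full.sat (hrel U) U (on Z)"

lemma X_V: "X \<subseteq> V" and AX_V: "A \<union> X \<subseteq> V" and X_eq: "x \<in> X \<Longrightarrow> Es l x = U x" and X_A: "x \<in> X \<Longrightarrow> x \<notin> A"
  and Es_U: "Es l x \<subseteq> U x"
  using A_V Es_mono[OF l] unfolding X_def by auto

lemma s_in: "x \<in> A \<Longrightarrow> s x \<in> Es l x" and s_U: "x \<in> A \<Longrightarrow> s x \<in> U x"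
  using good Es_U unfolding good_def by blast+

lemma F_s:
  assumes "z \<in> A" "\<And>i. i < Suc n \<Longrightarrow> v i \<in> U z" "\<And>i. i < Suc n \<Longrightarrow> i \<noteq> i0 \<Longrightarrow> v i = s z"
  shows "F v = s z"
proof (rule F_nu)
  have "{i. i < Suc n \<and> v i \<noteq> s z} \<subseteq> {i0}" using assms(3) by blast
  then show "card {i. i < Suc n \<and> v i \<noteq> s z} \<le> 1" by (rule card_le_1)
qed (use assms(1,2) Es_D s_U in blast)+

text \<open>Branches without a port in \<open>W\<close> can be dropped because \<open>extend\<close> realizes them afterwards.\<close>

lemma prune:
  assumes "plain.wft C V Sp x T S" "leaf_spots T" "Suc (br T) \<le> n" "x \<in> V"
    and off: "\<forall>(m, z)\<in>S. m \<notin> W \<longrightarrow> U z \<subseteq> Y m"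
    and onW: "\<forall>(m, z)\<in>S. m \<in> W \<longrightarrow>
       1 \<le> cnt m \<and> (\<exists>P S'. plain.wft C V A z P S' \<and> leaf_spots P \<and> br P \<le> cnt m \<and> psat P z \<subseteq> Y m)"
  shows "\<exists>P S'. plain.wft C V A x P S' \<and> leaf_spots P \<and> br P \<le> (\<Sum>m\<in>W \<inter> fst ` S. cnt m) \<and>
    (root_free T \<longrightarrow> root_free P) \<and> (is_edge T \<longrightarrow> is_edge P \<or> P = Free) \<and>
    psat P x \<subseteq> plain.sat crel U (\<lambda>m z. Y m) T x"
  using assms
proof (induction rule: plain.wft.induct)
  case (wft_Free x)
  show ?case by (rule exI[of _ Free], rule exI[of _ "{}"]) (use Es_U in \<open>auto intro: plain.wft.intros\<close>)
next
  case (wft_Spot x m)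
  show ?case
  proof (cases "m \<in> W")
    case True
    from wft_Spot.prems(5) True
    obtain P S' where P: "plain.wft C V A x P S'" "leaf_spots P" "br P \<le> cnt m" "psat P x \<subseteq> Y m" by auto
    have "psat P x \<subseteq> U x" using plain.sat_subset Es_U by (rule subset_trans)
    then show ?thesis using P True by (intro exI[of _ P] exI[of _ S']) simp
  next
    case False
    then have "U x \<subseteq> Y m" using wft_Spot.prems(4) by simp
    then have "Es l x \<subseteq> Y m \<inter> U x" using Es_U[of x] by blast
    then show ?thesis by (intro exI[of _ Free] exI[of _ "{}"]) (simp add: plain.wft.wft_Free)
  qed
next
  case (wft_Meet x T1 S1 T2 S2)
  have ls: "leaf_spots T1" "leaf_spots T2" "root_free T1" "root_free T2" "Suc (br T1) \<le> n" "Suc (br T2) \<le> n"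
    using wft_Meet.prems(1,2) by auto
  obtain P1 S1' where P1: "plain.wft C V A x P1 S1'" "leaf_spots P1" "br P1 \<le> (\<Sum>m\<in>W \<inter> fst ` S1. cnt m)"
    "root_free T1 \<longrightarrow> root_free P1" "psat P1 x \<subseteq> plain.sat crel U (\<lambda>m z. Y m) T1 x"
    using wft_Meet.IH(1)[OF ls(1,5) wft_Meet.prems(3) conjunct1[OF wft_Meet.prems(4)[unfolded ball_Un]]
      conjunct1[OF wft_Meet.prems(5)[unfolded ball_Un]]] by (elim exE conjE)
  obtain P2 S2' where P2: "plain.wft C V A x P2 S2'" "leaf_spots P2" "br P2 \<le> (\<Sum>m\<in>W \<inter> fst ` S2. cnt m)"
    "root_free T2 \<longrightarrow> root_free P2" "psat P2 x \<subseteq> plain.sat crel U (\<lambda>m z. Y m) T2 x"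
    using wft_Meet.IH(2)[OF ls(2,6) wft_Meet.prems(3) conjunct2[OF wft_Meet.prems(4)[unfolded ball_Un]]
      conjunct2[OF wft_Meet.prems(5)[unfolded ball_Un]]] by (elim exE conjE)
  let ?P = "Meet (rename_spots (\<lambda>m. 2 * m) P1) (rename_spots (\<lambda>m. 2 * m + 1) P2)"
  have wft: "plain.wft C V A x ?P (map_prod (\<lambda>m. 2 * m) id ` S1' \<union> map_prod (\<lambda>m. 2 * m + 1) id ` S2')"
  proof (rule plain.wft_Meet[OF wft_Meet(1) plain.wft_rename[OF P1(1)] plain.wft_rename[OF P2(1)]])
    show "inj (\<lambda>m :: nat. 2 * m)" "inj (\<lambda>m :: nat. 2 * m + 1)" by (auto intro: injI)
    show "fst ` map_prod (\<lambda>m. 2 * m) id ` S1' \<inter> fst ` map_prod (\<lambda>m :: nat. 2 * m + 1) id ` S2' = {}"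
      by (auto) presburger
  qed
  have fin: "finite S1" "finite S2" using plain.wft_finite wft_Meet(2,3) by (auto simp: cports_def)
  have "(\<Sum>m\<in>W \<inter> fst ` (S1 \<union> S2). cnt m) = (\<Sum>m\<in>W \<inter> fst ` S1. cnt m) + (\<Sum>m\<in>W \<inter> fst ` S2. cnt m)"
    unfolding image_Un Int_Un_distrib using fin wft_Meet(4) by (intro sum.union_disjoint) auto
  then have "br ?P \<le> (\<Sum>m\<in>W \<inter> fst ` (S1 \<union> S2). cnt m)" using P1(3) P2(3) by simp
  moreover have "psat ?P x \<subseteq> plain.sat crel U (\<lambda>m z. Y m) (Meet T1 T2) x"
    using P1(5) P2(5) unfolding plain.sat.simps plain.sat_rename by blast
  moreover have "leaf_spots ?P" "root_free ?P" using P1 P2 ls by simp_all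
  ultimately show ?case using wft by (intro exI[of _ ?P]) auto
next
  case (wft_Edge x c p ts S)
  have q: "cports c - {p} = {1 - p}" using wft_Edge(3) by (auto simp: cports_def)
  have US: "(\<Union>q\<in>cports c - {p}. S q) = S (1 - p)" unfolding q by simp
  have wft: "plain.wft C V Sp x (Edge c p ts) (S (1 - p))"
    unfolding US[symmetric] by (rule plain.wft.wft_Edge) (use wft_Edge in blast)+
  show ?case
  proof (cases "W \<inter> fst ` S (1 - p) = {}")
    case True
    have "Es l x \<subseteq> plain.sat crel U (\<lambda>m z. UNIV) (Edge c p ts) x"
      using extend[OF l wft wft_Edge.prems(1-3)] by blast
    also have "\<dots> \<subseteq> plain.sat crel U (\<lambda>m z. Y m) (Edge c p ts) x"
    proof (rule plain.sat_mono[OF wft])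
      fix m z assume mz: "(m, z) \<in> S (1 - p)"
      then have "m \<notin> W" using True by force
      then show "UNIV \<inter> U z \<subseteq> Y m" using bspec[OF wft_Edge.prems(4)[unfolded US] mz] by simp
    qed auto
    finally show ?thesis by (intro exI[of _ Free] exI[of _ "{}"]) (simp add: plain.wft.wft_Free)
  next
    case False
    have pre: "1 - p \<in> cports c - {p}" "leaf_spots (ts (1 - p))" "Suc (br (ts (1 - p))) \<le> n" "clab c (1 - p) \<in> V"
      using q wft_Edge.prems(1,2) bspec[OF C_V wft_Edge(2)] by (auto simp: clab_def)
    obtain P S' where P: "plain.wft C V A (clab c (1 - p)) P S'" "leaf_spots P" "br P \<le> (\<Sum>m\<in>W \<inter> fst ` S (1 - p). cnt m)"
      "psat P (clab c (1 - p)) \<subseteq> plain.sat crel U (\<lambda>m z. Y m) (ts (1 - p)) (clab c (1 - p))"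
      using wft_Edge.IH[OF pre wft_Edge.prems(4,5)[unfolded US]] by (elim exE conjE)
    let ?P = "Edge c p (\<lambda>_. P)"
    have "plain.wft C V A x ?P (\<Union>q\<in>cports c - {p}. S')"
      by (rule plain.wft.wft_Edge) (use wft_Edge P(1) q in auto)
    moreover have "br ?P \<le> (\<Sum>m\<in>W \<inter> fst ` S (1 - p). cnt m)"
    proof -
      \<comment> \<open>An edge counts as one leaf even if nothing hangs below it; a spot of
        \<open>W\<close> below it pays for that, as \<open>1 \<le> cnt m\<close>.\<close>
      obtain m z where m: "(m, z) \<in> S (1 - p)" "m \<in> W" using False by auto
      have "finite (S (1 - p))" using plain.wft_finite[OF _ wft] by (simp add: cports_def)
      then have "cnt m \<le> (\<Sum>m\<in>W \<inter> fst ` S (1 - p). cnt m)" using m by (intro member_le_sum) force+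
      moreover have "1 \<le> cnt m" using bspec[OF wft_Edge.prems(5)[unfolded US] m(1)] m(2) by simp
      ultimately show ?thesis using P(3) by simp
    qed
    moreover have "psat ?P x \<subseteq> plain.sat crel U (\<lambda>m z. Y m) (Edge c p ts) x"
      using P(4) Es_U[of x] unfolding subset_iff sat_Edge[OF wft_Edge(3)] by blast
    ultimately show ?thesis using P(2) unfolding US by (intro exI[of _ ?P]) auto
  qed
qed

lemma full_ac:
  assumes "h \<in> H" "p \<in> hports h" "hlab h p \<in> X" "a \<in> U (hlab h p)"
  shows "\<exists>t\<in>hrel U h. t p = a \<and> (\<forall>q\<in>hports h. t q \<in> U (hlab h q))"
proof -
  obtain t where "t \<in> hrel U h" "t p = a"
    using hrel_extend[OF l assms(1) AX_V assms(2), of a] assms(4) unfolding X_eq[OF assms(3)] by blast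
  then show ?thesis using hrel_in[OF assms(1)] by blast
qed

lemma hsat_off: "full.wft H X A x T S \<Longrightarrow> Z \<inter> fst ` S = {} \<Longrightarrow> hsat Z T x = U x"
proof (rule full.sat_full)
  fix m z assume "Z \<inter> fst ` S = {}" "(m, z) \<in> S"
  then have "m \<notin> Z" by force
  then show "U z \<subseteq> on Z m z" by (simp add: on_def)
qed (use full_ac in auto)

text \<open>\<open>P\<close> is a tree of constraints that contains what \<open>T\<close> needs to reach the spots in \<open>Z\<close>.\<close>

definition converts :: "nat set \<Rightarrow> 'x \<Rightarrow> ('x \<times> ('x, 'd) bin_constraint gtree \<times> (nat \<times> 'x) set) gtree \<Rightarrow>
    (nat \<times> 'x) set \<Rightarrow> ('x, 'd) bin_constraint gtree \<Rightarrow> bool" where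
  "converts Z x T S P \<longleftrightarrow> (\<exists>S'. plain.wft C V A x P S') \<and> leaf_spots P \<and> br P \<le> card (Z \<inter> fst ` S) \<and>
     psat P x \<subseteq> hsat Z T x"

text \<open>Seen from \<open>p\<close>, the hyperedge is a tree of constraints. Drop its branches
  that lead to no spot in \<open>Z\<close> and plug the trees of the remaining ports into their
  leaves. The surviving leaves are charged to spots in \<open>Z\<close>, which are disjoint for
  different ports.\<close>

lemma converts_edge:
  assumes h: "h \<in> H" "p \<in> hports h"
    and ts: "\<And>q. q \<in> hports h - {p} \<Longrightarrow> full.wft H X A (hlab h q) (ts q) (S q)"
    and disj: "\<And>q q'. q \<in> hports h - {p} \<Longrightarrow> q' \<in> hports h - {p} \<Longrightarrow> q \<noteq> q' \<Longrightarrow> fst ` S q \<inter> fst ` S q' = {}"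
    and IH: "\<And>q. q \<in> hports h - {p} \<Longrightarrow> \<exists>P. converts Z (hlab h q) (ts q) (S q) P"
  shows "\<exists>P. converts Z (hlab h p) (Edge h p ts) (\<Union>q\<in>hports h - {p}. S q) P \<and> (is_edge P \<or> P = Free)"
proof -
  define W where "W = {m. Z \<inter> fst ` S m \<noteq> {}}"
  define Y where "Y m = hsat Z (ts m) (hlab h m)" for m
  define cnt where "cnt m = card (Z \<inter> fst ` S m)" for m
  note finp = hedge_ports(1)[OF h(1)]
  have finS: "finite (S q)" if "q \<in> hports h - {p}" for q
    using full.wft_finite[OF _ ts[OF that]] hedge_ports(1) by blast
  obtain T' where T': "plain.wft C V (A \<union> X) (hlab h p) T' ((\<lambda>m. (m, hlab h m)) ` (hports h - {p}))" "leaf_spots T'"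
    "is_edge T'" "Suc (br T') \<le> n" "\<forall>U t. t \<in> hrel U h \<longleftrightarrow> t p \<in> plain.sat crel U (\<lambda>m z. {t m}) T' (hlab h p)"
    using hedge_port[OF h] by (elim exE conjE)
  have pV: "hlab h p \<in> V" using hedge_ports(2)[OF h] AX_V by blast
  have off: "\<forall>(m, z)\<in>(\<lambda>m. (m, hlab h m)) ` (hports h - {p}). m \<notin> W \<longrightarrow> U z \<subseteq> Y m"
    using hsat_off[OF ts] unfolding W_def Y_def by auto
  have onW: "1 \<le> cnt m \<and> (\<exists>P S'. plain.wft C V A z P S' \<and> leaf_spots P \<and> br P \<le> cnt m \<and> psat P z \<subseteq> Y m)"
    if m: "(m, z) \<in> (\<lambda>m. (m, hlab h m)) ` (hports h - {p})" "m \<in> W" for m z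
  proof -
    have mq: "m \<in> hports h - {p}" "z = hlab h m" using m(1) by auto
    have "finite (Z \<inter> fst ` S m)" "Z \<inter> fst ` S m \<noteq> {}" using finS[OF mq(1)] m(2) unfolding W_def by auto
    then have "1 \<le> cnt m" unfolding cnt_def by (simp add: Suc_le_eq card_gt_0_iff)
    then show ?thesis using IH[OF mq(1)] unfolding mq(2) converts_def Y_def cnt_def by blast
  qed
  then have onW: "\<forall>(m, z)\<in>(\<lambda>m. (m, hlab h m)) ` (hports h - {p}). m \<in> W \<longrightarrow> 1 \<le> cnt m \<and>
      (\<exists>P S'. plain.wft C V A z P S' \<and> leaf_spots P \<and> br P \<le> cnt m \<and> psat P z \<subseteq> Y m)" by blast
  from prune[OF T'(1,2,4) pV off onW]
  obtain P S' where P: "plain.wft C V A (hlab h p) P S'" "leaf_spots P"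
    "br P \<le> (\<Sum>m\<in>W \<inter> fst ` (\<lambda>m. (m, hlab h m)) ` (hports h - {p}). cnt m)" "is_edge T' \<longrightarrow> is_edge P \<or> P = Free"
    "psat P (hlab h p) \<subseteq> plain.sat crel U (\<lambda>m z. Y m) T' (hlab h p)"
    by (elim exE conjE)
  have "(\<Sum>m\<in>W \<inter> fst ` (\<lambda>m. (m, hlab h m)) ` (hports h - {p}). cnt m) \<le> (\<Sum>m\<in>hports h - {p}. cnt m)"
    using finp by (intro sum_mono2) auto
  also have "\<dots> = card (\<Union>m\<in>hports h - {p}. Z \<inter> fst ` S m)"
    unfolding cnt_def
  proof (rule card_UN_disjoint[symmetric])
    show "\<forall>i\<in>hports h - {p}. \<forall>j\<in>hports h - {p}. i \<noteq> j \<longrightarrow> (Z \<inter> fst ` S i) \<inter> (Z \<inter> fst ` S j) = {}"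
      using disj by blast
  qed (use finp finS in auto)
  also have "(\<Union>m\<in>hports h - {p}. Z \<inter> fst ` S m) = Z \<inter> fst ` (\<Union>q\<in>hports h - {p}. S q)" by auto
  finally have br: "br P \<le> card (Z \<inter> fst ` (\<Union>q\<in>hports h - {p}. S q))" using P(3) by simp
  have "psat P (hlab h p) \<subseteq> hsat Z (Edge h p ts) (hlab h p)"
  proof
    fix a assume "a \<in> psat P (hlab h p)"
    then have a: "a \<in> plain.sat crel U (\<lambda>m z. Y m) T' (hlab h p)" using P(5) by blast
    from plain.sat_singletons[OF T'(1) a]
    obtain g where g: "\<forall>(m, z)\<in>(\<lambda>m. (m, hlab h m)) ` (hports h - {p}). g m \<in> Y m \<inter> U z"
      "a \<in> plain.sat crel U (\<lambda>m z. {g m}) T' (hlab h p)" by (elim exE conjE)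
    have "plain.sat crel U (\<lambda>m z. {g m}) T' (hlab h p) = plain.sat crel U (\<lambda>m z. {(g(p := a)) m}) T' (hlab h p)"
      by (rule plain.sat_cong[OF T'(1)]) auto
    then have t: "g(p := a) \<in> hrel U h" unfolding T'(5)[rule_format] using g(2) by simp
    have "a \<in> U (hlab h p)" using a plain.sat_subset by (rule rev_subsetD)
    moreover have "(g(p := a)) q \<in> hsat Z (ts q) (hlab h q)" if "q \<in> hports h - {p}" for q
    proof -
      have "(q, hlab h q) \<in> (\<lambda>m. (m, hlab h m)) ` (hports h - {p})" using that by (rule imageI)
      from bspec[OF g(1) this] show ?thesis using that unfolding Y_def by simp
    qed
    ultimately show "a \<in> hsat Z (Edge h p ts) (hlab h p)"
      unfolding full.sat.simps using t by (intro CollectI conjI bexI[of _ "g(p := a)"] ballI) simp_all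
  qed
  then show ?thesis using P(1,2,4) br T'(3) unfolding converts_def by (intro exI[of _ P]) blast
qed

text \<open>Each hyperedge has few leaves, but a tree of hyperedges may have any number; the
  resulting tree of constraints pays only for the spots in \<open>Z\<close>. At labels in
  \<open>X\<close> there are no spots, so the root stays free and trees can be glued there.\<close>

lemma converts_exists:
  assumes "full.wft H X A x T S" "x \<in> A \<union> X"
  shows "\<exists>P. converts Z x T S P \<and> (x \<in> X \<longrightarrow> root_free P)"
  using assms
proof (induction rule: full.wft.induct)
  case (wft_Free x)
  show ?case by (rule exI[of _ Free]) (use Es_U in \<open>auto simp: converts_def intro: plain.wft.intros\<close>)
next
  case (wft_Spot x m)
  have x: "x \<notin> X" using wft_Spot X_A by blast
  show ?case
  proof (cases "m \<in> Z")
    case True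
    have "converts Z x (Spot m) {(m, x)} (Spot 0)"
      using True wft_Spot Es_U[of x] unfolding converts_def by (auto simp: on_def intro: plain.wft.intros)
    then show ?thesis using x by blast
  next
    case False
    have "converts Z x (Spot m) {(m, x)} Free"
      using False Es_U[of x] unfolding converts_def by (auto simp: on_def intro: plain.wft.intros)
    then show ?thesis using x by blast
  qed
next
  case (wft_Meet x T1 S1 T2 S2)
  obtain P1 S1' where P1: "plain.wft C V A x P1 S1'" "leaf_spots P1" "br P1 \<le> card (Z \<inter> fst ` S1)"
    "psat P1 x \<subseteq> hsat Z T1 x" "root_free P1"
    using wft_Meet.IH(1)[OF wft_Meet.prems] wft_Meet(1) unfolding converts_def by blast
  obtain P2 S2' where P2: "plain.wft C V A x P2 S2'" "leaf_spots P2" "br P2 \<le> card (Z \<inter> fst ` S2)"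
    "psat P2 x \<subseteq> hsat Z T2 x" "root_free P2"
    using wft_Meet.IH(2)[OF wft_Meet.prems] wft_Meet(1) unfolding converts_def by blast
  let ?P = "Meet (rename_spots (\<lambda>m. 2 * m) P1) (rename_spots (\<lambda>m. 2 * m + 1) P2)"
  have xV: "x \<in> V" using wft_Meet(1) X_V by blast
  have wft: "plain.wft C V A x ?P (map_prod (\<lambda>m. 2 * m) id ` S1' \<union> map_prod (\<lambda>m. 2 * m + 1) id ` S2')"
  proof (rule plain.wft_Meet[OF xV plain.wft_rename[OF P1(1)] plain.wft_rename[OF P2(1)]])
    show "inj (\<lambda>m :: nat. 2 * m)" "inj (\<lambda>m :: nat. 2 * m + 1)" by (auto intro: injI)
    show "fst ` map_prod (\<lambda>m. 2 * m) id ` S1' \<inter> fst ` map_prod (\<lambda>m :: nat. 2 * m + 1) id ` S2' = {}"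
      by (auto) presburger
  qed
  have fin: "finite S1" "finite S2" using full.wft_finite[OF _ wft_Meet(2)] full.wft_finite[OF _ wft_Meet(3)] hedge_ports(1) by blast+
  have "card (Z \<inter> fst ` (S1 \<union> S2)) = card (Z \<inter> fst ` S1) + card (Z \<inter> fst ` S2)"
    unfolding image_Un Int_Un_distrib using fin wft_Meet(4) by (intro card_Un_disjoint) auto
  then have "br ?P \<le> card (Z \<inter> fst ` (S1 \<union> S2))" using P1(3) P2(3) by simp
  moreover have "psat ?P x \<subseteq> hsat Z (Meet T1 T2) x"
    using P1(4) P2(4) unfolding plain.sat.simps full.sat.simps plain.sat_rename by blast
  moreover have "leaf_spots ?P" "root_free ?P" using P1 P2 by simp_all
  ultimately show ?case using wft unfolding converts_def by (intro exI[of _ ?P]) blast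
next
  case (wft_Edge x h p ts S)
  have "\<exists>P. converts Z (hlab h p) (Edge h p ts) (\<Union>q\<in>hports h - {p}. S q) P \<and> (is_edge P \<or> P = Free)"
  proof (rule converts_edge[OF wft_Edge(2,3,5,6)])
    fix q assume q: "q \<in> hports h - {p}"
    then have "hlab h q \<in> A \<union> X" using hedge_ports(2)[OF wft_Edge(2)] by blast
    then show "\<exists>P. converts Z (hlab h q) (ts q) (S q) P" using wft_Edge.IH[OF q] by blast
  qed
  then show ?case unfolding wft_Edge(4) using is_edge_root_free by auto
qed

end

section \<open>The Helly property for prescribed leaves\<close>

lemma card_le_1_subset: "finite A \<Longrightarrow> card A \<le> 1 \<Longrightarrow> \<exists>a. A \<subseteq> {a}"
  unfolding One_nat_def card_le_Suc0_iff_eq by blast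

lemma plain_wft_spots: "plain.wft C G Sp x T S \<Longrightarrow> (\<forall>(m, z)\<in>S. z \<in> Sp') \<Longrightarrow> plain.wft C G Sp' x T S"
proof (induction rule: plain.wft.induct)
  case (wft_Edge x c p ts S)
  show ?case
  proof (rule plain.wft.wft_Edge[OF wft_Edge(1-4)])
    fix q assume q: "q \<in> cports c - {p}"
    then have "\<forall>(m, z)\<in>S q. z \<in> Sp'" using wft_Edge.prems by blast
    then show "plain.wft C G Sp' (clab c q) (ts q) (S q)" by (rule wft_Edge.IH[OF q])
  qed (fact wft_Edge(6))
next
  case (wft_Meet x A S B S')
  show ?case by (rule plain.wft.wft_Meet[OF wft_Meet(1) _ _ wft_Meet(4)]) (use wft_Meet in simp_all)
qed (simp_all add: plain.wft.wft_Free plain.wft.wft_Spot)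

context stage
begin

text \<open>The root \<open>z\<close> is itself an assigned leaf, which leaves room for
  \<open>n - 1\<close> others in the invariant. As \<open>z\<close> is not in \<open>X\<close>, the
  case of substance is an edge attached at \<open>z\<close>, and \<open>converts_edge\<close>
  reduces it to the invariant.\<close>

lemma few_spots_below:
  assumes z: "z \<in> A" and T: "(T = Free \<and> S = {}) \<or> full.wft H X A z T S \<or> full.wfe H X A z T S"
    and Z: "Suc (card (Z \<inter> fst ` S)) \<le> n"
  shows "s z \<in> hsat Z T z"
  using T
proof (elim disjE)
  assume "T = Free \<and> S = {}"
  then show ?thesis using s_U[OF z] by simp
next
  assume "full.wft H X A z T S"
  then show ?thesis
  proof (cases rule: full.wft.cases)
    case wft_Free
    then show ?thesis using s_U[OF z] by simp
  next
    case (wft_Spot m)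
    then show ?thesis using s_U[OF z] by (simp add: on_def)
  qed (use z X_A in blast)+
next
  assume "full.wfe H X A z T S"
  then obtain h p ts Sq where e: "T = Edge h p ts" "S = (\<Union>q\<in>hports h - {p}. Sq q)" "h \<in> H" "p \<in> hports h" "hlab h p = z"
     "\<forall>q\<in>hports h - {p}. full.wft H X A (hlab h q) (ts q) (Sq q)"
     "\<forall>q\<in>hports h - {p}. \<forall>q'\<in>hports h - {p}. q \<noteq> q' \<longrightarrow> fst ` Sq q \<inter> fst ` Sq q' = {}"
    unfolding full.wfe_def by (elim exE conjE)
  have "\<exists>P. converts Z (hlab h p) (Edge h p ts) (\<Union>q\<in>hports h - {p}. Sq q) P \<and> (is_edge P \<or> P = Free)"
  proof (rule converts_edge[OF e(3,4)])
    fix q assume q: "q \<in> hports h - {p}"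
    show "full.wft H X A (hlab h q) (ts q) (Sq q)" using e(6) q by blast
    then show "\<exists>P. converts Z (hlab h q) (ts q) (Sq q) P"
      using converts_exists hedge_ports(2)[OF e(3)] q by blast
  qed (use e(7) in blast)
  then obtain P where P: "converts Z z T S P" "is_edge P \<or> P = Free" unfolding e(1,2,5)[symmetric] by blast
  then obtain S' where P': "plain.wft C V A z P S'" "leaf_spots P" "br P \<le> card (Z \<inter> fst ` S)" "psat P z \<subseteq> hsat Z T z"
    unfolding converts_def by blast
  have "s z \<in> psat P z"
    using P(2)
  proof
    assume "is_edge P"
    moreover have "Suc (br P) \<le> n" using P'(3) Z by simp
    ultimately show ?thesis using good z P'(1,2) unfolding good_def by blast
  qed (use s_in[OF z] in simp)
  then show ?thesis using P'(4) by blast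
qed

text \<open>The invariant says nothing at a root that has no value yet. Seen from one of its
  prescribed spots, the same tree is rooted at an assigned variable.\<close>

lemma few_spots:
  assumes x: "x \<in> X" and T: "full.wft H X A x T S" and Z: "card (Z \<inter> fst ` S) \<le> n"
  shows "hsat Z T x \<noteq> {}"
proof (cases "Z \<inter> fst ` S = {}")
  case True
  then show ?thesis using hsat_off[OF T True] Es_nonempty[of x "l + 1"] x X_V l by auto
next
  case False
  then obtain m z where m: "(m, z) \<in> S" "m \<in> Z" by auto
  have fin: "finite S" using full.wft_finite[OF _ T] hedge_ports(1) by blast
  have d: "fst ` S \<inter> fst ` ({} :: (nat \<times> 'x) set) = {}" by simp
  from full.reroot[OF T m(1) disjI1[OF conjI[OF refl refl]] d]
  obtain T' S' where T': "(T' = Free \<and> S' = {}) \<or> full.wft H X A z T' S' \<or> full.wfe H X A z T' S'"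
    "S' = S - {(m, z)} \<union> {}"
    "\<forall>R U (dec :: nat \<Rightarrow> 'x \<Rightarrow> 'd set). full.sat R U dec T x \<inter> full.sat R U dec Free x \<noteq> {} \<longleftrightarrow>
       full.sat R U dec T' z \<inter> dec m z \<inter> U z \<noteq> {}"
    by (elim exE conjE)
  have z: "z \<in> A" by (rule full.wft_spot_label[OF T m(1)])
  have "fst ` S' \<subseteq> fst ` S - {m}"
  proof
    fix k assume "k \<in> fst ` S'"
    then obtain ky where ky: "ky \<in> S" "ky \<noteq> (m, z)" "k = fst ky" unfolding T'(2) by blast
    define y where "y = snd ky"
    have y: "(k, y) \<in> S" "(k, y) \<noteq> (m, z)" using ky unfolding y_def by simp_all
    have "k \<noteq> m" using inj_onD[OF full.wft_inj_fst[OF T] _ y(1) m(1)] y(2) by auto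
    then show "k \<in> fst ` S - {m}" using y(1) by force
  qed
  moreover have "m \<in> Z \<inter> fst ` S" using m by force
  ultimately have "Z \<inter> fst ` S' \<subset> Z \<inter> fst ` S" by blast
  then have "card (Z \<inter> fst ` S') < card (Z \<inter> fst ` S)" using fin by (intro psubset_card_mono) auto
  then have "s z \<in> hsat Z T' z" using Z by (intro few_spots_below[OF z T'(1)]) simp
  then have "hsat Z T' z \<inter> on Z m z \<inter> U z \<noteq> {}" using m(2) s_U[OF z] by (auto simp: on_def)
  then have "hsat Z T x \<inter> hsat Z Free x \<noteq> {}" using T'(3) by blast
  then show ?thesis by blast
qed

text \<open>Near unanimity works at each spot separately, so different spots may be violated by
  different arguments.\<close>

lemma hsat_apply:
  assumes T: "full.wft H X A x T S" and v: "\<And>i. i < Suc n \<Longrightarrow> v i \<in> hsat (Z' i) T x"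
    and Z: "\<And>m z. (m, z) \<in> S \<Longrightarrow> m \<in> Z \<Longrightarrow> \<exists>i0. \<forall>i<Suc n. i \<noteq> i0 \<longrightarrow> m \<in> Z' i"
  shows "F v \<in> hsat Z T x"
proof (rule full.sat_apply[where F = F and N = "Suc n" and v = v and dec = "\<lambda>i. on (Z' i)"
      and R = "\<lambda>_. hrel U" and U = "\<lambda>_. U", OF T])
  fix m z and v :: "nat \<Rightarrow> 'd" assume m: "(m, z) \<in> S" and v: "\<And>i. i < Suc n \<Longrightarrow> v i \<in> on (Z' i) m z \<inter> U z"
  show "F v \<in> on Z m z"
  proof (cases "m \<in> Z")
    case True
    then obtain i0 where i0: "\<forall>i<Suc n. i \<noteq> i0 \<longrightarrow> m \<in> Z' i" using Z[OF m] by blast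
    have "F v = s z"
    proof (rule F_s[OF full.wft_spot_label[OF T m]])
      show "v i = s z" if "i < Suc n" "i \<noteq> i0" for i using v[OF that(1)] i0 that by (simp add: on_def)
    qed (use v in blast)
    then show ?thesis by (simp add: on_def)
  qed (simp add: on_def)
qed (use hrel_apply Es_F v in auto)

text \<open>The Baker-Pixley argument: among more than \<open>n\<close> prescriptions choose
  \<open>n + 1\<close>, drop each of these in turn, and apply \<open>F\<close> to the
  \<open>n + 1\<close> solutions. Every prescription is missing for at most one argument.\<close>

lemma helly:
  assumes x: "x \<in> X" and T: "full.wft H X A x T S"
  shows "hsat Z T x \<noteq> {}"
proof (induction "card (Z \<inter> fst ` S)" arbitrary: Z rule: less_induct)
  case less
  have fin: "finite S" using full.wft_finite[OF _ T] hedge_ports(1) by blast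
  show ?case
  proof (cases "card (Z \<inter> fst ` S) \<le> n")
    case True
    then show ?thesis by (rule few_spots[OF x T])
  next
    case False
    then obtain B where B: "B \<subseteq> Z \<inter> fst ` S" "card B = Suc n" "finite B"
      using obtain_subset_with_card_n[of "Suc n" "Z \<inter> fst ` S"] by auto
    obtain g where g: "bij_betw g {0..<Suc n} B" using ex_bij_betw_nat_finite[OF B(3)] B(2) by auto
    have "\<exists>a. a \<in> hsat (Z - {g i}) T x" if i: "i < Suc n" for i
    proof -
      have "g i \<in> Z \<inter> fst ` S" using g i B(1) by (auto simp: bij_betw_def)
      then have "(Z - {g i}) \<inter> fst ` S \<subset> Z \<inter> fst ` S" by blast
      then have "card ((Z - {g i}) \<inter> fst ` S) < card (Z \<inter> fst ` S)" using fin by (intro psubset_card_mono) auto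
      from less[OF this] show ?thesis by blast
    qed
    then have "\<forall>i. \<exists>a. i < Suc n \<longrightarrow> a \<in> hsat (Z - {g i}) T x" by blast
    from choice[OF this] obtain v where v: "\<And>i. i < Suc n \<Longrightarrow> v i \<in> hsat (Z - {g i}) T x" by blast
    have "F v \<in> hsat Z T x"
    proof (rule hsat_apply[OF T v])
      fix m z assume m: "m \<in> Z"
      show "\<exists>i0. \<forall>i<Suc n. i \<noteq> i0 \<longrightarrow> m \<in> Z - {g i}"
      proof (cases "\<exists>i0<Suc n. g i0 = m")
        case True
        then obtain i0 where i0: "i0 < Suc n" "g i0 = m" by blast
        have "g i \<noteq> m" if "i < Suc n" "i \<noteq> i0" for i
          using bij_betw_imp_inj_on[OF g] that i0 by (auto dest: inj_onD)
        then show ?thesis using m by blast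
      qed (use m in blast)
    qed
    then show ?thesis by blast
  qed
qed

section \<open>The multisorted instance on \<open>X\<close>\<close>

definition xports :: "'x \<times> ('x, 'd) bin_constraint gtree \<times> (nat \<times> 'x) set \<Rightarrow> nat set" where
  "xports h = {p \<in> hports h. hlab h p \<in> X}"

definition Q :: "'x \<Rightarrow> 'd set" where
  "Q x = (if x \<in> X then U x else {})"

definition R' :: "'x \<times> ('x, 'd) bin_constraint gtree \<times> (nat \<times> 'x) set \<Rightarrow> (nat \<Rightarrow> 'd) set" where
  "R' h = {t \<in> hrel U h. \<forall>p\<in>hports h. hlab h p \<in> A \<longrightarrow> t p = s (hlab h p)}"

lemma hedge_R':
  assumes h: "h \<in> H" and T: "\<And>i. i < Suc n \<Longrightarrow> T i \<in> hrel U h" and c: "card {i. i < Suc n \<and> T i \<notin> R' h} \<le> 1"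
  shows "(\<lambda>p. F (\<lambda>i. T i p)) \<in> R' h"
proof -
  have "\<exists>i0. {i. i < Suc n \<and> T i \<notin> R' h} \<subseteq> {i0}"
    using c by (intro card_le_1_subset) simp_all
  then obtain i0 where i0: "{i. i < Suc n \<and> T i \<notin> R' h} \<subseteq> {i0}" by blast
  have "F (\<lambda>i. T i p) = s (hlab h p)" if p: "p \<in> hports h" "hlab h p \<in> A" for p
  proof (rule F_s[OF p(2)])
    show "T i p = s (hlab h p)" if "i < Suc n" "i \<noteq> i0" for i
    proof -
      have "T i \<in> R' h" using i0 that by blast
      then show ?thesis using p by (simp add: R'_def)
    qed
  qed (use hrel_in[OF h T p(1)] in blast)
  moreover have "(\<lambda>p. F (\<lambda>i. T i p)) \<in> hrel U h" by (rule hrel_apply[OF h]) (rule T)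
  ultimately show ?thesis unfolding R'_def by blast
qed

sublocale nu: nu_instance xports hlab "Suc n" F H X Q "hrel U" R'
proof
  show "finite X" using X_V fin_V finite_subset by blast
  show "finite (Q x)" for x using finite_subset[OF Es_D fin_D] by (simp add: Q_def)
  show "finite (xports h)" if "h \<in> H" for h using hedge_ports(1)[OF that] by (simp add: xports_def)
  show "t p \<in> Q (hlab h p)" if "h \<in> H" "t \<in> hrel U h" "p \<in> xports h" for h t p
    using hrel_in[OF that(1,2)] that(3) by (simp add: xports_def Q_def)
  show "F v = a" if "\<And>i. i < Suc n \<Longrightarrow> v i \<in> Q x" "a \<in> Q x" "card {i. i < Suc n \<and> v i \<noteq> a} \<le> 1" for v x a
  proof (rule F_nu)
    have "Q x \<subseteq> D" using Es_D by (simp add: Q_def)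
    then show "\<And>i. i < Suc n \<Longrightarrow> v i \<in> D" "a \<in> D" using that(1,2) by blast+
  qed (fact that(3))
  show "\<exists>t\<in>hrel U h. t p = a" if "h \<in> H" "p \<in> xports h" "a \<in> Q (hlab h p)" for h p a
    using full_ac[OF that(1), of p a] that(2,3) by (auto simp: xports_def Q_def)
  show "F u = F v" if "\<And>i. i < Suc n \<Longrightarrow> u i = v i" for u v by (rule F_cong) (rule that)
qed (use hrel_apply hedge_R' in \<open>auto simp: xports_def Q_def R'_def\<close>)

text \<open>A path through ports in \<open>X\<close> unfolds into a path of \<open>n\<close>-trees
  whose relation is no larger. The value \<open>a\<close> belongs to level \<open>l\<close> because
  the two levels agree on \<open>X\<close>.\<close>

lemma nu_pq:
  assumes P: "nu.chain x P x" "nu.chain x P' x" "P \<noteq> []" "P' \<noteq> []" and a: "a \<in> Q x"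
  shows "\<exists>j. (a, a) \<in> nu.prel (hrel U) (concat (replicate j (P @ P')) @ P)"
proof -
  have path: "\<exists>ps. tree_path V C n x ps y \<and> (P \<noteq> [] \<longrightarrow> ps \<noteq> []) \<and> prls U ps \<subseteq> nu.prel (hrel U) P" if "nu.chain x P y" for x P y
    using that
  proof (induction P arbitrary: x)
    case Nil
    then show ?case by (intro exI[of _ "[]"]) simp
  next
    case (Cons e P)
    obtain h p q where e: "e = (h, p, q)" by (cases e)
    have h: "h \<in> H" "p \<in> hports h" "q \<in> hports h" "hlab h p = x" "nu.chain (hlab h q) P y"
      using Cons.prems unfolding e nu.chain.simps prod.case by (simp_all add: xports_def del: nu.chain.simps)
    obtain t where t: "n_tree_pattern V C n t" "vlabel t (beginning t) = hlab h p" "vlabel t (ending t) = hlab h q"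
      "\<forall>U. prl U t \<subseteq> {(r p, r q) |r. r \<in> hrel U h}"
      using hedge_pattern[OF h(1) AX_V h(2,3)] by (elim exE conjE)
    obtain ps where ps: "tree_path V C n (hlab h q) ps y" "prls U ps \<subseteq> nu.prel (hrel U) P" using Cons.IH[OF h(5)] by blast
    have "prls U (t # ps) \<subseteq> nu.prel (hrel U) (e # P)" 
      unfolding e prls.simps nu.prel.simps prod.case by (rule relcomp_mono[OF t(4)[rule_format] ps(2)])
    then show ?case using t(1-3) ps(1) h(4) by (intro exI[of _ "t # ps"]) simp
  qed
  have x: "x \<in> X" using a by (auto simp: Q_def split: if_splits)
  obtain ps where ps: "tree_path V C n x ps x" "ps \<noteq> []" "prls U ps \<subseteq> nu.prel (hrel U) P" using path[OF P(1)] P(3) by blast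
  obtain qs where qs: "tree_path V C n x qs x" "qs \<noteq> []" "prls U qs \<subseteq> nu.prel (hrel U) P'" using path[OF P(2)] P(4) by blast
  have "a \<in> Es l x" using a x X_eq[OF x] by (simp add: Q_def)
  from returns[OF l _ this ps(1,2) qs(1,2)] x X_V
  obtain j where j: "(a, a) \<in> (prls U ps O prls U qs) ^^ j O prls U ps" by blast
  have "(prls U ps O prls U qs) ^^ j \<subseteq> nu.prel (hrel U) (concat (replicate j (P @ P')))"
  proof (induction j)
    case (Suc j)
    have "(prls U ps O prls U qs) ^^ Suc j = (prls U ps O prls U qs) O (prls U ps O prls U qs) ^^ j"
      by (simp add: relpow_commute)
    also have "\<dots> \<subseteq> nu.prel (hrel U) (P @ P') O nu.prel (hrel U) (concat (replicate j (P @ P')))"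
      unfolding nu.prel_append using ps(3) qs(3) Suc by (intro relcomp_mono)
    also have "\<dots> = nu.prel (hrel U) (concat (replicate (Suc j) (P @ P')))"
      by (simp only: replicate.simps concat.simps nu.prel_append)
    finally show ?case .
  qed simp
  then have "(prls U ps O prls U qs) ^^ j O prls U ps \<subseteq> nu.prel (hrel U) (concat (replicate j (P @ P')) @ P)"
    unfolding nu.prel_append[of _ "concat _"] using ps(3) by (intro relcomp_mono)
  then show ?thesis using j by blast
qed

text \<open>Trees with the assigned values at their spots have solutions by \<open>helly\<close>. An
  argument from \<open>U\<close> outside the solution set solves the tree without prescriptions, and
  near unanimity restores every spot.\<close>

lemma absorbing_exists: "\<exists>D0. nu.absorbing_family D0"
proof -
  obtain K T S where T: "\<And>x. x \<in> X \<Longrightarrow> full.wft H X A x (T x) (S x)"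
    and K: "\<And>x. x \<in> X \<Longrightarrow> K x = full.sat (hrel U) U (\<lambda>m z. {s z}) (T x) x"
    and ac: "\<And>h p a. h \<in> H \<Longrightarrow> p \<in> hports h \<Longrightarrow> hlab h p \<in> X \<Longrightarrow> a \<in> K (hlab h p) \<Longrightarrow>
       \<exists>t\<in>hrel U h. t p = a \<and> (\<forall>q\<in>hports h - {p}. (hlab h q \<in> X \<longrightarrow> t q \<in> K (hlab h q)) \<and>
          (hlab h q \<in> A - X \<longrightarrow> t q \<in> {s (hlab h q)}))"
  proof (rule full.closure_family[where H = H and G = X and Sp = A and R = "hrel U" and U = U and E = "\<lambda>z. {s z}"])
    show "finite (U x)" for x using finite_subset[OF Es_D fin_D] .
  qed blast
  have onU: "on UNIV = (\<lambda>m z. {s z})" by (intro ext) (simp add: on_def)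
  note K = K[folded onU]
  define D0 where "D0 x = (if x \<in> X then K x else {})" for x
  have "nu.tol 1 (D0 x) (Q x)" for x
    unfolding nu.tol_def
  proof (intro conjI allI impI)
    show "D0 x \<subseteq> Q x" 
    proof (cases "x \<in> X")
      case True
      have "K x \<subseteq> U x" unfolding K[OF True] by (rule full.sat_subset)
      then show ?thesis using True by (simp add: D0_def Q_def)
    qed (simp add: D0_def)
    fix v assume v: "(\<forall>i<Suc n. v i \<in> Q x) \<and> card {i. i < Suc n \<and> v i \<notin> D0 x} \<le> 1"
    then have x: "x \<in> X" by (auto simp: Q_def split: if_splits)
    then have D0: "D0 x = K x" and Qx: "Q x = U x" by (simp_all add: D0_def Q_def)
    have "\<exists>i0. {i. i < Suc n \<and> v i \<notin> K x} \<subseteq> {i0}"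
      using v unfolding D0 by (intro card_le_1_subset) simp_all
    then obtain i0 where i0: "{i. i < Suc n \<and> v i \<notin> K x} \<subseteq> {i0}" by blast
    have "F v \<in> hsat UNIV (T x) x"
    proof (rule hsat_apply[OF T[OF x], where Z' = "\<lambda>i. if i = i0 then {} else UNIV"])
      fix i assume i: "i < Suc n"
      show "v i \<in> hsat (if i = i0 then {} else UNIV) (T x) x"
      proof (cases "i = i0")
        case True
        have "{} \<inter> fst ` S x = {}" by simp
        from hsat_off[OF T[OF x] this] show ?thesis using True v i Qx by auto
      next
        case False
        then have "v i \<in> K x" using i0 i by blast
        then show ?thesis using False K[OF x] by simp
      qed
    next
      show "\<exists>i0'. \<forall>i<Suc n. i \<noteq> i0' \<longrightarrow> m \<in> (if i = i0 then {} else UNIV)" for m :: nat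
        by (intro exI[of _ i0]) simp
    qed
    then show "F v \<in> D0 x" using D0 K[OF x] by simp
  qed
  moreover have "nu.arc_cons D0"
    unfolding nu.arc_cons_def
  proof (intro ballI)
    fix h p a assume h: "h \<in> H" and p: "p \<in> xports h" and a: "a \<in> D0 (hlab h p)"
    have p': "p \<in> hports h" "hlab h p \<in> X" using p by (auto simp: xports_def)
    have a': "a \<in> K (hlab h p)" using a p'(2) by (simp add: D0_def)
    obtain t where t: "t \<in> hrel U h" "t p = a" "\<forall>q\<in>hports h - {p}. (hlab h q \<in> X \<longrightarrow> t q \<in> K (hlab h q)) \<and>
          (hlab h q \<in> A - X \<longrightarrow> t q \<in> {s (hlab h q)})" using ac[OF h p' a'] by blast
    have "t q = s (hlab h q)" if q: "q \<in> hports h" "hlab h q \<in> A" for q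
    proof -
      have "hlab h q \<notin> X" using q(2) X_A by blast
      then have "q \<noteq> p" using p'(2) by blast
      then show ?thesis using t(3) q \<open>hlab h q \<notin> X\<close> by blast
    qed
    then have "t \<in> R' h" using t(1) by (simp add: R'_def)
    moreover have "t q \<in> D0 (hlab h q)" if "q \<in> xports h" for q
      using that a t(2,3) by (cases "q = p") (auto simp: xports_def D0_def)
    ultimately show "\<exists>t\<in>R' h. t p = a \<and> (\<forall>q\<in>xports h. t q \<in> D0 (hlab h q))" using t(2) by blast
  qed
  moreover have "D0 x \<noteq> {}" if "x \<in> X" for x using helly[OF that T[OF that]] K[OF that] that by (simp add: D0_def)
  ultimately show ?thesis unfolding nu.absorbing_family_def by blast
qed

lemma good_step: "\<exists>s'. good (l + 1) (A \<union> X) s'"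
proof -
  obtain D0 where "nu.absorbing_family D0" using absorbing_exists by blast
  then have "\<exists>s. (\<forall>x\<in>X. s x \<in> Q x) \<and> (\<forall>h\<in>H. xports h \<noteq> {} \<longrightarrow> (\<exists>t\<in>R' h. \<forall>p\<in>xports h. t p = s (hlab h p)))"
    by (rule nu.pq_solution) (rule nu_pq)
  then obtain s0 where s0: "\<forall>x\<in>X. s0 x \<in> Q x"
    "\<forall>h\<in>H. xports h \<noteq> {} \<longrightarrow> (\<exists>t\<in>R' h. \<forall>p\<in>xports h. t p = s0 (hlab h p))" by blast
  define s' where "s' x = (if x \<in> A then s x else s0 x)" for x
  have s'U: "s' x \<in> U x" if "x \<in> A \<union> X" for x
    using that s0(1) s_U[of x] by (auto simp: s'_def Q_def split: if_splits)
  have "s' x \<in> plain.sat crel U (\<lambda>m z. {s' z}) T x"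
    if x: "x \<in> A \<union> X" and wft: "plain.wft C V (A \<union> X) x T S" and T: "is_edge T" "leaf_spots T" "Suc (br T) \<le> n" for x T S
  proof -
    \<comment> \<open>Shifting the spots frees the number \<open>0\<close> for the root
      port.\<close>
    define T0 where "T0 = rename_spots Suc T"
    define S0 where "S0 = map_prod Suc id ` S"
    define h where "h = (x, T0, S0)"
    have wft0: "plain.wft C V (A \<union> X) x T0 S0" unfolding T0_def S0_def by (rule plain.wft_rename[OF wft]) simp
    have S00: "0 \<notin> fst ` S0" unfolding S0_def by auto
    have h: "h \<in> H" unfolding h_def hedges_def using x wft0 T S00 by (simp add: T0_def)
    note lab = hlab_eq[OF plain.wft_inj_fst[OF wft0] S00, of _ _ x T0, folded h_def]
    have "s' x \<in> plain.sat crel U (\<lambda>m z. {s' z}) T0 x"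
    \<comment> \<open>If no port is labelled in \<open>X\<close>, the new solution yields no tuple
      of \<open>h\<close>. All its ports are then assigned, and the old invariant passes from level
      \<open>l\<close> to \<open>l + 1\<close>, whose sets are larger.\<close>
    proof (cases "xports h = {}")
      case True
      have labA: "hlab h p \<in> A" if "p \<in> hports h" for p
        using hedge_ports(2)[OF h that] True that by (auto simp: xports_def)
      have lx: "hlab h 0 = x" using lab by simp
      have xA: "x \<in> A" using labA[of 0] lx by (simp add: hports_def)
      have SA: "z \<in> A" if "(m, z) \<in> S0" for m z
      proof -
        have "m \<in> hports h" using that by (force simp: hports_def h_def)
        then show ?thesis using labA[of m] lab[of m z] that by simp
      qed
      have wftA: "plain.wft C V A x T0 S0" by (rule plain_wft_spots[OF wft0]) (use SA in blast)
      have "s x \<in> plain.sat crel (Es l) (\<lambda>m z. {s z}) T0 x"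
        using good xA wftA T unfolding good_def T0_def by (auto simp only: rename_shape)
      moreover have "plain.sat crel (Es l) (\<lambda>m z. {s z}) T0 x \<subseteq> plain.sat crel U (\<lambda>m z. {s' z}) T0 x"
        by (rule plain.sat_mono[OF wftA]) (use Es_U SA in \<open>auto simp: s'_def\<close>)
      ultimately show ?thesis using xA by (auto simp: s'_def)
    next
      case False
      then obtain t where t: "t \<in> R' h" "\<forall>p\<in>xports h. t p = s0 (hlab h p)" using s0(2) h by blast
      have ts: "t p = s' (hlab h p)" if p: "p \<in> hports h" for p
      proof (cases "hlab h p \<in> A")
        case True
        then show ?thesis using t(1) p by (simp add: R'_def s'_def)
      next
        case False
        then have "p \<in> xports h" using hedge_ports(2)[OF h p] p by (simp add: xports_def)
        then show ?thesis using t(2) False by (simp add: s'_def)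
      qed
      have lx: "hlab h 0 = x" using lab by simp
      have "t 0 \<in> plain.sat crel U (\<lambda>m z. {t m}) T0 x" using t(1) by (simp add: R'_def hrel_def h_def)
      moreover have "plain.sat crel U (\<lambda>m z. {t m}) T0 x = plain.sat crel U (\<lambda>m z. {s' z}) T0 x"
      proof (rule plain.sat_cong[OF wft0])
        fix m z assume m: "(m, z) \<in> S0"
        then have "m \<in> hports h" by (force simp: hports_def h_def)
        then show "{t m} \<inter> U z = {s' z} \<inter> U z" using ts[of m] lab[of m z] m by simp
      qed
      moreover have "t 0 = s' x" using ts[of 0] lx by (simp add: hports_def)
      ultimately show ?thesis by simp
    qed
    then show ?thesis unfolding T0_def plain.sat_rename .
  qed
  then show ?thesis unfolding good_def using s'U by blast
qed

end

section \<open>Satisfiability\<close>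

context nu_csp
begin

lemma good_upto:
  "k \<le> card D \<Longrightarrow> \<exists>s. good (k + 1) {x \<in> V. \<exists>l\<in>{1..k}. Es l x = Es (l + 1) x} s"
proof (induction k)
  case 0
  then show ?case by (simp add: good_def)
next
  case (Suc k)
  let ?A = "{x \<in> V. \<exists>l\<in>{1..k}. Es l x = Es (l + 1) x}"
  obtain s where s: "good (k + 1) ?A s" using Suc by auto
  interpret stage D V C n F Es "k + 1" ?A s
    by unfold_locales (use Suc.prems s in auto)
  have "?A \<union> X = {x \<in> V. \<exists>l\<in>{1..Suc k}. Es l x = Es (l + 1) x}"
  proof -
    have e: "{1..Suc k} = insert (k + 1) {1..k}" by auto
    have "{x \<in> V. Q x} \<union> ({x \<in> V. P x} - {x \<in> V. Q x}) = {x \<in> V. P x \<or> Q x}" for P Q by blast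
    then show ?thesis unfolding X_def e by (simp only: bex_simps)
  qed
  then show ?case using good_step by simp
qed

text \<open>Strict growth throughout would give level \<open>k + 1\<close> at least
  \<open>k + 1\<close> elements, hence \<open>card D + 1\<close> elements at the top level, which is
  \<open>D\<close>.\<close>

lemma stable_level:
  assumes x: "x \<in> V" shows "\<exists>l\<in>{1..card D}. Es l x = Es (l + 1) x"
proof (rule ccontr)
  assume "\<not> ?thesis"
  then have ne: "Es l x \<noteq> Es (l + 1) x" if "l \<in> {1..card D}" for l using that by blast
  have fin: "finite (Es l x)" for l using finite_subset[OF Es_D fin_D] .
  have "k \<le> card D \<Longrightarrow> k + 1 \<le> card (Es (k + 1) x)" for k
  proof (induction k)
    case 0
    then show ?case using Es_nonempty[OF x, of 1] fin[of 1] by (simp add: Suc_le_eq card_gt_0_iff)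
  next
    case (Suc k)
    then have "Es (k + 1) x \<subset> Es (k + 1 + 1) x" using Es_mono[of "k + 1" x] ne[of "k + 1"] by auto
    from psubset_card_mono[OF fin this] show ?case using Suc by simp
  qed
  from this[of "card D"] show False using Es_top[OF x] by simp
qed

text \<open>Once every variable is assigned, a single constraint is a tree with two leaves, its root
  and one spot; \<open>n\<close> is large enough to admit it.\<close>

lemma instance_satisfiable: "satisfiable D V C"
proof -
  have "{x \<in> V. \<exists>l\<in>{1..card D}. Es l x = Es (l + 1) x} = V" using stable_level by blast
  then obtain s where s: "good (card D + 1) V s" using good_upto[of "card D"] by auto
  have "(s x, s y) \<in> R" if c: "((x, y), R) \<in> C" for x y R
  proof -
    let ?c = "((x, y), R)"
    let ?T = "Edge ?c 0 (\<lambda>_. Spot 0)"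
    have V: "x \<in> V" "y \<in> V" using bspec[OF C_V c] by simp_all
    have p: "0 \<in> cports ?c" by (simp add: cports_def)
    have "plain.wft C V V x ?T (\<Union>q\<in>cports ?c - {0}. {(0, clab ?c q)})"
      by (rule plain.wft.wft_Edge)
        (use V c p cports_minus[OF p] in \<open>auto simp: clab_def intro: plain.wft.wft_Spot\<close>)
    then have "s x \<in> plain.sat crel (Es (card D + 1)) (\<lambda>m z. {s z}) ?T x"
      using s V(1) n_ge unfolding good_def by fastforce
    then show ?thesis unfolding sat_Edge[OF p] by (auto simp: clab_def crel_def)
  qed
  moreover have "s x \<in> D" if "x \<in> V" for x using s that Es_D unfolding good_def by blast
  ultimately show ?thesis unfolding satisfiable_def by blast
qed

end

section \<open>Transfer of the return condition to the closed sets\<close>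

lemma prls_mono:
  assumes "\<And>x. x \<in> V \<Longrightarrow> U x \<subseteq> U' x"
  shows "tree_path V C n x ps y \<Longrightarrow> prls U ps \<subseteq> prls U' ps"
proof (induction ps arbitrary: x)
  case (Cons p ps)
  have "\<forall>v\<in>verts (graph_of p). U (vlabel p v) \<subseteq> U' (vlabel p v)"
    using Cons.prems assms unfolding tree_path.simps n_tree_pattern_def pattern_in_def by blast
  then have "prl U p \<subseteq> prl U' p" unfolding prl_def by blast
  then show ?case using Cons.prems unfolding prls.simps tree_path.simps by (elim conjE) (intro relcomp_mono Cons.IH)
qed simp

text \<open>Realizations of the same pattern are combined vertex by vertex, so the relations defined
  by patterns inherit the polymorphism.\<close>

lemma prls_apply:
  assumes F_C: "\<And>c t. c \<in> C \<Longrightarrow> (\<And>i. i < N \<Longrightarrow> t i \<in> crel c) \<Longrightarrow> (\<lambda>p. F (\<lambda>i. t i p)) \<in> crel c"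
    and F_U: "\<And>v x. (\<And>i. i < N \<Longrightarrow> v i \<in> U x) \<Longrightarrow> F v \<in> U x"
    and F_cong: "\<And>u v. (\<And>i. i < N \<Longrightarrow> u i = v i) \<Longrightarrow> F u = F v"
  shows "tree_path V C n x ps y \<Longrightarrow> (\<And>i. i < N \<Longrightarrow> (v i, w i) \<in> prls U ps) \<Longrightarrow> (F v, F w) \<in> prls U ps"
proof (induction ps arbitrary: x v)
  case Nil
  then show ?case using F_cong[of v w] by simp
next
  case (Cons p ps)
  have p: "pattern_in V C p" using Cons.prems(1) by (simp add: n_tree_pattern_def)
  have "\<forall>i. \<exists>u. i < N \<longrightarrow> (v i, u) \<in> prl U p \<and> (u, w i) \<in> prls U ps" using Cons.prems(2) by (auto elim!: relcompE)
  from choice[OF this] obtain u where u: "\<And>i. i < N \<Longrightarrow> (v i, u i) \<in> prl U p \<and> (u i, w i) \<in> prls U ps" by blast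
  have "\<forall>i. \<exists>r. i < N \<longrightarrow> v i = r (beginning p) \<and> u i = r (ending p) \<and> (\<forall>v\<in>verts (graph_of p). r v \<in> U (vlabel p v)) \<and>
     (\<forall>e\<in>arcs (graph_of p). (r (tail (graph_of p) e), r (head (graph_of p) e)) \<in> snd (elabel p e))"
    using u unfolding prl_def by blast
  from choice[OF this] obtain r where r: "\<forall>i. i < N \<longrightarrow> v i = r i (beginning p) \<and> u i = r i (ending p) \<and>
     (\<forall>v\<in>verts (graph_of p). r i v \<in> U (vlabel p v)) \<and>
     (\<forall>e\<in>arcs (graph_of p). (r i (tail (graph_of p) e), r i (head (graph_of p) e)) \<in> snd (elabel p e))" by blast
  have "(F (\<lambda>i. r i (beginning p)), F (\<lambda>i. r i (ending p))) \<in> prl U p"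
    unfolding prl_def
  proof (intro CollectI exI[of _ "\<lambda>v. F (\<lambda>i. r i v)"] conjI ballI)
    show "F (\<lambda>i. r i v) \<in> U (vlabel p v)" if "v \<in> verts (graph_of p)" for v
      by (rule F_U) (use r that in blast)
    fix e assume e: "e \<in> arcs (graph_of p)"
    let ?t = "\<lambda>i q. if q = (0 :: nat) then r i (tail (graph_of p) e) else r i (head (graph_of p) e)"
    have "(\<lambda>q. F (\<lambda>i. ?t i q)) \<in> crel (elabel p e)"
    proof (rule F_C)
      show "elabel p e \<in> C" using p e unfolding pattern_in_def by blast
      show "?t i \<in> crel (elabel p e)" if "i < N" for i using r that e by (simp add: crel_def)
    qed
    then show "(F (\<lambda>i. r i (tail (graph_of p) e)), F (\<lambda>i. r i (head (graph_of p) e))) \<in> snd (elabel p e)"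
      by (simp add: crel_def)
  qed simp
  moreover have "F v = F (\<lambda>i. r i (beginning p))" "F u = F (\<lambda>i. r i (ending p))" by (rule F_cong, use r in blast)+
  moreover have "(F u, F w) \<in> prls U ps" by (rule Cons.IH) (use Cons.prems(1) u in auto)
  ultimately show ?case by (auto intro: relcompI)
qed

lemma fclosure_mono: "B \<subseteq> B' \<Longrightarrow> fclosure N F B \<subseteq> fclosure N F B'"
proof
  fix a assume "B \<subseteq> B'" "a \<in> fclosure N F B"
  from this(2,1) show "a \<in> fclosure N F B'" by (induction rule: fclosure.induct) (auto intro: fclosure.intros)
qed

lemma relpow_mono: "P \<subseteq> Q \<Longrightarrow> P ^^ j \<subseteq> Q ^^ j" for P Q :: "('a \<times> 'a) set"
  by (induction j) (simp_all add: relcomp_mono)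

text \<open>Each list is replaced by one path of \<open>n\<close>-trees; the sums and multiples of
  the condition then become compositions and powers of relations.\<close>

lemma IPQ_returns:
  assumes ipq: "\<forall>p q. path_of_n_trees V C n p \<and> pattern_from_to p x x \<and> path_of_n_trees V C n q \<and> pattern_from_to q x x \<longrightarrow>
      (\<exists>j. a \<in> l_add D Ds l {a} (pmult j (p \<oplus>\<^sub>p q) \<oplus>\<^sub>p p))"
    and ps: "tree_path V C n x ps x" "ps \<noteq> []" and qs: "tree_path V C n x qs x" "qs \<noteq> []"
  shows "\<exists>j. (a, a) \<in> (prls (Ds (l + 1)) ps O prls (Ds (l + 1)) qs) ^^ j O prls (Ds (l + 1)) ps"
proof -
  let ?U = "Ds (l + 1)"
  obtain p where p: "path_of_n_trees V C n p" "pattern_from_to p x x" "prl ?U p \<subseteq> prls ?U ps"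
    using tree_path_pattern[OF ps] by blast
  obtain q where q: "path_of_n_trees V C n q" "pattern_from_to q x x" "prl ?U q \<subseteq> prls ?U qs"
    using tree_path_pattern[OF qs] by blast
  obtain j where "a \<in> l_add D Ds l {a} (pmult j (p \<oplus>\<^sub>p q) \<oplus>\<^sub>p p)" using ipq p(1,2) q(1,2) by blast
  then have a: "(a, a) \<in> prl ?U (pmult j (p \<oplus>\<^sub>p q) \<oplus>\<^sub>p p)" using l_add_subset_prl[of D Ds l "{a}"] by blast
  have pq: "vlabel p (ending p) = vlabel q (beginning q)" "vlabel p (beginning p) = x" "vlabel q (ending q) = x"
    using p(2) q(2) by (simp_all add: pattern_from_to_def)
  note l = vlabel_psum[OF pq(1)]
  have "vlabel (p \<oplus>\<^sub>p q) (ending (p \<oplus>\<^sub>p q)) = vlabel (p \<oplus>\<^sub>p q) (beginning (p \<oplus>\<^sub>p q))" using l pq by simp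
  note pm = prl_pmult[OF this, of ?U j]
  have "prl ?U (p \<oplus>\<^sub>p q) \<subseteq> prls ?U ps O prls ?U qs"
    using prl_psum[OF pq(1), of ?U] relcomp_mono[OF p(3) q(3)] by (rule subset_trans)
  from relpow_mono[OF this, of j] have "prl ?U (pmult j (p \<oplus>\<^sub>p q)) \<subseteq> (prls ?U ps O prls ?U qs) ^^ j"
    using pm by blast
  moreover have "prl ?U (pmult j (p \<oplus>\<^sub>p q) \<oplus>\<^sub>p p) \<subseteq> prl ?U (pmult j (p \<oplus>\<^sub>p q)) O prl ?U p"
    by (rule prl_psum) (use pm l pq in simp)
  ultimately show ?thesis using a p(3) by (intro exI[of _ j]) (meson relcomp_mono subsetD)
qed

theorem theorem3:
  fixes D :: "'d set" and \<Gamma> :: "('d \<times> 'd) set set"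
    and V :: "'x set" and C :: "('x, 'd) bin_constraint set" and n :: nat
  assumes "finite D"
    and "binary_language D \<Gamma>"
    and "n \<ge> 2"
    and "\<exists>f. polymorphism (n + 1) D \<Gamma> f \<and> near_unanimity (n + 1) D f"
    and "csp_instance \<Gamma> V C"
    and "IPQ n D V C"
  shows "satisfiable D V C"
proof -
  obtain f where f: "polymorphism (n + 1) D \<Gamma> f" "near_unanimity (n + 1) D f" using assms(4) by blast
  obtain Ds where Ds: "\<forall>y\<in>V. (\<forall>l\<in>{1..card D + 1}. Ds l y \<noteq> {}) \<and> (\<forall>l\<in>{1..card D}. Ds l y \<subseteq> Ds (l + 1) y) \<and> Ds (card D + 1) y = D"
    and ipq: "\<forall>x\<in>V. \<forall>l\<in>{1..card D}. \<forall>a\<in>Ds l x. \<forall>p q.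
        path_of_n_trees V C n p \<and> pattern_from_to p x x \<and> path_of_n_trees V C n q \<and> pattern_from_to q x x \<longrightarrow>
        (\<exists>j. a \<in> l_add D Ds l {a} (pmult j (p \<oplus>\<^sub>p q) \<oplus>\<^sub>p p))"
    using assms(6) unfolding IPQ_def by (elim exE conjE)
  define F where "F v = f (map v [0..<Suc n])" for v
  \<comment> \<open>The empty default outside the meaningful variables and levels makes closure
    under \<open>F\<close> and inclusion in \<open>D\<close> hold for all indices.\<close>
  define Es where "Es l x = (if x \<in> V \<and> l \<in> {1..card D + 1} then fclosure (Suc n) F (Ds l x) else {})" for l x
  have F_cong: "F u = F v" if "\<And>i. i < Suc n \<Longrightarrow> u i = v i" for u v
    unfolding F_def by (rule arg_cong[of _ _ f]) (use that in auto)
  have F_D: "F v \<in> D" if "\<And>i. i < Suc n \<Longrightarrow> v i \<in> D" for v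
  proof -
    have "set (map v [0..<Suc n]) \<subseteq> D" using that by auto
    then show ?thesis using f(1) unfolding F_def polymorphism_def operation_def by simp
  qed
  have F_C: "(\<lambda>p. F (\<lambda>i. t i p)) \<in> crel c" if c: "c \<in> C" and t: "\<And>i. i < Suc n \<Longrightarrow> t i \<in> crel c" for c t
  proof -
    let ?ps = "map (\<lambda>i. (t i 0, t i 1)) [0..<Suc n]"
    have "snd c \<in> \<Gamma>" using assms(5) c unfolding csp_instance_def by (cases c) auto
    moreover have "length ?ps = n + 1" "set ?ps \<subseteq> snd c" using t by (auto simp: crel_def)
    ultimately have "(f (map fst ?ps), f (map snd ?ps)) \<in> snd c" using f(1) unfolding polymorphism_def by blast
    then show ?thesis by (simp add: crel_def F_def comp_def del: upt_Suc)
  qed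
  have F_nu: "F v = a" if v: "\<And>i. i < Suc n \<Longrightarrow> v i \<in> D" and a: "a \<in> D" and c: "card {i. i < Suc n \<and> v i \<noteq> a} \<le> 1" for v a
  proof -
    obtain i0 where i0: "{i. i < Suc n \<and> v i \<noteq> a} \<subseteq> {i0}" using card_le_1_subset[OF _ c] by auto
    \<comment> \<open>If no argument deviates, \<open>i0\<close> may be out of range; position
      \<open>0\<close> is then overwritten with \<open>a\<close> itself.\<close>
    define k where "k = (if i0 < Suc n then i0 else 0)"
    have k: "k < Suc n" by (simp add: k_def)
    have "map v [0..<Suc n] = (replicate (n + 1) a)[k := v k]"
    proof (rule nth_equalityI)
      fix i assume "i < length (map v [0..<Suc n])"
      then have i: "i < Suc n" by simp
      have "v i = a" if "i \<noteq> k" using i0 i that by (auto simp: k_def split: if_splits)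
      then show "map v [0..<Suc n] ! i = (replicate (n + 1) a)[k := v k] ! i"
        using i k by (simp add: nth_list_update del: replicate.simps upt_Suc)
    qed (simp del: replicate.simps)
    then show ?thesis using f(2) a v[OF k] k unfolding near_unanimity_def F_def
      by (simp del: replicate.simps upt_Suc)
  qed
  have Ds_D: "Ds l x \<subseteq> D" if x: "x \<in> V" and l: "l \<in> {1..card D + 1}" for l x
  proof -
    have "l \<le> card D + 1" using l by simp
    then show ?thesis
    proof (induction rule: inc_induct)
      case base
      then show ?case using Ds x by simp
    next
      case (step k)
      then have "k \<in> {1..card D}" using l by simp
      then have "Ds k x \<subseteq> Ds (k + 1) x" using Ds x by blast
      then show ?case using step.IH by simp
    qed
  qed
  have closure_D: "fclosure (Suc n) F B \<subseteq> D" if "B \<subseteq> D" for B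
  proof
    fix a assume "a \<in> fclosure (Suc n) F B"
    then show "a \<in> D" by (induction rule: fclosure.induct) (use that F_D in auto)
  qed
  have closure_sub: "B \<subseteq> fclosure (Suc n) F B" for B by (auto intro: fclosure.base)
  have Es_eq: "Es l x = fclosure (Suc n) F (Ds l x)" if "x \<in> V" "l \<in> {1..card D + 1}" for l x
    using that by (simp add: Es_def)
  interpret nu_csp D V C n F Es
  proof
    show "finite V" using assms(5) by (simp add: csp_instance_def)
    show "\<forall>c\<in>C. fst (fst c) \<in> V \<and> snd (fst c) \<in> V" using assms(5) unfolding csp_instance_def by fastforce
    show "Es l x \<subseteq> D" for l x using closure_D Ds_D by (simp add: Es_def)
    show F_Es: "F v \<in> Es l x" if "\<And>i. i < Suc n \<Longrightarrow> v i \<in> Es l x" for v l x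
    proof -
      \<comment> \<open>The arity is positive, so argument \<open>0\<close> already shows that the
        set is not the empty default.\<close>
      have "x \<in> V \<and> l \<in> {1..card D + 1}" using that[of 0] by (auto simp: Es_def split: if_splits)
      then show ?thesis using that by (auto simp: Es_def intro: fclosure.step)
    qed
    show "Es l x \<noteq> {}" if "x \<in> V" "l \<in> {1..card D + 1}" for x l
    proof -
      have "Ds l x \<noteq> {}" using Ds that by blast
      then show ?thesis unfolding Es_eq[OF that] using closure_sub[of "Ds l x"] by blast
    qed
    show "Es l x \<subseteq> Es (l + 1) x" if "l \<in> {1..card D}" for l x
    proof (cases "x \<in> V")
      case True
      have "l \<in> {1..card D + 1}" "l + 1 \<in> {1..card D + 1}" using that by auto
      moreover have "Ds l x \<subseteq> Ds (l + 1) x" using Ds True that by blast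
      ultimately show ?thesis using fclosure_mono by (simp only: Es_eq True)
    qed (simp add: Es_def)
    show "Es (card D + 1) x = D" if "x \<in> V" for x
    proof -
      have "Es (card D + 1) x = fclosure (Suc n) F D" using Es_eq[OF that, of "card D + 1"] Ds that by simp
      then show ?thesis using closure_D[of D] closure_sub[of D] by blast
    qed
    show "\<exists>j. (a, a) \<in> (prls (Es (l + 1)) ps O prls (Es (l + 1)) qs) ^^ j O prls (Es (l + 1)) ps"
      if l: "l \<in> {1..card D}" and x: "x \<in> V" and a: "a \<in> Es l x" and ps: "tree_path V C n x ps x" "ps \<noteq> []"
        and qs: "tree_path V C n x qs x" "qs \<noteq> []" for l x a ps qs
    proof -
      let ?U = "Es (l + 1)"
      \<comment> \<open>Relations of closed tree paths at \<open>x\<close> over the enlarged sets: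
        composition is concatenation of lists, and \<open>F\<close> preserves them. The original
        elements still return, since enlarging the sets only adds realizations;
        \<open>fclosure_returns\<close> then passes this on to the closure.\<close>
      let ?G = "{prls ?U ps |ps. tree_path V C n x ps x \<and> ps \<noteq> []}"
      have sub: "Ds (l + 1) y \<subseteq> ?U y" if "y \<in> V" for y
        using Es_eq[OF that, of "l + 1"] closure_sub[of "Ds (l + 1) y"] l by simp
      show ?thesis
      proof (rule fclosure_returns[where \<G> = ?G and N = "Suc n" and F = F and B = "Ds l x"])
        show "P O Q \<in> ?G" if PQ: "P \<in> ?G" "Q \<in> ?G" for P Q
        proof -
          obtain ps qs where e: "P = prls ?U ps" "tree_path V C n x ps x" "ps \<noteq> []" "Q = prls ?U qs" "tree_path V C n x qs x"
            using PQ by blast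
          then have "P O Q = prls ?U (ps @ qs)" "tree_path V C n x (ps @ qs) x" by (auto simp: prls_append tree_path_append)
          then show ?thesis using e(3) by blast
        qed
        show "(F v, F w) \<in> P" if P: "P \<in> ?G" and vw: "\<And>i. i < Suc n \<Longrightarrow> (v i, w i) \<in> P" for P v w
        proof -
          obtain ps where e: "P = prls ?U ps" "tree_path V C n x ps x" using P by blast
          show ?thesis unfolding e(1)
            by (rule prls_apply[where N = "Suc n" and F = F and U = ?U, OF F_C F_Es F_cong e(2)]) (use vw e(1) in auto)
        qed
        show "\<exists>j. (b, b) \<in> (P O Q) ^^ j O P" if b: "b \<in> Ds l x" and PQ: "P \<in> ?G" "Q \<in> ?G" for b P Q
        proof -
          obtain ps qs where e: "P = prls ?U ps" "tree_path V C n x ps x" "ps \<noteq> []" "Q = prls ?U qs" "tree_path V C n x qs x" "qs \<noteq> []"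
            using PQ by blast
          obtain j where j: "(b, b) \<in> (prls (Ds (l + 1)) ps O prls (Ds (l + 1)) qs) ^^ j O prls (Ds (l + 1)) ps"
            using IPQ_returns[OF _ e(2,3,5,6), of b D Ds l] ipq x l b by blast
          have m: "prls (Ds (l + 1)) ps \<subseteq> P" "prls (Ds (l + 1)) qs \<subseteq> Q"
            unfolding e(1,4) using prls_mono[OF sub e(2)] prls_mono[OF sub e(5)] by auto
          have "(prls (Ds (l + 1)) ps O prls (Ds (l + 1)) qs) ^^ j O prls (Ds (l + 1)) ps \<subseteq> (P O Q) ^^ j O P"
            by (intro relcomp_mono relpow_mono m)
          then show ?thesis using j by blast
        qed
        show "a \<in> fclosure (Suc n) F (Ds l x)" using a by (auto simp: Es_def split: if_splits)
      qed (use ps qs F_cong in blast)+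
    qed
  qed (fact assms(1) assms(3) F_cong F_C F_nu)+
  show ?thesis by (rule instance_satisfiable)
qed

end
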